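(* Let $L$ be a finite-dimensional $n$-Lie algebra over a field $\mathbb{k}$, where $n=2,3$ (that is, a Lie algebra or a $3$-Lie algebra), and let $\mathcal L$ be a framed link which is the closure of a framed braid $b$. Let $\Psi_b$ be the linear map associated with $b$, and $\Psi(\mathcal L)$ its trace, as in the context. Then the map $\Psi_b$ depends only on the isotopy class of $\mathcal L$ and, therefore, $\Psi(\mathcal L)$ is a $\mathbb{k}$-valued invariant of $\mathcal L$.
   Context: A $3$-Lie algebra over $\mathbb{k}$ is a $\mathbb{k}$-vector space $L$ with a trilinear map $[\cdot,\cdot,\cdot]$ such that $[x_1,x_2,x_3]=\mathrm{sgn}(\sigma)[x_{\sigma(1)},x_{\sigma(2)},x_{\sigma(3)}]$ for every permutation $\sigma$ of $\{1,2,3\}$, and $[[x_1,x_2,x_3],x_4,x_5]=[[x_1,x_4,x_5],x_2,x_3]+[x_1,[x_2,x_4,x_5],x_3]+[x_1,x_2,[x_3,x_4,x_5]]$. A $2$-Lie algebra is an ordinary Lie algebra. Let $X=\mathbb{k}\oplus L$, with elements written as pairs $(a,x)$; tensor products are over $\mathbb{k}$. The comultiplication is $\Delta(a,x)=(a,x)\otimes(1,0)+(1,0)\otimes(0,x)$, with Sweedler notation $\Delta(x)=x^{(1)}\otimes x^{(2)}$, $(\mathbf 1\otimes\Delta)\Delta(x)=x^{(1)}\otimes x^{(2)}\otimes x^{(3)}$ for $x\in X$ (sums understood). The linear map $T:X^{\otimes 3}\to X$ is $T((a,x)\otimes(b,y)\otimes(c,z))=(abc,\ bcx+c[x,y]+b[x,z]+[[x,y],z])$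 if $L$ is a Lie algebra, and $T((a,x)\otimes(b,y)\otimes(c,z))=(abc,\ bcx+[x,y,z])$ if $L$ is a $3$-Lie algebra. The (invertible) linear maps $R$ on $X^{\otimes 2}\otimes X^{\otimes 2}$ and $\theta$ on $X^{\otimes 2}$ are $$R(x\otimes y\otimes z\otimes w)= z^{(1)}\otimes w^{(1)}\otimes T(x\otimes z^{(2)}\otimes w^{(2)})\otimes T(y\otimes z^{(3)}\otimes w^{(3)}),$$ $$\theta(x\otimes y)=T(x^{(1)}\otimes x^{(2)}\otimes y^{(2)})\otimes T(y^{(1)}\otimes x^{(3)}\otimes y^{(3)}).$$ The framed braid group $\mathbb{FB}_n=\mathbb{Z}^n\rtimes\mathbb{B}_n$ on $n$ strings has generators $\sigma_1,\dots,\sigma_{n-1}$ (standard braid generators, satisfying the braid relations) and $t_1,\dots,t_n$, with $t_it_j=t_jt_i$ and $\sigma_jt_i=t_{\tau_j(i)}\sigma_j$, where $\tau_j=(j\ j+1)$. Geometrically a framed braid is a braid of ribbons, $t_i$ being one full twist of the $i$-th ribbon (of the same sign as the twist produced by a ribbon self-crossing of the type $\sigma_i$); its closure is the framed link obtained by closing the ribbons in the standard way. That is, with the crossing $\sigma_i$ counted as $+1$, the framing of a component is its self-writhe in the closed braid diagram plus the sum of the twists on its strands. Every framed link is isotopic to the closure of a framed braid. Given a framed link $\mathcal L$, choose a framed braid $b\in\mathbb{FB}_n$ whose closure is isotopic to $\mathcal L$, with integer twists $t_1,\dots,t_n$ on the strings and underlying braid $\tau_n\in\mathbb{B}_n$,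 written as a product $\tau_n=\prod_j\sigma_{i_j}^{k_j}$ of braid generators. Set $R_{n,i}=\mathbf 1^{\otimes 2(i-1)}\otimes R\otimes\mathbf 1^{\otimes 2(n-i-1)}$ on $X^{\otimes 2n}$, and define $\Psi_b:X^{\otimes 2n}\to X^{\otimes 2n}$ by $$\Psi_b=\Big(\prod_j R_{n,i_j}^{k_j}\Big)\circ(\theta^{t_1}\otimes\cdots\otimes\theta^{t_n}),$$ the product being composition of maps. The trace of $\Psi_b$ is denoted $\Psi(\mathcal L)$.
   Formalization: The map Ψ_b is shown to depend only on the framed braid b as an element of FB_n, not on the isotopy class of the link (false: σ_1 and t_1 have isotopic closures but maps on different spaces); the trace is shown to depend only on the isotopy class of the framed link. *)

theory Defs
  imports "HOL-Analysis.Analysis" "HOL-Combinatorics.Permutations"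
    "HOL-Library.Function_Algebras"
begin

section \<open>Lie algebras and 3-Lie algebras\<close>

locale lie_algebra = vector_space sc
  for sc :: "'k::field \<Rightarrow> 'l::ab_group_add \<Rightarrow> 'l" +
  fixes bracket :: "'l \<Rightarrow> 'l \<Rightarrow> 'l"
  assumes linear_left: "Vector_Spaces.linear sc sc (\<lambda>x. bracket x y)"
    and linear_right: "Vector_Spaces.linear sc sc (\<lambda>y. bracket x y)"
    and alternating: "bracket x x = 0"
    and jacobi: "bracket (bracket x y) z + bracket (bracket y z) x + bracket (bracket z x) y = 0"

locale three_lie_algebra = vector_space sc
  for sc :: "'k::field \<Rightarrow> 'l::ab_group_add \<Rightarrow> 'l" +
  fixes bracket :: "'l \<Rightarrow> 'l \<Rightarrow> 'l \<Rightarrow> 'l"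
  assumes linear_1: "Vector_Spaces.linear sc sc (\<lambda>x. bracket x y z)"
    and linear_2: "Vector_Spaces.linear sc sc (\<lambda>y. bracket x y z)"
    and linear_3: "Vector_Spaces.linear sc sc (\<lambda>z. bracket x y z)"
    and skew_symmetric: "\<sigma> permutes {1, 2, 3::nat} \<Longrightarrow>
      bracket (v 1) (v 2) (v 3) =
        sc (of_int (sign \<sigma>)) (bracket (v (\<sigma> 1)) (v (\<sigma> 2)) (v (\<sigma> 3)))"
    and fundamental_identity:
      "bracket (bracket x1 x2 x3) x4 x5 =
        bracket (bracket x1 x4 x5) x2 x3 + bracket x1 (bracket x2 x4 x5) x3
        + bracket x1 x2 (bracket x3 x4 x5)"


section \<open>The space X, its comultiplication and the map T\<close>

definition scaleX :: "('k::field \<Rightarrow> 'l \<Rightarrow> 'l) \<Rightarrow> 'k \<Rightarrow> 'k \<times> 'l \<Rightarrow> 'k \<times> 'l" where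
  "scaleX sc c = (\<lambda>(a, x). (c * a, sc c x))"

text \<open>Elements of tensor products given by Sweedler sums are written as lists of pure tensors,
  read as their sum.\<close>

definition comult :: "'k::field \<times> 'l::zero \<Rightarrow> (('k \<times> 'l) \<times> ('k \<times> 'l)) list" where
  "comult = (\<lambda>(a, x). [((a, x), (1, 0)), ((1, 0), (0, x))])"

definition comult3 ::
    "'k::field \<times> 'l::zero \<Rightarrow> (('k \<times> 'l) \<times> ('k \<times> 'l) \<times> ('k \<times> 'l)) list" where
  "comult3 p = [(p1, p2, p3). (p1, q) \<leftarrow> comult p, (p2, p3) \<leftarrow> comult q]"

text \<open>A trilinear map \<open>X \<times> X \<times> X \<rightarrow> X\<close> stands for the linear map on \<open>X \<otimes> X \<otimes> X\<close>.\<close>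

definition lie_T :: "('k::field \<Rightarrow> 'l::ab_group_add \<Rightarrow> 'l) \<Rightarrow> ('l \<Rightarrow> 'l \<Rightarrow> 'l) \<Rightarrow>
    'k \<times> 'l \<Rightarrow> 'k \<times> 'l \<Rightarrow> 'k \<times> 'l \<Rightarrow> 'k \<times> 'l" where
  "lie_T sc bracket = (\<lambda>(a, x) (b, y) (c, z).
     (a * b * c,
      sc (b * c) x + sc c (bracket x y) + sc b (bracket x z) + bracket (bracket x y) z))"

definition three_lie_T :: "('k::field \<Rightarrow> 'l::ab_group_add \<Rightarrow> 'l) \<Rightarrow> ('l \<Rightarrow> 'l \<Rightarrow> 'l \<Rightarrow> 'l) \<Rightarrow>
    'k \<times> 'l \<Rightarrow> 'k \<times> 'l \<Rightarrow> 'k \<times> 'l \<Rightarrow> 'k \<times> 'l" where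
  "three_lie_T sc bracket = (\<lambda>(a, x) (b, y) (c, z).
     (a * b * c, sc (b * c) x + bracket x y z))"


section \<open>Tensor powers, induced linear maps and traces\<close>

text \<open>Over a field, the canonical map from the \<open>m\<close>-th tensor power of \<open>V\<close> to the dual of the space
  of \<open>m\<close>-linear forms on \<open>V\<close> is injective, so the tensor power is realised as its image: a pure
  tensor is evaluation of \<open>m\<close>-linear forms at a list of \<open>m\<close> vectors, and the tensor power is the
  span of the pure tensors. Lists of length other than \<open>m\<close> play no role, and evaluation is extended
  by 0 to functions that are not \<open>m\<close>-linear.\<close>

definition multilinear_form ::
    "('k::field \<Rightarrow> 'v::ab_group_add \<Rightarrow> 'v) \<Rightarrow> nat \<Rightarrow> ('v list \<Rightarrow> 'k) \<Rightarrow> bool" where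
  "multilinear_form sc m f \<longleftrightarrow>
     (\<forall>us vs. length us + 1 + length vs = m \<longrightarrow>
        Vector_Spaces.linear sc (*) (\<lambda>x. f (us @ x # vs)))"

type_synonym ('k, 'v) tensor = "('v list \<Rightarrow> 'k) \<Rightarrow> 'k"

definition scale_tensor :: "'k::field \<Rightarrow> ('k, 'v) tensor \<Rightarrow> ('k, 'v) tensor" where
  "scale_tensor c t = (\<lambda>f. c * t f)"

definition pure_tensor ::
    "('k::field \<Rightarrow> 'v::ab_group_add \<Rightarrow> 'v) \<Rightarrow> 'v list \<Rightarrow> ('k, 'v) tensor" where
  "pure_tensor sc xs = (\<lambda>f. if multilinear_form sc (length xs) f then f xs else 0)"

definition tensor_power ::
    "('k::field \<Rightarrow> 'v::ab_group_add \<Rightarrow> 'v) \<Rightarrow> nat \<Rightarrow> ('k, 'v) tensor set" where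
  "tensor_power sc m = module.span scale_tensor (pure_tensor sc ` {xs. length xs = m})"

text \<open>If the Sweedler sum \<open>F xs\<close> is multilinear in \<open>xs\<close> (of length \<open>m\<close>), this is the linear
  endomorphism of the \<open>m\<close>-th tensor power with \<open>pure_tensor sc xs \<mapsto> \<Sum>ys\<leftarrow>F xs. pure_tensor sc ys\<close>:
  a form \<open>f\<close> is pulled back to the form \<open>\<lambda>xs. \<Sum>ys\<leftarrow>F xs. f ys\<close>.\<close>

definition induced_map :: "('k::field \<Rightarrow> 'v::ab_group_add \<Rightarrow> 'v) \<Rightarrow> nat \<Rightarrow>
    ('v list \<Rightarrow> 'v list list) \<Rightarrow> ('k, 'v) tensor \<Rightarrow> ('k, 'v) tensor" where
  "induced_map sc m F t =
     (\<lambda>f. if multilinear_form sc m f then t (\<lambda>xs. \<Sum>ys\<leftarrow>F xs. f ys) else 0)"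

definition trace_on ::
    "('k::field \<Rightarrow> 'v::ab_group_add \<Rightarrow> 'v) \<Rightarrow> 'v set \<Rightarrow> ('v \<Rightarrow> 'v) \<Rightarrow> 'k" where
  "trace_on sc V g =
     (let B = (SOME B. \<not> module.dependent sc B \<and> module.span sc B = V)
      in \<Sum>b\<in>B. module.representation sc B (g b) b)"

text \<open>Integer powers of a bijection of \<open>V\<close>.\<close>

definition int_power :: "'a set \<Rightarrow> ('a \<Rightarrow> 'a) \<Rightarrow> int \<Rightarrow> 'a \<Rightarrow> 'a" where
  "int_power V g k = (if k \<ge> 0 then g ^^ nat k else inv_into V g ^^ nat (- k))"


section \<open>Framed braids\<close>

text \<open>An element of the semidirect product \<open>FB\<^sub>n = \<int>\<^sup>n \<rtimes> B\<^sub>n\<close>, with \<open>n\<close> the length of the first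
  component: the integer twists on the strings, and a word of syllables \<open>(i, k)\<close> for
  \<open>\<sigma>\<^sub>i\<^sup>k\<close>. Strings and generators are numbered from 1, so the twist \<open>t\<^sub>i\<close> is entry \<open>i - 1\<close>.\<close>

type_synonym framed_braid = "int list \<times> (nat \<times> int) list"

definition strands :: "framed_braid \<Rightarrow> nat" where
  "strands b = length (fst b)"

definition braid_word :: "nat \<Rightarrow> (nat \<times> int) list \<Rightarrow> bool" where
  "braid_word n w \<longleftrightarrow> (\<forall>(i, k) \<in> set w. 1 \<le> i \<and> i < n)"

definition framed_braid :: "framed_braid \<Rightarrow> bool" where
  "framed_braid b \<longleftrightarrow> strands b \<ge> 1 \<and> braid_word (strands b) (snd b)"

text \<open>Two words are related iff they represent the same element of the braid group on \<open>n\<close> strings;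
  the first four rules make this a congruence and the next two reduce syllables to powers.\<close>

inductive braid_eq :: "nat \<Rightarrow> (nat \<times> int) list \<Rightarrow> (nat \<times> int) list \<Rightarrow> bool" for n where
  refl: "braid_word n w \<Longrightarrow> braid_eq n w w"
| sym: "braid_eq n w w' \<Longrightarrow> braid_eq n w' w"
| trans: "braid_eq n w w' \<Longrightarrow> braid_eq n w' w'' \<Longrightarrow> braid_eq n w w''"
| congruence: "braid_word n u \<Longrightarrow> braid_word n v \<Longrightarrow> braid_eq n w w' \<Longrightarrow>
    braid_eq n (u @ w @ v) (u @ w' @ v)"
| power_0: "1 \<le> i \<Longrightarrow> i < n \<Longrightarrow> braid_eq n [(i, 0)] []"
| power_add: "1 \<le> i \<Longrightarrow> i < n \<Longrightarrow> braid_eq n [(i, k), (i, l)] [(i, k + l)]"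
| commute: "1 \<le> i \<Longrightarrow> i + 2 \<le> j \<Longrightarrow> j < n \<Longrightarrow> braid_eq n [(i, 1), (j, 1)] [(j, 1), (i, 1)]"
| braid: "1 \<le> i \<Longrightarrow> i + 1 < n \<Longrightarrow>
    braid_eq n [(i, 1), (i + 1, 1), (i, 1)] [(i + 1, 1), (i, 1), (i + 1, 1)]"

definition framed_braid_eq :: "framed_braid \<Rightarrow> framed_braid \<Rightarrow> bool" where
  "framed_braid_eq b b' \<longleftrightarrow> fst b = fst b' \<and> braid_eq (strands b) (snd b) (snd b')"


section \<open>Framed links and closures of framed braids\<close>

text \<open>A framed link is a finite nonempty disjoint union of tame ribbons (embedded annuli) in
  3-space. Tameness: the ribbons \<open>\<bar>u\<bar> \<le> 1\<close>, \<open>v = 0\<close> extend to an embedding of thickened, wider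
  ribbons; on this compact domain an embedding is an injective continuous map.\<close>

definition framed_link :: "(real ^ 3) set \<Rightarrow> bool" where
  "framed_link S \<longleftrightarrow>
     (\<exists>(c::nat) (e :: nat \<times> complex \<times> real \<times> real \<Rightarrow> real ^ 3).
        c \<ge> 1 \<and>
        continuous_on ({..<c} \<times> sphere 0 1 \<times> {-2..2} \<times> {-2..2}) e \<and>
        inj_on e ({..<c} \<times> sphere 0 1 \<times> {-2..2} \<times> {-2..2}) \<and>
        S = e ` ({..<c} \<times> sphere 0 1 \<times> {-1..1} \<times> {0}))"

definition isotopic :: "(real ^ 3) set \<Rightarrow> (real ^ 3) set \<Rightarrow> bool" where
  "isotopic S S' \<longleftrightarrow>
     (\<exists>H :: real \<times> (real ^ 3) \<Rightarrow> real ^ 3.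
        continuous_on ({0..1} \<times> UNIV) H \<and>
        (\<forall>s\<in>{0..1}. \<exists>g. homeomorphism UNIV UNIV (\<lambda>p. H (s, p)) g) \<and>
        (\<forall>p. H (0, p) = p) \<and>
        (\<lambda>p. H (1, p)) ` S = S')"

definition cylindrical :: "real \<Rightarrow> real \<times> real \<Rightarrow> real ^ 3" where
  "cylindrical \<phi> = (\<lambda>(r, z). vector [r * cos \<phi>, r * sin \<phi>, z])"

text \<open>The closed braid runs around the \<open>z\<close>-axis in the direction of increasing angle \<open>\<phi>\<close>, through
  one sector for the twists and then one for each syllable. A section gives, at time \<open>s \<in> [0, 1]\<close> of
  a sector, the intersection of the ribbons with the half-plane at that angle in the coordinates
  \<open>(r, z)\<close>: string \<open>p\<close> has its core at \<open>(p, 0)\<close> and its ribbon is the radial segment of half-width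
  \<open>1/4\<close>, except as follows. In the twist sector each ribbon rotates about its core. In the sector
  of \<open>\<sigma>\<^sub>i\<^sup>k\<close> the cores of strings \<open>i\<close> and \<open>i + 1\<close> rotate about their midpoint by \<open>k\<close> half turns, the
  ribbons staying radial, that is, flat in the projection along \<open>z\<close>. Both rotations take the outward
  radial direction to the downward one, so they are right-handed along the direction of travel: a
  crossing \<open>\<sigma>\<^sub>i\<close> is positive, and \<open>t\<^sub>i\<close> contributes \<open>+1\<close> to the framing.\<close>

definition twist_section :: "int list \<Rightarrow> real \<Rightarrow> (real \<times> real) set" where
  "twist_section ts s =
     {(real (p + 1) + u * cos (2 * pi * of_int (ts ! p) * s),
       - u * sin (2 * pi * of_int (ts ! p) * s)) | p u. p < length ts \<and> \<bar>u\<bar> \<le> 1/4}"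

definition crossing_section :: "nat \<Rightarrow> nat \<times> int \<Rightarrow> real \<Rightarrow> (real \<times> real) set" where
  "crossing_section n = (\<lambda>(i, k) s. let c = real i + 1/2 in
     {(c + (real p - c) * cos (pi * of_int k * s) + u,
       - (real p - c) * sin (pi * of_int k * s)) | p u. p \<in> {i, i + 1} \<and> \<bar>u\<bar> \<le> 1/4}
     \<union> {(real p + u, 0) | p u. p \<in> {1..n} - {i, i + 1} \<and> \<bar>u\<bar> \<le> 1/4})"

text \<open>Braid words are read from right to left, like the compositions of maps below.\<close>

definition sectors :: "framed_braid \<Rightarrow> (real \<Rightarrow> (real \<times> real) set) list" where
  "sectors b = twist_section (fst b) # map (crossing_section (strands b)) (rev (snd b))"

definition braid_closure :: "framed_braid \<Rightarrow> (real ^ 3) set" where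
  "braid_closure b =
     (\<Union>j<length (sectors b). \<Union>s\<in>{0..1}.
        cylindrical (2 * pi * (real j + s) / real (length (sectors b))) ` ((sectors b ! j) s))"


section \<open>The linear map of a framed braid and its trace\<close>

context
  fixes sc :: "'k::field \<Rightarrow> 'l::ab_group_add \<Rightarrow> 'l"
    and T :: "'k \<times> 'l \<Rightarrow> 'k \<times> 'l \<Rightarrow> 'k \<times> 'l \<Rightarrow> 'k \<times> 'l"
begin

definition R_sum :: "'k \<times> 'l \<Rightarrow> 'k \<times> 'l \<Rightarrow> 'k \<times> 'l \<Rightarrow> 'k \<times> 'l \<Rightarrow> ('k \<times> 'l) list list" where
  "R_sum x y z w =
     [[z1, w1, T x z2 w2, T y z3 w3]. (z1, z2, z3) \<leftarrow> comult3 z, (w1, w2, w3) \<leftarrow> comult3 w]"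

definition \<theta>_sum :: "'k \<times> 'l \<Rightarrow> 'k \<times> 'l \<Rightarrow> ('k \<times> 'l) list list" where
  "\<theta>_sum x y =
     [[T x1 x2 y2, T y1 x3 y3]. (x1, x2, x3) \<leftarrow> comult3 x, (y1, y2, y3) \<leftarrow> comult3 y]"

abbreviation X_power :: "nat \<Rightarrow> ('k, 'k \<times> 'l) tensor set" where
  "X_power \<equiv> tensor_power (scaleX sc)"

definition R_map :: "nat \<Rightarrow> nat \<Rightarrow> ('k, 'k \<times> 'l) tensor \<Rightarrow> ('k, 'k \<times> 'l) tensor" where
  "R_map n i = induced_map (scaleX sc) (2 * n) (\<lambda>xs. let m = 2 * (i - 1) in
     [take m xs @ ys @ drop (m + 4) xs.
        ys \<leftarrow> R_sum (xs ! m) (xs ! (m + 1)) (xs ! (m + 2)) (xs ! (m + 3))])"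

text \<open>The map \<open>\<theta>\<close> acting on the \<open>i\<close>-th factor \<open>X \<otimes> X\<close>.\<close>

definition \<theta>_map :: "nat \<Rightarrow> nat \<Rightarrow> ('k, 'k \<times> 'l) tensor \<Rightarrow> ('k, 'k \<times> 'l) tensor" where
  "\<theta>_map n i = induced_map (scaleX sc) (2 * n) (\<lambda>xs. let m = 2 * (i - 1) in
     [take m xs @ ys @ drop (m + 2) xs. ys \<leftarrow> \<theta>_sum (xs ! m) (xs ! (m + 1))])"

text \<open>The map \<open>\<theta>\<^bsup>t\<^sub>1\<^esup> \<otimes> \<dots> \<otimes> \<theta>\<^bsup>t\<^sub>n\<^esup>\<close> is the composition of the (commuting) maps
  \<open>\<one> \<otimes> \<dots> \<otimes> \<theta>\<^bsup>t\<^sub>i\<^esup> \<otimes> \<dots> \<otimes> \<one>\<close>.\<close>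

definition Psi_map :: "framed_braid \<Rightarrow> ('k, 'k \<times> 'l) tensor \<Rightarrow> ('k, 'k \<times> 'l) tensor" where
  "Psi_map b = (let n = strands b; V = X_power (2 * n) in
     foldr (\<circ>) (map (\<lambda>(i, k). int_power V (R_map n i) k) (snd b)) id
     \<circ> foldr (\<circ>) (map (\<lambda>i. int_power V (\<theta>_map n i) (fst b ! (i - 1))) [1..<n + 1]) id)"

definition Psi_trace :: "framed_braid \<Rightarrow> 'k" where
  "Psi_trace b = trace_on scale_tensor (X_power (2 * strands b)) (Psi_map b)"

definition Psi_link :: "(real ^ 3) set \<Rightarrow> 'k" where
  "Psi_link S = Psi_trace (SOME b. framed_braid b \<and> isotopic (braid_closure b) S)"

end

end

(*
  Grade the tensor powers of X = k + L by the number of factors in L. Both R and theta lower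
  this degree except for their leading terms, which are the exchange of two neighbouring pairs of
  factors and the identity. Hence they are invertible, and the trace of the map of a framed braid is
  the number of words in a basis of X, of length twice the number of strings, that are fixed by the
  permutation of the pairs of letters, i.e. (dim X)^(2c) in k, where c is the number of cycles of the
  underlying permutation. These cycles correspond to the connected components of the closure, and
  isotopies preserve the number of components.

  The braid relations are proved by evaluating multilinear forms: the Yang-Baxter equation for R
  follows from the cocommutativity of the comultiplication, the compatibility of T with it, and
  the self-distributivity of T.
*)

theory Submission
  imports Defs
begin

section \<open>Tensors and multilinear forms\<close>

text \<open>Isotopic closures may come from braids with different numbers of strings, whose maps act
  on different tensor powers. Maps are therefore compared only for equal elements of one framed
  braid group, and traces across all closures. Markov moves do not enter: an isotopy is used only
  through the homeomorphism at its final time.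

  The degree drops because the unit is group-like and T keeps the degree of its first argument: a
  nonzero summand of R or \<theta> other than the leading one replaces a factor in L by the unit,
  the factor itself being absorbed by the action.

  Components are not matched with cycles directly. Both sides are counted through colourings of the
  strings invariant under the permutation: in the algebra a colour is a pair of basis letters, in
  the topology a colouring is a function constant on components.

  Tensors are functionals on multilinear forms, so maps are studied through their transposes on
  forms. Identities of maps are asserted on the tensor power only, since inverses are arbitrary
  outside it.\<close>

lemma linear_iff_additive_homogeneous:
  assumes "vector_space s1" "vector_space s2"
  shows "Vector_Spaces.linear s1 s2 f \<longleftrightarrow> (\<forall>x y. f (x + y) = f x + f y) \<and> (\<forall>c x. f (s1 c x) = s2 c (f x))"
  using assms by (auto simp: Vector_Spaces.linear_def module_hom_def module_hom_axioms_def vector_space_def module_def)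

lemma vector_space_mult: "vector_space ((*) :: 'k::field \<Rightarrow> 'k \<Rightarrow> 'k)"
  by unfold_locales (auto simp: algebra_simps)

interpretation tensor: vector_space "scale_tensor :: 'k::field \<Rightarrow> ('k, 'v) tensor \<Rightarrow> ('k, 'v) tensor"
  by unfold_locales (auto simp: scale_tensor_def fun_eq_iff algebra_simps)

text \<open>The transpose of an induced map, acting on forms; composites of maps become composites
  of pulls in the opposite order.\<close>

definition pull :: "('v list \<Rightarrow> 'v list list) \<Rightarrow> ('v list \<Rightarrow> 'k) \<Rightarrow> 'v list \<Rightarrow> 'k::field" where
  "pull F f xs = (\<Sum>ys\<leftarrow>F xs. f ys)"

text \<open>The operator G on the r factors after the first m, tensored with identities on both
  sides.\<close>

definition local_op :: "nat \<Rightarrow> nat \<Rightarrow> ('v list \<Rightarrow> 'v list list) \<Rightarrow> 'v list \<Rightarrow> 'v list list" where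
  "local_op m r G xs = [take m xs @ ys @ drop (m + r) xs. ys \<leftarrow> G (take r (drop m xs))]"

text \<open>A list of summands is not an element of a vector space, so multilinearity of a Sweedler
  sum is expressed through its transpose.\<close>

definition multilinear_op :: "('k::field \<Rightarrow> 'v::ab_group_add \<Rightarrow> 'v) \<Rightarrow> nat \<Rightarrow> ('v list \<Rightarrow> 'v list list) \<Rightarrow> bool" where
  "multilinear_op sc r G \<longleftrightarrow>
     (\<forall>xs. length xs = r \<longrightarrow> (\<forall>ys\<in>set (G xs). length ys = r)) \<and>
     (\<forall>f. multilinear_form sc r f \<longrightarrow> multilinear_form sc r (pull G f))"

lemma induced_map_pull:
  "multilinear_form sc m f \<Longrightarrow> induced_map sc m F t f = t (pull F f)"
  by (simp add: induced_map_def pull_def[abs_def])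

lemma pull_local_op:
  assumes "length as = m" "length xs = r"
  shows "pull (local_op m r G) f (as @ xs @ bs) = pull G (\<lambda>ys. f (as @ ys @ bs)) xs"
  using assms by (simp add: pull_def local_op_def o_def)

lemma tensor_sum_list_apply: "(\<Sum>x\<leftarrow>xs. (f x :: ('k::field, 'v) tensor)) g = (\<Sum>x\<leftarrow>xs. f x g)"
  by (induction xs) auto

lemma linear_induced_map: "Vector_Spaces.linear scale_tensor scale_tensor (induced_map sc m F)"
  by unfold_locales (auto simp: induced_map_def scale_tensor_def fun_eq_iff)

context vector_space
begin

lemma linear_sum_list:
  assumes "\<And>i. i \<in> set is \<Longrightarrow> Vector_Spaces.linear scale (*) (f i)"
  shows "Vector_Spaces.linear scale (*) (\<lambda>x. \<Sum>i\<leftarrow>is. f i x)"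
proof -
  interpret k: vector_space "(*) :: 'a \<Rightarrow> 'a \<Rightarrow> 'a"
    by unfold_locales (auto simp: algebra_simps)
  interpret vector_space_pair scale "(*) :: 'a \<Rightarrow> 'a \<Rightarrow> 'a" ..
  show ?thesis
    using assms by (induction "is") (auto intro!: linear_compose_add linear_zero[unfolded])
qed

lemma multilinear_formD:
  "multilinear_form scale m f \<Longrightarrow> Suc (length us + length vs) = m \<Longrightarrow>
    Vector_Spaces.linear scale (*) (\<lambda>x. f (us @ x # vs))"
  by (simp add: multilinear_form_def)

lemma multilinear_form_zero:
  assumes "multilinear_form scale (length xs) f" "0 \<in> set xs"
  shows "f xs = 0"
proof -
  obtain us vs where xs: "xs = us @ 0 # vs"
    using assms(2) by (auto simp: in_set_conv_decomp)
  then interpret Vector_Spaces.linear scale "(*)" "\<lambda>x. f (us @ x # vs)"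
    using assms(1) by (intro multilinear_formD) auto
  show ?thesis
    using zero xs by simp
qed

lemma pure_tensor_zero: "0 \<in> set xs \<Longrightarrow> pure_tensor scale xs = 0"
  by (auto simp: pure_tensor_def fun_eq_iff multilinear_form_zero)

lemma pure_tensor_in_power: "length xs = m \<Longrightarrow> pure_tensor scale xs \<in> tensor_power scale m"
  unfolding tensor_power_def by (auto intro: tensor.span_base)

lemma subspace_tensor_power: "tensor.subspace (tensor_power scale m)"
  unfolding tensor_power_def by (rule tensor.subspace_span)

lemma multilinear_form_middle:
  assumes "multilinear_form scale N f" "length as + r + length bs = N"
  shows "multilinear_form scale r (\<lambda>ys. f (as @ ys @ bs))"
  unfolding multilinear_form_def
proof (intro allI impI)
  fix us vs :: "'b list" assume "length us + 1 + length vs = r"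
  then have "Suc (length (as @ us) + length (vs @ bs)) = N"
    using assms(2) by simp
  then have "Vector_Spaces.linear scale (*) (\<lambda>x. f ((as @ us) @ x # (vs @ bs)))"
    by (rule multilinear_formD[OF assms(1)])
  then show "Vector_Spaces.linear scale (*) (\<lambda>x. f (as @ (us @ x # vs) @ bs))"
    by simp
qed

text \<open>The varying entry lies before, inside or after the window of G. Outside the window the
  pulled-back form is a finite sum of values of f with that entry free; inside, the hypothesis on G
  applies to f with the outer entries fixed.\<close>

lemma multilinear_form_local:
  assumes f: "multilinear_form scale N f" and G: "multilinear_op scale r G" and "m + r \<le> N"
  shows "multilinear_form scale N (pull (local_op m r G) f)"
  unfolding multilinear_form_def
proof (intro allI impI)
  fix us vs :: "'b list" assume len: "length us + 1 + length vs = N"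
  consider "length us < m" | "m \<le> length us" "length us < m + r" | "m + r \<le> length us"
    by linarith
  then show "Vector_Spaces.linear scale (*) (\<lambda>x. pull (local_op m r G) f (us @ x # vs))"
  proof cases
    case 1
    define c where "c = m - Suc (length us)"
    define mid where "mid = take r (drop c vs)"
    have m: "m = Suc (length us + c)"
      using 1 by (simp add: c_def)
    have c: "c + r \<le> length vs" and mid: "length mid = r"
      using len \<open>m + r \<le> N\<close> m by (auto simp: mid_def)
    have "drop (c + r) vs = drop r (drop c vs)"
      by (simp add: add.commute)
    then have vs: "vs = take c vs @ mid @ drop (c + r) vs"
      by (simp only: mid_def append_take_drop_id)
    have "pull (local_op m r G) f (us @ x # vs) = pull G (\<lambda>ys. f (us @ x # take c vs @ ys @ drop (c + r) vs)) mid" for x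
      using pull_local_op[of "us @ x # take c vs" m mid r G f "drop (c + r) vs"] c m mid vs
      by simp
    moreover have "Vector_Spaces.linear scale (*) (\<lambda>x. pull G (\<lambda>ys. f (us @ x # take c vs @ ys @ drop (c + r) vs)) mid)"
      unfolding pull_def
    proof (intro linear_sum_list multilinear_formD[OF f])
      fix ys assume "ys \<in> set (G mid)"
      then have "length ys = r"
        using G mid by (auto simp: multilinear_op_def)
      then show "Suc (length us + length (take c vs @ ys @ drop (c + r) vs)) = N"
        using c len by simp
    qed
    ultimately show ?thesis
      by simp
  next
    case 2
    define us1 where "us1 = take m us"
    define us2 where "us2 = drop m us"
    define c where "c = r - Suc (length us2)"
    have us: "us = us1 @ us2" "length us1 = m"
      using 2 by (auto simp: us1_def us2_def)
    have c: "c \<le> length vs" "Suc (length us2 + c) = r"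
      using 2 len \<open>m + r \<le> N\<close> by (auto simp: c_def us2_def)
    have "pull (local_op m r G) f (us @ x # vs) =
        pull G (\<lambda>ys. f (us1 @ ys @ drop c vs)) (us2 @ x # take c vs)" for x
      using pull_local_op[of us1 m "us2 @ x # take c vs" r G f "drop c vs"] us(2) c
      by (simp add: us(1))
    moreover have "multilinear_form scale r (\<lambda>ys. f (us1 @ ys @ drop c vs))"
      using us(2) c len by (intro multilinear_form_middle[OF f]) (auto simp: us(1))
    then have "multilinear_form scale r (pull G (\<lambda>ys. f (us1 @ ys @ drop c vs)))"
      using G by (simp add: multilinear_op_def)
    then have "Vector_Spaces.linear scale (*) (\<lambda>x. pull G (\<lambda>ys. f (us1 @ ys @ drop c vs)) (us2 @ x # take c vs))"
      using c by (intro multilinear_formD) auto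
    ultimately show ?thesis
      by simp
  next
    case 3
    define mid where "mid = take r (drop m us)"
    have mid: "length mid = r"
      using 3 by (simp add: mid_def)
    have "drop (m + r) us = drop r (drop m us)"
      by (simp add: add.commute)
    then have us: "us = take m us @ mid @ drop (m + r) us"
      by (simp only: mid_def append_take_drop_id)
    have "pull (local_op m r G) f (us @ x # vs) = pull G (\<lambda>ys. f (take m us @ ys @ drop (m + r) us @ x # vs)) mid" for x
      using pull_local_op[of "take m us" m mid r G f "drop (m + r) us @ x # vs"] 3 mid
      by (metis add_leD1 append.assoc length_take min.absorb2 us)
    moreover have "Vector_Spaces.linear scale (*) (\<lambda>x. pull G (\<lambda>ys. f (take m us @ ys @ drop (m + r) us @ x # vs)) mid)"
      unfolding pull_def
    proof (rule linear_sum_list)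
      fix ys assume "ys \<in> set (G mid)"
      then have "length ys = r"
        using G mid by (auto simp: multilinear_op_def)
      then show "Vector_Spaces.linear scale (*) (\<lambda>x. f (take m us @ ys @ drop (m + r) us @ x # vs))"
        using multilinear_formD[OF f, of "take m us @ ys @ drop (m + r) us" vs] 3 len by simp
    qed
    ultimately show ?thesis
      by simp
  qed
qed

text \<open>A pure tensor tests multilinearity at its own length, so all summands must have length N
  for both sides to vanish on the same forms.\<close>

lemma induced_map_pure_tensor:
  assumes "\<And>f. multilinear_form scale N f \<Longrightarrow> multilinear_form scale N (pull F f)"
    and "length xs = N" "\<And>ys. ys \<in> set (F xs) \<Longrightarrow> length ys = N"
  shows "induced_map scale N F (pure_tensor scale xs) = (\<Sum>ys\<leftarrow>F xs. pure_tensor scale ys)"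
proof
  fix f
  have "(\<Sum>ys\<leftarrow>F xs. pure_tensor scale ys f) = (if multilinear_form scale N f then \<Sum>ys\<leftarrow>F xs. f ys else 0)"
    using assms(3) by (simp add: pure_tensor_def cong: map_cong)
  then show "induced_map scale N F (pure_tensor scale xs) f = (\<Sum>ys\<leftarrow>F xs. pure_tensor scale ys) f"
    using assms(1)[of f] assms(2) by (auto simp: tensor_sum_list_apply induced_map_def pure_tensor_def pull_def[abs_def])
qed

end

section \<open>Traces and injectivity on finite-dimensional subspaces\<close>

lemma tensor_sum_apply: "(\<Sum>i\<in>I. (h i :: ('k::field, 'v) tensor)) f = (\<Sum>i\<in>I. h i f)"
  by (induction I rule: infinite_finite_induct) auto

text \<open>The expansion writes the identity of V as a sum of rank-one maps, so g is the sum of the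
  maps sending t to \<open>\<phi> j t\<close> times \<open>g (e j)\<close>. Such a map has trace
  \<open>\<phi> j (g (e j))\<close> in any basis, in particular in the one chosen by
  \<open>SOME\<close>.\<close>

lemma (in vector_space) trace_on_eq_sum_dual:
  assumes V: "subspace V" and "finite J" and e: "\<And>j. j \<in> J \<Longrightarrow> e j \<in> V"
    and \<phi>: "\<And>j x y. \<phi> j (x + y) = \<phi> j x + \<phi> j y" "\<And>j c x. \<phi> j (scale c x) = c * \<phi> j x"
    and expand: "\<And>t. t \<in> V \<Longrightarrow> t = (\<Sum>j\<in>J. scale (\<phi> j t) (e j))"
    and g: "\<And>x. x \<in> V \<Longrightarrow> g x \<in> V" "\<And>x y. x \<in> V \<Longrightarrow> y \<in> V \<Longrightarrow> g (x + y) = g x + g y"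
      "\<And>c x. x \<in> V \<Longrightarrow> g (scale c x) = scale c (g x)"
  shows "trace_on scale V g = (\<Sum>j\<in>J. \<phi> j (g (e j)))"
proof -
  define C where "C = (SOME B. \<not> dependent B \<and> span B = V)"
  obtain B where "B \<subseteq> V" "independent B" "V \<subseteq> span B"
    by (rule basis_exists)
  then have "\<not> dependent B \<and> span B = V"
    using span_minimal[OF _ V] by blast
  then have "\<not> dependent C \<and> span C = V"
    unfolding C_def by (rule someI)
  then have C: "independent C" "span C = V"
    by blast+
  have "V \<subseteq> span (e ` J)"
  proof
    fix t assume "t \<in> V"
    have "(\<Sum>j\<in>J. scale (\<phi> j t) (e j)) \<in> span (e ` J)"
      by (intro span_sum span_scale span_base imageI)
    then show "t \<in> span (e ` J)"
      using expand[OF \<open>t \<in> V\<close>] by simp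
  qed
  then have "C \<subseteq> span (e ` J)"
    using C(2) span_superset by blast
  then have fin: "finite C"
    using independent_span_bound C(1) \<open>finite J\<close> by blast
  \<comment> \<open>Since g is additive on V only, the partial sums must be seen to stay in V; hence
    the induction over subsets of J.\<close>
  have g_sum: "g (\<Sum>j\<in>I. scale (a j) (e j)) = (\<Sum>j\<in>I. scale (a j) (g (e j)))" if "I \<subseteq> J" for a I
    using finite_subset[OF that \<open>finite J\<close>] that
  proof (induction I rule: finite_induct)
    case empty
    then show ?case
      using g(3)[OF subspace_0[OF V], of 0] by simp
  next
    case (insert i I)
    have "(\<Sum>j\<in>I. scale (a j) (e j)) \<in> V" "scale (a i) (e i) \<in> V"
      using insert e by (auto intro!: subspace_sum[OF V] subspace_scale[OF V])
    then show ?case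
      using insert e by (simp add: g)
  qed
  have \<phi>_sum: "\<phi> j (\<Sum>c\<in>C. scale (a c) c) = (\<Sum>c\<in>C. a c * \<phi> j c)" for j a
    using fin
  proof (induction C rule: finite_induct)
    case empty
    then show ?case
      using \<phi>(2)[of j 0 0] by simp
  qed (simp add: \<phi>)
  have "trace_on scale V g = (\<Sum>c\<in>C. representation C (g c) c)"
    by (simp add: trace_on_def C_def Let_def)
  also have "\<dots> = (\<Sum>c\<in>C. \<Sum>j\<in>J. \<phi> j c * representation C (g (e j)) c)"
  proof (intro sum.cong HOL.refl)
    fix c assume "c \<in> C"
    then have "c \<in> V"
      using C(2) span_base by blast
    then have "g c = (\<Sum>j\<in>J. scale (\<phi> j c) (g (e j)))"
      using g_sum[OF order_refl, of "\<lambda>j. \<phi> j c"] expand by metis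
    moreover have "scale (\<phi> j c) (g (e j)) \<in> span C" "g (e j) \<in> span C" if "j \<in> J" for j
      using g(1) e[OF that] C(2) subspace_scale[OF V] by auto
    ultimately show "representation C (g c) c = (\<Sum>j\<in>J. \<phi> j c * representation C (g (e j)) c)"
      using C(1) by (simp add: representation_sum representation_scale)
  qed
  also have "\<dots> = (\<Sum>j\<in>J. \<Sum>c\<in>C. representation C (g (e j)) c * \<phi> j c)"
    by (subst sum.swap) (simp add: mult.commute)
  also have "\<dots> = (\<Sum>j\<in>J. \<phi> j (g (e j)))"
  proof (intro sum.cong HOL.refl)
    fix j assume "j \<in> J"
    then have "g (e j) \<in> span C"
      using g(1) e C(2) by blast
    then have "(\<Sum>c\<in>C. scale (representation C (g (e j)) c) c) = g (e j)"
      using sum_representation_eq[OF C(1) _ fin order_refl] by blast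
    then show "(\<Sum>c\<in>C. representation C (g (e j)) c * \<phi> j c) = \<phi> j (g (e j))"
      using \<phi>_sum[of j "representation C (g (e j))"] by simp
  qed
  finally show ?thesis .
qed

text \<open>The ambient space of functionals may be infinite-dimensional, so the dimension count
  takes place inside the span: the image of a basis B spans and has at most as many elements as B,
  hence is again a basis of the same size.\<close>

lemma (in vector_space) surjective_imp_injective_on_span:
  assumes g: "Vector_Spaces.linear scale scale g" and "finite A" and surj: "g ` span A = span A"
  shows "inj_on g (span A)"
proof -
  interpret g: Vector_Spaces.linear scale scale g
    by (rule g)
  obtain B where B: "B \<subseteq> span A" "independent B" "span A \<subseteq> span B"
    by (rule basis_exists)
  then have span_B: "span B = span A"
    using span_minimal[OF B(1) subspace_span] by blast
  have fin: "finite B"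
    using independent_span_bound[OF \<open>finite A\<close> B(2,1)] by blast
  have span_gB: "span (g ` B) = span A"
    using g.span_image[of B] span_B surj by simp
  have "card B \<le> card (g ` B)"
    using independent_span_bound[of "g ` B" B] fin B span_gB by simp
  then have inj: "inj_on g B" and card: "card (g ` B) = card B"
    using card_image_le[OF fin, of g] eq_card_imp_inj_on[OF fin, of g] by auto
  have "independent (g ` B)"
  proof
    assume "dependent (g ` B)"
    then obtain a where a: "a \<in> g ` B" "a \<in> span (g ` B - {a})"
      unfolding dependent_def by blast
    then have "span (g ` B - {a}) = span A"
      using span_redundant[OF a(2)] span_gB by (simp add: insert_absorb)
    then have "card B \<le> card (g ` B - {a})"
      using independent_span_bound[of "g ` B - {a}" B] fin B by simp
    also have "\<dots> < card (g ` B)"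
      using a(1) fin by (intro psubset_card_mono) auto
    finally show False
      using card by simp
  qed
  then show ?thesis
    using g.inj_on_span_iff_independent_image[of B] inj span_B by simp
qed

section \<open>Words in a basis and the dual basis of a tensor power\<close>

definition words :: "'a set \<Rightarrow> nat \<Rightarrow> 'a list set" where
  "words B N = {I. length I = N \<and> set I \<subseteq> B}"

lemma finite_words: "finite B \<Longrightarrow> finite (words B N)"
  using finite_lists_length_eq[of B N] by (simp add: words_def conj_commute)

lemma words_0: "words B 0 = {[]}"
  by (auto simp: words_def)

lemma words_Suc: "words B (Suc N) = (\<lambda>(b, I). b # I) ` (B \<times> words B N)"
  by (auto simp: words_def length_Suc_conv image_iff)

text \<open>The product of the coordinate forms of the letters of I: the dual basis vector belonging
  to the word I.\<close>

definition dual_form :: "('v \<Rightarrow> 'v \<Rightarrow> 'k) \<Rightarrow> 'v list \<Rightarrow> 'v list \<Rightarrow> 'k::field" where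
  "dual_form coord I xs = (\<Prod>(b, x)\<leftarrow>zip I xs. coord b x)"

lemma dual_form_simps [simp]:
  "dual_form coord [] [] = 1"
  "dual_form coord (b # I) (x # xs) = coord b x * dual_form coord I xs"
  by (simp_all add: dual_form_def)

lemma dual_form_append:
  "length I = length xs \<Longrightarrow> dual_form coord (I @ J) (xs @ ys) = dual_form coord I xs * dual_form coord J ys"
  by (simp add: dual_form_def)

lemma dual_form_words:
  assumes "\<And>b c. b \<in> B \<Longrightarrow> c \<in> B \<Longrightarrow> coord b c = (if b = c then 1 else 0)" "I \<in> words B N" "J \<in> words B N"
  shows "dual_form coord I J = (if I = J then 1 else 0)"
  using assms(2,3)
proof (induction N arbitrary: I J)
  case (Suc N)
  then obtain b I' c J' where "I = b # I'" "J = c # J'" "b \<in> B" "c \<in> B" "I' \<in> words B N" "J' \<in> words B N"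
    by (auto simp: words_Suc)
  then show ?case
    using Suc.IH assms(1) by simp
qed (simp add: words_0)

context vector_space
begin

lemma multilinear_form_Cons:
  assumes "multilinear_form scale (Suc N) f"
  shows "multilinear_form scale N (\<lambda>xs. f (b # xs))"
  using multilinear_form_middle[OF assms, of "[b]" N "[]"] by simp

lemma multilinear_form_dual_form:
  assumes coord: "\<And>b. Vector_Spaces.linear scale (*) (coord b)" and "length I = N"
  shows "multilinear_form scale N (dual_form coord I)"
  unfolding multilinear_form_def
proof (intro allI impI)
  fix us vs :: "'b list" assume len: "length us + 1 + length vs = N"
  define J where "J = take (length us) I"
  obtain b K where K: "drop (length us) I = b # K"
    using len \<open>length I = N\<close> by (cases "drop (length us) I") auto
  have I: "I = J @ b # K" "length J = length us"
    using len \<open>length I = N\<close> K by (simp_all add: J_def flip: K)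
  have k: "vector_space ((*) :: 'a \<Rightarrow> 'a \<Rightarrow> 'a)"
    by (rule vector_space_mult)
  show "Vector_Spaces.linear scale (*) (\<lambda>x. dual_form coord I (us @ x # vs))"
    using coord[of b] I
    by (simp add: linear_iff_additive_homogeneous[OF vector_space_axioms k] dual_form_append algebra_simps)
qed

lemma multilinear_form_expand:
  assumes "finite B" and expand: "\<And>x. x = (\<Sum>b\<in>B. scale (coord b x) b)"
    and "multilinear_form scale N f" "length xs = N"
  shows "f xs = (\<Sum>I\<in>words B N. dual_form coord I xs * f I)"
  using assms(3,4)
proof (induction N arbitrary: f xs)
  case 0
  then show ?case
    by (simp add: words_0)
next
  case (Suc N)
  obtain x ys where xs: "xs = x # ys" "length ys = N"
    using Suc.prems(2) by (auto simp: length_Suc_conv)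
  interpret f: Vector_Spaces.linear scale "(*)" "\<lambda>x. f (x # ys)"
    using multilinear_formD[OF Suc.prems(1), of "[]" ys] xs by simp
  have "f xs = f ((\<Sum>b\<in>B. scale (coord b x) b) # ys)"
    using expand[of x] xs by simp
  also have "\<dots> = (\<Sum>b\<in>B. coord b x * f (b # ys))"
    by (simp add: f.sum f.scale)
  also have "\<dots> = (\<Sum>b\<in>B. \<Sum>I\<in>words B N. dual_form coord (b # I) xs * f (b # I))"
    using Suc.IH[OF multilinear_form_Cons[OF Suc.prems(1)] xs(2)]
    by (simp add: xs sum_distrib_left mult.assoc)
  also have "\<dots> = (\<Sum>(b, I)\<in>B \<times> words B N. dual_form coord (b # I) xs * f (b # I))"
    by (rule sum.cartesian_product)
  also have "\<dots> = (\<Sum>I\<in>words B (Suc N). dual_form coord I xs * f I)"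
    unfolding words_Suc by (subst sum.reindex) (auto simp: inj_on_def case_prod_unfold o_def)
  finally show ?case .
qed

text \<open>A tensor is itself a functional on forms, so its coordinate at the word I is its value
  at the dual form of I. For pure tensors this is the expansion of a multilinear form in
  coordinates.\<close>

lemma tensor_expand:
  assumes "finite B" "\<And>x. x = (\<Sum>b\<in>B. scale (coord b x) b)"
    and coord: "\<And>b. Vector_Spaces.linear scale (*) (coord b)" and t: "t \<in> tensor_power scale N"
  shows "t = (\<Sum>I\<in>words B N. scale_tensor (t (dual_form coord I)) (pure_tensor scale I))"
  using t unfolding tensor_power_def
proof (induction rule: tensor.span_induct_alt)
  case base
  then show ?case
    by (simp add: scale_tensor_def fun_eq_iff)
next
  case (step c x y)
  then obtain xs where xs: "x = pure_tensor scale xs" "length xs = N"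
    by blast
  \<comment> \<open>Both sides are compared on every function f; where f is not multilinear both are
    0 by the convention for pure tensors.\<close>
  have x: "x = (\<Sum>I\<in>words B N. scale_tensor (x (dual_form coord I)) (pure_tensor scale I))"
  proof
    fix f
    have *: "(\<Sum>I\<in>words B N. scale_tensor (x (dual_form coord I)) (pure_tensor scale I)) f =
        (\<Sum>I\<in>words B N. dual_form coord I xs * (if multilinear_form scale N f then f I else 0))"
      using xs multilinear_form_dual_form[OF coord]
      by (auto simp: scale_tensor_def pure_tensor_def words_def tensor_sum_apply intro!: sum.cong)
    show "x f = (\<Sum>I\<in>words B N. scale_tensor (x (dual_form coord I)) (pure_tensor scale I)) f"
      unfolding * using multilinear_form_expand[OF assms(1,2), of N f xs] xs
      by (simp add: pure_tensor_def)
  qed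
  have eq: "scale_tensor ((scale_tensor c x + y) f) s = scale_tensor c (scale_tensor (x f) s) + scale_tensor (y f) s" for f s
    by (simp add: scale_tensor_def fun_eq_iff algebra_simps)
  have "(\<Sum>I\<in>words B N. scale_tensor ((scale_tensor c x + y) (dual_form coord I)) (pure_tensor scale I)) =
      scale_tensor c (\<Sum>I\<in>words B N. scale_tensor (x (dual_form coord I)) (pure_tensor scale I)) +
      (\<Sum>I\<in>words B N. scale_tensor (y (dual_form coord I)) (pure_tensor scale I))"
    by (simp only: eq sum.distrib tensor.scale_sum_right)
  also have "\<dots> = scale_tensor c x + y"
    by (simp only: x[symmetric] step(2)[symmetric])
  finally show ?case
    by (rule HOL.sym)
qed

end

section \<open>The Yang-Baxter equation for ternary shelves\<close>

lemma (in vector_space) vector_space_scaleX: "vector_space (scaleX scale)"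
  by unfold_locales (auto simp: scaleX_def algebra_simps split_beta prod_eq_iff)

abbreviation unitX :: "'k::field \<times> 'l::zero" where "unitX \<equiv> (1, 0)"

text \<open>The comultiplication of the coalgebra X \<otimes> X. Each string carries this object,
  and R becomes a braiding of it with itself.\<close>

definition pair_comult ::
    "('k::field \<times> 'l::zero) \<times> ('k \<times> 'l) \<Rightarrow> ((('k \<times> 'l) \<times> ('k \<times> 'l)) \<times> (('k \<times> 'l) \<times> ('k \<times> 'l))) list" where
  "pair_comult q = [((z1, w1), (z2, w2)). (z1, z2) \<leftarrow> comult (fst q), (w1, w2) \<leftarrow> comult (snd q)]"

text \<open>Sweedler sums are tested against scalar functions of the two halves, so that coalgebra
  identities become identities of finite sums in the field.\<close>

definition sweedler :: "('k::field \<times> 'l::zero) \<times> ('k \<times> 'l) \<Rightarrow>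
    (('k \<times> 'l) \<times> ('k \<times> 'l) \<Rightarrow> ('k \<times> 'l) \<times> ('k \<times> 'l) \<Rightarrow> 'k) \<Rightarrow> 'k" where
  "sweedler q F = (\<Sum>(a, b)\<leftarrow>pair_comult q. F a b)"

lemma sweedler_eq:
  "sweedler ((a, z), (b, w)) F =
     F ((a, z), (b, w)) (unitX, unitX) + F ((a, z), unitX) (unitX, (0, w)) +
     F (unitX, (b, w)) ((0, z), unitX) + F (unitX, unitX) ((0, z), (0, w))"
  by (simp add: sweedler_def pair_comult_def comult_def add.assoc)

lemma sweedler_swap:
  "sweedler q (\<lambda>a b. sweedler r (\<lambda>c d. K a b c d)) = sweedler r (\<lambda>c d. sweedler q (\<lambda>a b. K a b c d))"
proof -
  have "(\<Sum>x\<leftarrow>xs. \<Sum>y\<leftarrow>ys. f x y) = (\<Sum>y\<leftarrow>ys. \<Sum>x\<leftarrow>xs. f x y)"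
    for xs :: "'x list" and ys :: "'y list" and f :: "'x \<Rightarrow> 'y \<Rightarrow> 'a"
    by (induction xs) (simp_all add: sum_list_addf)
  then show ?thesis
    unfolding sweedler_def case_prod_beta .
qed

text \<open>The properties common to both maps T. The first projection is the counit of X and
  \<open>unitX\<close> is group-like: \<open>fst_T\<close> says that T respects counits,
  \<open>T_unit_left\<close> that the unit is acted on through counits, and
  \<open>self_distributive\<close> is ternary self-distributivity with repeated arguments replaced
  by comultiplication.\<close>

locale ternary_shelf = vector_space sc
  for sc :: "'k::field \<Rightarrow> 'l::ab_group_add \<Rightarrow> 'l" +
  fixes T :: "'k \<times> 'l \<Rightarrow> 'k \<times> 'l \<Rightarrow> 'k \<times> 'l \<Rightarrow> 'k \<times> 'l"
  assumes linear_T1: "Vector_Spaces.linear (scaleX sc) (scaleX sc) (\<lambda>x. T x y z)"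
    and linear_T2: "Vector_Spaces.linear (scaleX sc) (scaleX sc) (\<lambda>y. T x y z)"
    and linear_T3: "Vector_Spaces.linear (scaleX sc) (scaleX sc) (\<lambda>z. T x y z)"
    and T_unit_left: "T unitX y z = (fst y * fst z, 0)"
    and T_unit_right: "T x unitX unitX = x"
    and fst_T: "fst (T x y z) = fst x * fst y * fst z"
    and self_distributive: "T (T x y z) u v =
      (\<Sum>(u1, u2, u3)\<leftarrow>comult3 u. \<Sum>(v1, v2, v3)\<leftarrow>comult3 v. T (T x u1 v1) (T y u2 v2) (T z u3 v3))"
begin

abbreviation "linK \<equiv> Vector_Spaces.linear (scaleX sc) ((*) :: 'k \<Rightarrow> 'k \<Rightarrow> 'k)"
abbreviation "linX \<equiv> Vector_Spaces.linear (scaleX sc) (scaleX sc)"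

lemmas linK_iff = linear_iff_additive_homogeneous[OF vector_space_scaleX vector_space_mult]
lemmas linX_iff = linear_iff_additive_homogeneous[OF vector_space_scaleX vector_space_scaleX]

definition pair_linear :: "(('k \<times> 'l) \<times> ('k \<times> 'l) \<Rightarrow> 'k) \<Rightarrow> bool" where
  "pair_linear K \<longleftrightarrow> (\<forall>w. linK (\<lambda>z. K (z, w))) \<and> (\<forall>z. linK (\<lambda>w. K (z, w)))"

lemma pair_linearI:
  "(\<And>w. linK (\<lambda>z. K (z, w))) \<Longrightarrow> (\<And>z. linK (\<lambda>w. K (z, w))) \<Longrightarrow> pair_linear K"
  unfolding pair_linear_def by blast

lemma pair_linearD:
  "pair_linear K \<Longrightarrow> linK (\<lambda>z. K (z, w))" "pair_linear K \<Longrightarrow> linK (\<lambda>w. K (z, w))"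
  unfolding pair_linear_def by blast+

lemma linK_compose: "linK f \<Longrightarrow> linX g \<Longrightarrow> linK (\<lambda>x. f (g x))"
  by (simp add: linK_iff linX_iff del: split_paired_All)

lemma linK_add: "linK f \<Longrightarrow> linK g \<Longrightarrow> linK (\<lambda>x. f x + g x)"
  by (simp add: linK_iff algebra_simps del: split_paired_All)

lemma linX_snd: "linX (\<lambda>x. (0, snd x))"
  by (auto simp: linX_iff scaleX_def case_prod_beta)

lemma linK_zero: "linK f \<Longrightarrow> f 0 = 0"
  by (metis add_cancel_right_right linK_iff)

lemma linX_zero: "linX f \<Longrightarrow> f 0 = 0"
  by (metis add_cancel_right_right linX_iff)

text \<open>The list for the comultiplication of the unit contains the spurious summand
  \<open>unitX\<close> \<otimes> 0; such summands disappear only once a bilinear form is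
  applied.\<close>

lemma pair_linear_zero: "pair_linear K \<Longrightarrow> K (0, w) = 0" "pair_linear K \<Longrightarrow> K (z, 0) = 0"
  unfolding pair_linear_def using linK_zero[of "\<lambda>z. K (z, w)"] linK_zero[of "\<lambda>w. K (z, w)"] by blast+

lemma T_zero [simp]: "T 0 y z = 0" "T x 0 z = 0" "T x y 0 = 0"
  using linX_zero[OF linear_T1] linX_zero[OF linear_T2] linX_zero[OF linear_T3] by auto

text \<open>The second halves enter through the linear map sending x to \<open>(0, snd x)\<close>,
  and each of the four summands contains z and w exactly once.\<close>

lemma pair_linear_sweedler:
  assumes "\<And>b. pair_linear (\<lambda>a. F a b)" "\<And>a. pair_linear (F a)"
  shows "pair_linear (\<lambda>q. sweedler q F)"
proof -
  have F: "linK (\<lambda>z. F (z, w) b)" "linK (\<lambda>w. F (z, w) b)" "linK (\<lambda>z. F a (z, w))" "linK (\<lambda>w. F a (z, w))"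
    for z w a b
    by (rule pair_linearD assms)+
  have eq: "sweedler (z, w) F = F (z, w) (unitX, unitX) + F (z, unitX) (unitX, (0, snd w)) +
     F (unitX, w) ((0, snd z), unitX) + F (unitX, unitX) ((0, snd z), (0, snd w))" for z w
    using sweedler_eq[of "fst z" "snd z" "fst w" "snd w" F] by simp
  show ?thesis
    by (rule pair_linearI; unfold eq; intro linK_add F linK_compose[OF F(3) linX_snd] linK_compose[OF F(4) linX_snd] HOL.refl)
qed

lemma pair_linear_sum_list:
  "(\<And>i. pair_linear (\<lambda>p. G p i)) \<Longrightarrow> pair_linear (\<lambda>p. \<Sum>i\<leftarrow>is. G p i)"
  by (induction "is") (simp_all add: pair_linear_def linK_iff algebra_simps del: split_paired_All)

lemma pair_linear_sweedler_param:
  assumes "\<And>a b. pair_linear (\<lambda>p. G p a b)"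
  shows "pair_linear (\<lambda>p. sweedler q (G p))"
  unfolding sweedler_def case_prod_beta by (intro pair_linear_sum_list assms)

text \<open>The diagonal action of the pair q on the pair p, evaluated on F. It turns the ternary
  operation T on X into a binary operation on X \<otimes> X.\<close>

definition act :: "('k \<times> 'l) \<times> ('k \<times> 'l) \<Rightarrow> ('k \<times> 'l) \<times> ('k \<times> 'l) \<Rightarrow> (('k \<times> 'l) \<times> ('k \<times> 'l) \<Rightarrow> 'k) \<Rightarrow> 'k" where
  "act p q F = sweedler q (\<lambda>r s. F (T (fst p) (fst r) (snd r), T (snd p) (fst s) (snd s)))"

lemma linK_T:
  assumes "linK f"
  shows "linK (\<lambda>x. f (T x y z))" "linK (\<lambda>y. f (T x y z))" "linK (\<lambda>z. f (T x y z))"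
  by (intro linK_compose[OF assms] linear_T1 linear_T2 linear_T3)+

lemma pair_linear_T1:
  "pair_linear F \<Longrightarrow> pair_linear (\<lambda>p. F (T (fst p) a b, T (snd p) c d))"
  by (rule pair_linearI; unfold fst_conv snd_conv; intro linK_T pair_linearD)

lemma pair_linear_T2:
  assumes "linK f"
  shows "pair_linear (\<lambda>q. f (T x (fst q) (snd q)))"
  by (rule pair_linearI; unfold fst_conv snd_conv; intro linK_T assms)

lemma pair_linear_act1: "pair_linear F \<Longrightarrow> pair_linear (\<lambda>p. act p q F)"
  unfolding act_def by (intro pair_linear_sweedler_param pair_linear_T1)

lemma pair_linear_act2:
  assumes "pair_linear F"
  shows "pair_linear (\<lambda>q. act p q F)"
  unfolding act_def
  by (intro pair_linear_sweedler pair_linear_T2 pair_linear_T2[where f = "\<lambda>z. F (z, _)"] pair_linearD assms)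

lemma pair_linear_act_param: "(\<And>s. pair_linear (\<lambda>p. G p s)) \<Longrightarrow> pair_linear (\<lambda>p. act a b (G p))"
  unfolding act_def by (intro pair_linear_sweedler_param)

lemmas pair_linear_intros = pair_linear_act1 pair_linear_act2 pair_linear_act_param
  pair_linear_sweedler pair_linear_sweedler_param

text \<open>This combines cocommutativity and coassociativity.\<close>

lemma sweedler_middle_swap:
  assumes "\<And>b c d. pair_linear (\<lambda>a. K a b c d)" "\<And>a c d. pair_linear (\<lambda>b. K a b c d)"
    "\<And>a b d. pair_linear (\<lambda>c. K a b c d)" "\<And>a b c. pair_linear (\<lambda>d. K a b c d)"
  shows "sweedler r (\<lambda>r1 r2. sweedler r1 (\<lambda>a b. sweedler r2 (\<lambda>c d. K a b c d))) =
    sweedler r (\<lambda>r1 r2. sweedler r1 (\<lambda>a c. sweedler r2 (\<lambda>b d. K a b c d)))"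
proof -
  obtain a z b w where r: "r = ((a, z), (b, w))"
    by (metis surj_pair)
  note zero = assms[THEN pair_linear_zero(1), unfolded zero_prod_def] assms[THEN pair_linear_zero(2), unfolded zero_prod_def]
  show ?thesis
    unfolding r by (simp add: sweedler_eq zero)
qed

lemma sweedler_cong: "(\<And>a b. F a b = G a b) \<Longrightarrow> sweedler q F = sweedler q G"
  by presburger

lemma act_cong: "(\<And>s. F s = G s) \<Longrightarrow> act p q F = act p q G"
  by presburger

lemma act_sweedler: "act p r (\<lambda>s. sweedler q (\<lambda>a b. K a b s)) = sweedler q (\<lambda>a b. act p r (\<lambda>s. K a b s))"
  unfolding act_def by (rule sweedler_swap)

lemma act_swap: "act p q (\<lambda>s. act p' q' (\<lambda>t. K s t)) = act p' q' (\<lambda>t. act p q (\<lambda>s. K s t))"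
  unfolding act_def by (rule sweedler_swap)

section \<open>Compatibility of T and of the action with the comultiplication\<close>

definition cosum :: "'k \<times> 'l \<Rightarrow> ('k \<times> 'l \<Rightarrow> 'k \<times> 'l \<Rightarrow> 'k) \<Rightarrow> 'k" where
  "cosum x F = (\<Sum>(a, b)\<leftarrow>comult x. F a b)"

lemma cosum_eq: "cosum x F = F x unitX + F unitX (0, snd x)"
  by (cases x) (simp add: cosum_def comult_def)

lemma sweedler_cosum: "sweedler (z, w) F = cosum z (\<lambda>z1 z2. cosum w (\<lambda>w1 w2. F (z1, w1) (z2, w2)))"
  by (cases z; cases w) (simp add: sweedler_eq cosum_eq)

lemma cosum_sweedler_swap:
  "sweedler r (\<lambda>a b. cosum z (\<lambda>c d. K a b c d)) = cosum z (\<lambda>c d. sweedler r (\<lambda>a b. K a b c d))"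
proof -
  obtain a x b y where "r = ((a, x), (b, y))"
    by (metis surj_pair)
  then show ?thesis
    by (simp add: sweedler_eq cosum_eq)
qed

text \<open>T is a morphism of coalgebras. On z \<otimes> 1 the unit turns the second half of r into
  its counit, on 1 \<otimes> \<open>(0, \<zeta>)\<close> the first half, and what remains are the
  two summands of the comultiplication of T z r.\<close>

lemma cosum_T:
  assumes H: "\<And>t. linK (\<lambda>s. H s t)" "\<And>s. linK (H s)"
  shows "cosum (T z (fst r) (snd r)) H =
    cosum z (\<lambda>z1 z2. sweedler r (\<lambda>a b. H (T z1 (fst a) (snd a)) (T z2 (fst b) (snd b))))"
proof -
  obtain a x b y where r: "r = ((a, x), (b, y))"
    by (metis surj_pair)
  obtain c \<zeta> where z: "z = (c, \<zeta>)"
    by fastforce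
  have zero: "H 0 t = 0" "H t 0 = 0" for t
    using linK_zero[OF H(1)] linK_zero[OF H(2)] by auto
  have scale: "H (scaleX sc c s) t = c * H s t" "H s (scaleX sc c t) = c * H s t" for c s t
    using H by (auto simp: linK_iff simp del: split_paired_All)
  have add: "H s (t + t') = H s t + H s t'" for s t t'
    using H(2)[of s] by (auto simp: linK_iff simp del: split_paired_All)
  have unit: "(d, 0) = scaleX sc d unitX" for d
    by (simp add: scaleX_def)
  have T2: "T x (y + y') w = T x y w + T x y' w" "T x (scaleX sc d y) w = scaleX sc d (T x y w)" for x y y' w d
    using linear_T2[of x w] by (auto simp: linX_iff simp del: split_paired_All)
  have T3: "T x w (y + y') = T x w y + T x w y'" "T x w (scaleX sc d y) = scaleX sc d (T x w y)" for x y y' w d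
    using linear_T3[of x w] by (auto simp: linX_iff simp del: split_paired_All)
  have T1: "T (y + y') x w = T y x w + T y' x w" "T (scaleX sc d y) x w = scaleX sc d (T y x w)" for x y y' w d
    using linear_T1[of x w] by (auto simp: linX_iff simp del: split_paired_All)
  have split: "(d, v) = scaleX sc d unitX + (0, v)" for d v
    by (simp add: scaleX_def)
  \<comment> \<open>The unit part of z contributes only a multiple of the unit, so the component in
    L comes from \<open>(0, \<zeta>)\<close> alone.\<close>
  have "T z (a, x) (b, y) = scaleX sc c (T unitX (a, x) (b, y)) + T (0, \<zeta>) (a, x) (b, y)"
    unfolding z by (subst split) (simp only: T1)
  then have snd: "(0, snd (T z (a, x) (b, y))) = T (0, \<zeta>) (a, x) (b, y)"
    by (simp add: T_unit_left scaleX_def prod_eq_iff fst_T)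
  have expand: "T (0, \<zeta>) (a, x) (b, y) =
      scaleX sc (a * b) (0, \<zeta>) + scaleX sc a (T (0, \<zeta>) unitX (0, y)) +
      scaleX sc b (T (0, \<zeta>) (0, x) unitX) + T (0, \<zeta>) (0, x) (0, y)"
  proof -
    interpret X: vector_space "scaleX sc"
      by (rule vector_space_scaleX)
    have "T (0, \<zeta>) (a, x) (b, y) =
        T (0, \<zeta>) (scaleX sc a unitX + (0, x)) (scaleX sc b unitX + (0, y))"
      by (simp only: split[symmetric])
    then show ?thesis
      by (simp only: T2 T3 T_unit_right X.scale_right_distrib X.scale_scale ac_simps)
  qed
  have e: "T unitX (a, x) unitX = scaleX sc a unitX" "T unitX unitX (b, y) = scaleX sc b unitX"
    "T unitX (a, x) (b, y) = scaleX sc (a * b) unitX" "T unitX unitX unitX = unitX"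
    "T unitX u (0, y) = 0" "T unitX (0, x) u = 0" for u
    by (simp_all add: T_unit_left scaleX_def zero_prod_def)
  show ?thesis
    by (simp add: r cosum_eq sweedler_eq snd e zero scale z T_unit_right)
      (simp add: snd[unfolded z] expand add scale)
qed

text \<open>The action is a morphism of coalgebras as well. Applying \<open>cosum_T\<close> to both
  coordinates yields the quarters of r in an order that pairs the wrong ones; the middle swap, that
  is cocommutativity, repairs it.\<close>

lemma act_comult:
  assumes "\<And>t. pair_linear (\<lambda>s. G s t)" "\<And>s. pair_linear (G s)"
  shows "act q r (\<lambda>t. sweedler t G) =
    sweedler q (\<lambda>q1 q2. sweedler r (\<lambda>r1 r2. act q1 r1 (\<lambda>s. act q2 r2 (G s))))"
proof -
  obtain z w where q: "q = (z, w)"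
    by (metis surj_pair)
  let ?T = "\<lambda>z a. T z (fst a) (snd a)"
  have G1: "linK (\<lambda>s. G (s, a) b)" "linK (\<lambda>s. G (a, s) b)" for a b
    by (rule pair_linearD assms)+
  have G2: "linK (\<lambda>s. G b (s, a))" "linK (\<lambda>s. G b (a, s))" for a b
    by (rule pair_linearD assms)+
  have linK_cosum: "linK (\<lambda>s. cosum z (K s))" if "\<And>a b. linK (\<lambda>s. K s a b)" for z K
    unfolding cosum_eq by (intro linK_add that)
  have "act q r (\<lambda>t. sweedler t G) = sweedler r (\<lambda>r1 r2. cosum (?T z r1) (\<lambda>s1 s2. cosum (?T w r2) (\<lambda>t1 t2. G (s1, t1) (s2, t2))))"
    by (simp add: act_def q sweedler_cosum)
  also have "\<dots> = sweedler r (\<lambda>r1 r2. cosum z (\<lambda>z1 z2. sweedler r1 (\<lambda>a b.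
      cosum (?T w r2) (\<lambda>t1 t2. G (?T z1 a, t1) (?T z2 b, t2)))))"
    by (intro sweedler_cong cosum_T linK_cosum G1 G2)
  also have "\<dots> = sweedler r (\<lambda>r1 r2. cosum z (\<lambda>z1 z2. sweedler r1 (\<lambda>a b.
      cosum w (\<lambda>w1 w2. sweedler r2 (\<lambda>c d. G (?T z1 a, ?T w1 c) (?T z2 b, ?T w2 d))))))"
    by (simp only: cosum_T[OF G1(2) G2(2)])
  also have "\<dots> = cosum z (\<lambda>z1 z2. cosum w (\<lambda>w1 w2. sweedler r (\<lambda>r1 r2. sweedler r1 (\<lambda>a b.
      sweedler r2 (\<lambda>c d. G (?T z1 a, ?T w1 c) (?T z2 b, ?T w2 d))))))"
    by (simp only: cosum_sweedler_swap)
  also have "\<dots> = cosum z (\<lambda>z1 z2. cosum w (\<lambda>w1 w2. sweedler r (\<lambda>r1 r2. sweedler r1 (\<lambda>a c.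
      sweedler r2 (\<lambda>b d. G (?T z1 a, ?T w1 c) (?T z2 b, ?T w2 d))))))"
    by (subst sweedler_middle_swap) (intro pair_linear_T2 G1 G2 HOL.refl)+
  also have "\<dots> = sweedler q (\<lambda>q1 q2. sweedler r (\<lambda>r1 r2. act q1 r1 (\<lambda>s. act q2 r2 (G s))))"
    by (simp add: q sweedler_cosum act_def)
  finally show ?thesis .
qed

text \<open>Two independent triple comultiplications are one iterated comultiplication of the
  pair.\<close>

lemma sum_list_comult3:
  "(\<Sum>(u1, u2, u3)\<leftarrow>comult3 u. \<Sum>(v1, v2, v3)\<leftarrow>comult3 v. K u1 u2 u3 v1 v2 v3) =
    sweedler (u, v) (\<lambda>r1 r'. sweedler r' (\<lambda>r2 r3. K (fst r1) (fst r2) (fst r3) (snd r1) (snd r2) (snd r3)))"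
  by (cases u; cases v) (simp add: comult3_def comult_def sweedler_eq add_ac)

text \<open>Writing the last two arguments of T as one pair acting from the right,
  self-distributivity takes the binary form (x q) r = (x r1)(q r2): the last two parts of r act
  diagonally on q.\<close>

lemma linK_self_distributive:
  assumes "linK f"
  shows "f (T (T x (fst q) (snd q)) (fst r) (snd r)) =
    sweedler r (\<lambda>r1 r2. act q r2 (\<lambda>t. f (T (T x (fst r1) (snd r1)) (fst t) (snd t))))"
proof -
  have f: "f (\<Sum>i\<leftarrow>is. g i) = (\<Sum>i\<leftarrow>is. f (g i))" for "is" :: "'i list" and g
    using assms linK_zero[OF assms] by (induction "is") (simp_all add: linK_iff del: split_paired_All)
  obtain u v where r: "r = (u, v)"
    by (metis surj_pair)
  have "f (T (T x (fst q) (snd q)) u v) = f (\<Sum>(u1, u2, u3)\<leftarrow>comult3 u. \<Sum>(v1, v2, v3)\<leftarrow>comult3 v.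
      T (T x u1 v1) (T (fst q) u2 v2) (T (snd q) u3 v3))"
    by (rule arg_cong[OF self_distributive])
  also have "\<dots> = (\<Sum>(u1, u2, u3)\<leftarrow>comult3 u. \<Sum>(v1, v2, v3)\<leftarrow>comult3 v.
      f (T (T x u1 v1) (T (fst q) u2 v2) (T (snd q) u3 v3)))"
    by (simp only: f case_prod_unfold)
  also have "\<dots> = sweedler r (\<lambda>r1 r2. act q r2 (\<lambda>t. f (T (T x (fst r1) (snd r1)) (fst t) (snd t))))"
    by (simp only: sum_list_comult3 act_def r fst_conv snd_conv)
  finally show ?thesis
    by (simp only: r fst_conv snd_conv)
qed

text \<open>Self-distributivity (p q) r = (p r1)(q r2) for pairs. It is applied in each coordinate
  of p; the middle swap sorts the quarters of r, and \<open>act_comult\<close> reassembles those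
  that act on q.\<close>

lemma act_act:
  assumes F: "pair_linear F"
  shows "act p q (\<lambda>s. act s r F) =
    sweedler r (\<lambda>r1 r2. act p r1 (\<lambda>s. act q r2 (\<lambda>t. act s t F)))"
proof -
  obtain x y where p: "p = (x, y)"
    by (metis surj_pair)
  let ?T = "\<lambda>z a. T z (fst a) (snd a)"
  have "act p q (\<lambda>s. act s r F) = sweedler q (\<lambda>q1 q2. sweedler r (\<lambda>r1 r2. F (?T (?T x q1) r1, ?T (?T y q2) r2)))"
    by (simp add: act_def p)
  also have "\<dots> = sweedler q (\<lambda>q1 q2. sweedler r (\<lambda>r1 r2. sweedler r1 (\<lambda>a b. act q1 b (\<lambda>t.
      F (?T (?T x a) t, ?T (?T y q2) r2)))))"
    by (intro sweedler_cong linK_self_distributive[OF pair_linearD(1)[OF F]])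
  also have "\<dots> = sweedler q (\<lambda>q1 q2. sweedler r (\<lambda>r1 r2. sweedler r1 (\<lambda>a b. act q1 b (\<lambda>t.
      sweedler r2 (\<lambda>c d. act q2 d (\<lambda>t'. F (?T (?T x a) t, ?T (?T y c) t')))))))"
    by (intro sweedler_cong act_cong linK_self_distributive[OF pair_linearD(2)[OF F]])
  also have "\<dots> = sweedler q (\<lambda>q1 q2. sweedler r (\<lambda>r1 r2. sweedler r1 (\<lambda>a b.
      sweedler r2 (\<lambda>c d. act q1 b (\<lambda>t. act q2 d (\<lambda>t'. F (?T (?T x a) t, ?T (?T y c) t')))))))"
    by (simp only: act_sweedler)
  also have "\<dots> = sweedler q (\<lambda>q1 q2. sweedler r (\<lambda>r1 r2. sweedler r1 (\<lambda>a c.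
      sweedler r2 (\<lambda>b d. act q1 b (\<lambda>t. act q2 d (\<lambda>t'. F (?T (?T x a) t, ?T (?T y c) t')))))))"
    by (intro sweedler_cong sweedler_middle_swap pair_linear_act_param pair_linear_act2 pair_linear_T2
        linK_T pair_linearD F)
  also have "\<dots> = sweedler r (\<lambda>r1 r2. sweedler r1 (\<lambda>a c. sweedler q (\<lambda>q1 q2. sweedler r2 (\<lambda>b d.
      act q1 b (\<lambda>t. act q2 d (\<lambda>t'. F (?T (?T x a) t, ?T (?T y c) t')))))))"
    by (subst sweedler_swap) (intro sweedler_cong sweedler_swap)
  \<comment> \<open>The halves of q, acted on by the halves of r2, are the comultiplication of q
    acted on by r2.\<close>
  also have "\<dots> = sweedler r (\<lambda>r1 r2. sweedler r1 (\<lambda>a c. act q r2 (\<lambda>t. sweedler t (\<lambda>t1 t2.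
      F (?T (?T x a) t1, ?T (?T y c) t2)))))"
    by (intro sweedler_cong act_comult[symmetric] pair_linear_T2 pair_linearD F)
  also have "\<dots> = sweedler r (\<lambda>r1 r2. act p r1 (\<lambda>s. act q r2 (\<lambda>t. act s t F)))"
    by (simp add: act_def p)
  finally show ?thesis .
qed

section \<open>The braiding of pairs\<close>

definition braiding :: "('k \<times> 'l) \<times> ('k \<times> 'l) \<Rightarrow> ('k \<times> 'l) \<times> ('k \<times> 'l) \<Rightarrow>
    (('k \<times> 'l) \<times> ('k \<times> 'l) \<Rightarrow> ('k \<times> 'l) \<times> ('k \<times> 'l) \<Rightarrow> 'k) \<Rightarrow> 'k" where
  "braiding p q h = sweedler q (\<lambda>q1 q2. act p q2 (\<lambda>s. h q1 s))"

text \<open>With the action written as a product and r split into quarters, the left side is r11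
  \<otimes> q1 r12 \<otimes> (p r21)(q2 r22) by \<open>act_act\<close>, the right side r11 \<otimes>
  q1 r21 \<otimes> (p r12)(q2 r22) by \<open>act_comult\<close>; cocommutativity identifies
  them.\<close>

lemma yang_baxter:
  assumes f: "\<And>b c. pair_linear (\<lambda>a. f a b c)" "\<And>a c. pair_linear (\<lambda>b. f a b c)" "\<And>a b. pair_linear (\<lambda>c. f a b c)"
  shows "braiding p q (\<lambda>a b. braiding b r (\<lambda>c d. braiding a c (\<lambda>u v. f u v d))) =
    braiding q r (\<lambda>a b. braiding p a (\<lambda>c d. braiding d b (\<lambda>u v. f c u v)))"
proof -
  note pl = pair_linear_intros f
  have "braiding p q (\<lambda>a b. braiding b r (\<lambda>c d. braiding a c (\<lambda>u v. f u v d))) =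
    sweedler q (\<lambda>q1 q2. sweedler r (\<lambda>r1 r2. act p q2 (\<lambda>s. act s r2 (\<lambda>d.
      sweedler r1 (\<lambda>a b. act q1 b (\<lambda>v. f a v d))))))"
    by (simp only: braiding_def act_sweedler)
  also have "\<dots> = sweedler q (\<lambda>q1 q2. sweedler r (\<lambda>r1 r2. sweedler r2 (\<lambda>c d. act p c (\<lambda>s. act q2 d (\<lambda>t. act s t (\<lambda>e.
      sweedler r1 (\<lambda>a b. act q1 b (\<lambda>v. f a v e))))))))"
    by (intro sweedler_cong act_act pl)
  also have "\<dots> = sweedler q (\<lambda>q1 q2. sweedler r (\<lambda>r1 r2. sweedler r2 (\<lambda>c d. sweedler r1 (\<lambda>a b.
      act p c (\<lambda>s. act q2 d (\<lambda>t. act s t (\<lambda>e. act q1 b (\<lambda>v. f a v e))))))))"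
    by (simp only: act_sweedler)
  also have "\<dots> = sweedler q (\<lambda>q1 q2. sweedler r (\<lambda>r1 r2. sweedler r1 (\<lambda>a b. sweedler r2 (\<lambda>c d.
      act p c (\<lambda>s. act q2 d (\<lambda>t. act s t (\<lambda>e. act q1 b (\<lambda>v. f a v e))))))))"
    by (intro sweedler_cong sweedler_swap)
  \<comment> \<open>The quarter of r acting on q1 is exchanged with the one acting on p.\<close>
  also have "\<dots> = sweedler q (\<lambda>q1 q2. sweedler r (\<lambda>r1 r2. sweedler r1 (\<lambda>a c. sweedler r2 (\<lambda>b d.
      act p c (\<lambda>s. act q2 d (\<lambda>t. act s t (\<lambda>e. act q1 b (\<lambda>v. f a v e))))))))"
    by (intro sweedler_cong sweedler_middle_swap pl)
  also have "\<dots> = sweedler q (\<lambda>q1 q2. sweedler r (\<lambda>r1 r2. sweedler r1 (\<lambda>a c. sweedler r2 (\<lambda>b d.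
      act q1 b (\<lambda>v. act q2 d (\<lambda>t. act p c (\<lambda>s. act s t (\<lambda>e. f a v e))))))))"
  proof (intro sweedler_cong)
    fix q1 q2 a b c d
    have "act p c (\<lambda>s. act q2 d (\<lambda>t. act s t (\<lambda>e. act q1 b (\<lambda>v. f a v e)))) =
        act p c (\<lambda>s. act q2 d (\<lambda>t. act q1 b (\<lambda>v. act s t (\<lambda>e. f a v e))))"
      by (intro act_cong act_swap)
    also have "\<dots> = act p c (\<lambda>s. act q1 b (\<lambda>v. act q2 d (\<lambda>t. act s t (\<lambda>e. f a v e))))"
      by (intro act_cong act_swap)
    also have "\<dots> = act q1 b (\<lambda>v. act p c (\<lambda>s. act q2 d (\<lambda>t. act s t (\<lambda>e. f a v e))))"
      by (rule act_swap)
    also have "\<dots> = act q1 b (\<lambda>v. act q2 d (\<lambda>t. act p c (\<lambda>s. act s t (\<lambda>e. f a v e))))"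
      by (intro act_cong act_swap)
    finally show "act p c (\<lambda>s. act q2 d (\<lambda>t. act s t (\<lambda>e. act q1 b (\<lambda>v. f a v e)))) =
        act q1 b (\<lambda>v. act q2 d (\<lambda>t. act p c (\<lambda>s. act s t (\<lambda>e. f a v e))))" .
  qed
  also have "\<dots> = sweedler r (\<lambda>r1 r2. sweedler q (\<lambda>q1 q2. sweedler r1 (\<lambda>a c. sweedler r2 (\<lambda>b d.
      act q1 b (\<lambda>v. act q2 d (\<lambda>t. act p c (\<lambda>s. act s t (\<lambda>e. f a v e))))))))"
    by (rule sweedler_swap)
  also have "\<dots> = sweedler r (\<lambda>r1 r2. sweedler r1 (\<lambda>a c. sweedler q (\<lambda>q1 q2. sweedler r2 (\<lambda>b d.
      act q1 b (\<lambda>v. act q2 d (\<lambda>t. act p c (\<lambda>s. act s t (\<lambda>e. f a v e))))))))"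
    by (intro sweedler_cong sweedler_swap)
  also have "\<dots> = sweedler r (\<lambda>r1 r2. sweedler r1 (\<lambda>a c. act q r2 (\<lambda>b. sweedler b (\<lambda>v t.
      act p c (\<lambda>s. act s t (\<lambda>e. f a v e))))))"
    by (intro sweedler_cong act_comult[symmetric] pl)
  also have "\<dots> = braiding q r (\<lambda>a b. braiding p a (\<lambda>c d. braiding d b (\<lambda>u v. f c u v)))"
    by (simp only: braiding_def act_sweedler)
  finally show ?thesis .
qed

end

section \<open>Lie algebras and 3-Lie algebras as ternary shelves\<close>

lemma (in vector_space) scaleX_linear_iff:
  "Vector_Spaces.linear (scaleX scale) (scaleX scale) f \<longleftrightarrow>
     (\<forall>x y. f (x + y) = f x + f y) \<and> (\<forall>c x. f (scaleX scale c x) = scaleX scale c (f x))"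
  by (rule linear_iff_additive_homogeneous[OF vector_space_scaleX vector_space_scaleX])

lemma (in vector_space) linear_self_iff:
  "Vector_Spaces.linear scale scale f \<longleftrightarrow>
     (\<forall>x y. f (x + y) = f x + f y) \<and> (\<forall>c x. f (scale c x) = scale c (f x))"
  by (rule linear_iff_additive_homogeneous[OF vector_space_axioms vector_space_axioms])

section \<open>Lie algebras: T as a twofold rack action\<close>

context lie_algebra
begin

lemma bracket_add [simp]:
  "bracket (x + y) z = bracket x z + bracket y z" "bracket z (x + y) = bracket z x + bracket z y"
  using linear_left linear_right by (auto simp: linear_self_iff)

lemma bracket_scale [simp]:
  "bracket (sc c x) z = sc c (bracket x z)" "bracket z (sc c x) = sc c (bracket z x)"
  using linear_left linear_right by (auto simp: linear_self_iff)

lemma bracket_zero [simp]: "bracket 0 z = 0" "bracket z 0 = 0"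
  using bracket_add(1)[of 0 0 z] bracket_add(2)[of z 0 0] by simp_all

lemma bracket_skew: "bracket x y = - bracket y x"
proof -
  have "bracket x y + bracket y x = bracket (x + y) (x + y)"
    by (simp only: bracket_add) (simp add: alternating)
  then have "bracket x y + bracket y x = 0"
    by (simp only: alternating)
  then show ?thesis
    by (simp only: eq_neg_iff_add_eq_0)
qed

lemma bracket_minus: "bracket (- x) y = - bracket x y" "bracket x (- y) = - bracket x y"
  using bracket_add(1)[of x "- x" y] bracket_add(2)[of x y "- y"]
  by (simp_all add: eq_neg_iff_add_eq_0 add.commute del: bracket_add)

lemma bracket_bracket: "bracket (bracket x y) z = bracket (bracket x z) y + bracket x (bracket y z)"
proof -
  have "bracket (bracket x y) z = - (bracket (bracket y z) x + bracket (bracket z x) y)"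
    using jacobi[of x y z] by (simp only: eq_neg_iff_add_eq_0 add.assoc)
  also have "\<dots> = - bracket (bracket z x) y + - bracket (bracket y z) x"
    by (simp only: minus_add_distrib add.commute)
  also have "- bracket (bracket z x) y = bracket (bracket x z) y"
    by (metis bracket_minus(1) bracket_skew)
  also have "- bracket (bracket y z) x = bracket x (bracket y z)"
    by (rule bracket_skew[symmetric])
  finally show ?thesis .
qed

text \<open>The linear rack of the Lie algebra on \<k> \<oplus> L; acting by it twice gives
  \<open>lie_T\<close>.\<close>

definition rack :: "'k \<times> 'l \<Rightarrow> 'k \<times> 'l \<Rightarrow> 'k \<times> 'l" where
  "rack = (\<lambda>(a, x) (b, y). (a * b, sc b x + bracket x y))"

lemma lie_T_rack: "lie_T sc bracket x y z = rack (rack x y) z"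
  by (simp add: lie_T_def rack_def case_prod_beta algebra_simps)

lemma rack_linear:
  "rack (x + y) z = rack x z + rack y z" "rack z (x + y) = rack z x + rack z y"
  "rack (scaleX sc c x) z = scaleX sc c (rack x z)" "rack z (scaleX sc c x) = scaleX sc c (rack z x)"
  by (simp_all add: rack_def scaleX_def case_prod_beta algebra_simps)

lemma rack_zero: "rack 0 z = 0" "rack z 0 = 0"
  by (simp_all add: rack_def case_prod_beta zero_prod_def)

lemma rack_unit: "rack x unitX = x" "rack (a, 0) x = (a * fst x, 0)"
  by (simp_all add: rack_def case_prod_beta)

text \<open>Binary self-distributivity. The comultiplication of z is z \<otimes> 1 plus 1 \<otimes>
  \<open>(0, snd z)\<close>, which accounts for the two summands; the content is the Jacobi identity
  in derivation form.\<close>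

lemma rack_rack: "rack (rack x y) z = rack (rack x z) y + rack x (rack y (0, snd z))"
  using bracket_bracket[of "snd x" "snd y" "snd z"]
  by (simp add: rack_def case_prod_beta algebra_simps)

text \<open>T consists of two rack actions, so u and then v have to be moved past a product of three
  factors, each time by the binary identity; in each move the new factor lands on exactly one of x,
  y, z.\<close>

lemma lie_T_self_distributive:
  "lie_T sc bracket (lie_T sc bracket x y z) u v =
    (\<Sum>(u1, u2, u3)\<leftarrow>comult3 u. \<Sum>(v1, v2, v3)\<leftarrow>comult3 v.
      lie_T sc bracket (lie_T sc bracket x u1 v1) (lie_T sc bracket y u2 v2) (lie_T sc bracket z u3 v3))"
proof -
  have rack_rack_rack: "rack (rack (rack x y) z) w =
      rack (rack (rack x w) y) z + rack (rack x (rack y (0, snd w))) z + rack (rack x y) (rack z (0, snd w))"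
    for x y z w
    using rack_rack[of "rack x y" z w] rack_rack[of x y w] by (simp add: rack_linear)
  obtain a u' b v' where u: "u = (a, u')" and v: "v = (b, v')"
    by (metis surj_pair)
  show ?thesis
    unfolding lie_T_rack rack_rack_rack[of x y z u] rack_linear rack_rack_rack[of _ _ _ v]
    by (simp add: u v comult3_def comult_def rack_unit rack_zero[unfolded zero_prod_def] algebra_simps
        flip: zero_prod_def)
      (simp add: rack_zero algebra_simps)
qed

lemma ternary_shelf_lie_T: "ternary_shelf sc (lie_T sc bracket)"
proof (intro ternary_shelf.intro ternary_shelf_axioms.intro vector_space_axioms)
  show "lie_T sc bracket (lie_T sc bracket x y z) u v =
    (\<Sum>(u1, u2, u3)\<leftarrow>comult3 u. \<Sum>(v1, v2, v3)\<leftarrow>comult3 v.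
      lie_T sc bracket (lie_T sc bracket x u1 v1) (lie_T sc bracket y u2 v2) (lie_T sc bracket z u3 v3))"
    for x y z u v by (rule lie_T_self_distributive)
  show "fst (lie_T sc bracket x y z) = fst x * fst y * fst z" for x y z
    by (simp add: lie_T_def case_prod_beta)
qed (simp_all add: scaleX_linear_iff lie_T_rack rack_linear rack_unit del: split_paired_All)

end

section \<open>3-Lie algebras\<close>

context three_lie_algebra
begin

lemma bracket_add [simp]:
  "bracket (x + y) z w = bracket x z w + bracket y z w"
  "bracket z (x + y) w = bracket z x w + bracket z y w"
  "bracket z w (x + y) = bracket z w x + bracket z w y"
  using linear_1 linear_2 linear_3 by (auto simp: linear_self_iff)

lemma bracket_scale [simp]:
  "bracket (sc c x) z w = sc c (bracket x z w)"
  "bracket z (sc c x) w = sc c (bracket z x w)"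
  "bracket z w (sc c x) = sc c (bracket z w x)"
  using linear_1 linear_2 linear_3 by (auto simp: linear_self_iff)

lemma bracket_zero [simp]: "bracket 0 z w = 0" "bracket z 0 w = 0" "bracket z w 0 = 0"
  using bracket_add(1)[of 0 0 z w] bracket_add(2)[of z 0 0 w] bracket_add(3)[of z w 0 0] by simp_all

text \<open>An argument from L paired with the unit acts by 0, so a summand survives only if u and v
  fall into the same slot. The three survivors are those of the fundamental identity.\<close>

lemma three_lie_T_self_distributive:
  "three_lie_T sc bracket (three_lie_T sc bracket x y z) u v =
    (\<Sum>(u1, u2, u3)\<leftarrow>comult3 u. \<Sum>(v1, v2, v3)\<leftarrow>comult3 v.
      three_lie_T sc bracket (three_lie_T sc bracket x u1 v1)
        (three_lie_T sc bracket y u2 v2) (three_lie_T sc bracket z u3 v3))"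
proof -
  obtain a u' b v' where u: "u = (a, u')" and v: "v = (b, v')"
    by (metis surj_pair)
  let ?T = "three_lie_T sc bracket"
  have unit: "?T x unitX unitX = x" "?T x (0, w) unitX = 0" "?T x unitX (0, w) = 0" for x w
    by (simp_all add: three_lie_T_def case_prod_beta zero_prod_def)
  have unit2: "?T x (c, w) unitX = scaleX sc c x" "?T x unitX (c, w) = scaleX sc c x" for x c w
    by (simp_all add: three_lie_T_def case_prod_beta scaleX_def)
  have zero: "?T 0 x y = 0" "?T x 0 y = 0" "?T x y 0 = 0" for x y
    by (simp_all add: three_lie_T_def case_prod_beta zero_prod_def)
  have "?T (?T x y z) u v = ?T (?T x u v) y z + ?T x (?T y (0, u') (0, v')) z + ?T x y (?T z (0, u') (0, v'))"
    using fundamental_identity[of "snd x" "snd y" "snd z" u' v']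
    by (simp add: u v three_lie_T_def case_prod_beta algebra_simps)
  moreover have "scaleX sc 1 x = x" "scaleX sc 0 x = 0" for x
    by (simp_all add: scaleX_def case_prod_beta zero_prod_def)
  ultimately show ?thesis
    by (simp add: u v comult3_def comult_def unit unit2 zero add.assoc flip: zero_prod_def)
qed

lemma ternary_shelf_three_lie_T: "ternary_shelf sc (three_lie_T sc bracket)"
proof (intro ternary_shelf.intro ternary_shelf_axioms.intro vector_space_axioms)
  show "three_lie_T sc bracket (three_lie_T sc bracket x y z) u v =
    (\<Sum>(u1, u2, u3)\<leftarrow>comult3 u. \<Sum>(v1, v2, v3)\<leftarrow>comult3 v.
      three_lie_T sc bracket (three_lie_T sc bracket x u1 v1)
        (three_lie_T sc bracket y u2 v2) (three_lie_T sc bracket z u3 v3))"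
    for x y z u v by (rule three_lie_T_self_distributive)
qed (simp_all add: scaleX_linear_iff three_lie_T_def scaleX_def algebra_simps case_prod_beta)

end

section \<open>The maps R and theta on tensor powers\<close>

context vector_space
begin

text \<open>Elements of the tensor power see a form only on lists of length N, both for its value
  and for its multilinearity.\<close>

lemma tensor_cong:
  assumes "t \<in> tensor_power scale N" "\<And>xs. length xs = N \<Longrightarrow> f xs = g xs"
  shows "t f = t g"
  using assms(1) unfolding tensor_power_def
proof (induction rule: tensor.span_induct_alt)
  case (step c x y)
  then obtain xs where "x = pure_tensor scale xs" "length xs = N"
    by blast
  moreover have "multilinear_form scale N f \<longleftrightarrow> multilinear_form scale N g"
    unfolding multilinear_form_def using assms(2) by (intro all_cong1 imp_cong HOL.refl) simp
  ultimately show ?case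
    using step assms(2) by (simp add: scale_tensor_def pure_tensor_def)
qed simp

lemma tensor_not_multilinear:
  assumes "t \<in> tensor_power scale N" "\<not> multilinear_form scale N f"
  shows "t f = 0"
  using assms(1) unfolding tensor_power_def
proof (induction rule: tensor.span_induct_alt)
  case (step c x y)
  then show ?case
    using assms(2) by (auto simp: scale_tensor_def pure_tensor_def)
qed simp

lemma tensor_eqI:
  assumes "t \<in> tensor_power scale N" "t' \<in> tensor_power scale N"
    "\<And>f. multilinear_form scale N f \<Longrightarrow> t f = t' f"
  shows "t = t'"
  using assms tensor_not_multilinear by (metis ext)

lemma multilinear_form_cong:
  "(\<And>xs. length xs = N \<Longrightarrow> f xs = g xs) \<Longrightarrow> multilinear_form scale N f \<longleftrightarrow> multilinear_form scale N g"
  unfolding multilinear_form_def by (intro all_cong1 imp_cong HOL.refl) simp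

lemma linear_tensor_power_invariant:
  assumes lin: "Vector_Spaces.linear scale_tensor scale_tensor g"
    and pure: "\<And>xs. length xs = N \<Longrightarrow> g (pure_tensor scale xs) \<in> tensor_power scale N"
    and t: "t \<in> tensor_power scale N"
  shows "g t \<in> tensor_power scale N"
proof -
  interpret g: Vector_Spaces.linear scale_tensor scale_tensor g
    by (rule lin)
  show ?thesis
    using t unfolding tensor_power_def
  proof (induction rule: tensor.span_induct_alt)
    case (step c x y)
    have "g (scale_tensor c x + y) = scale_tensor c (g x) + g y"
      by (simp only: g.add g.scale)
    moreover have "g x \<in> tensor.span (pure_tensor scale ` {xs. length xs = N})"
      using step(1) pure unfolding tensor_power_def by blast
    ultimately show ?case
      using step(2) by (metis tensor.span_add tensor.span_scale)
  next
    case base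
    then show ?case
      by (metis g.zero tensor.span_zero)
  qed
qed

lemma sum_list_in_tensor_power:
  "(\<And>ys. ys \<in> set yss \<Longrightarrow> length ys = N) \<Longrightarrow> (\<Sum>ys\<leftarrow>yss. pure_tensor scale ys) \<in> tensor_power scale N"
  by (induction yss)
    (auto intro!: tensor.subspace_add[OF subspace_tensor_power] pure_tensor_in_power
      simp: tensor.subspace_0[OF subspace_tensor_power])

end

lemma split_4:
  assumes "length xs = 4 + k"
  obtains x1 x2 x3 x4 ys where "xs = x1 # x2 # x3 # x4 # ys" "length ys = k"
proof -
  have "length xs = Suc (Suc (Suc (Suc k)))"
    using assms by simp
  then show ?thesis
    using that unfolding length_Suc_conv by blast
qed

lemma take4_drop:
  assumes "m + 4 \<le> length xs"
  shows "take 4 (drop m xs) = [xs ! m, xs ! (m + 1), xs ! (m + 2), xs ! (m + 3)]"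
  using assms by (intro nth_equalityI) (auto simp: less_Suc_eq numeral_eq_Suc)

lemma take2_drop:
  assumes "m + 2 \<le> length xs"
  shows "take 2 (drop m xs) = [xs ! m, xs ! (m + 1)]"
  using assms by (intro nth_equalityI) (auto simp: less_Suc_eq numeral_eq_Suc)

lemma sum_list_concat_map: "(\<Sum>y\<leftarrow>concat (map f xs). g y) = (\<Sum>x\<leftarrow>xs. \<Sum>y\<leftarrow>f x. (g y :: 'k::comm_monoid_add))"
  by (induction xs) auto

context ternary_shelf
begin

sublocale X: vector_space "scaleX sc"
  by (rule vector_space_scaleX)

definition R_op :: "('k \<times> 'l) list \<Rightarrow> ('k \<times> 'l) list list" where
  "R_op xs = R_sum T (xs ! 0) (xs ! 1) (xs ! 2) (xs ! 3)"

definition \<theta>_op :: "('k \<times> 'l) list \<Rightarrow> ('k \<times> 'l) list list" where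
  "\<theta>_op xs = \<theta>_sum T (xs ! 0) (xs ! 1)"

lemma length_R_op: "ys \<in> set (R_op xs) \<Longrightarrow> length ys = 4"
  by (auto simp: R_op_def R_sum_def)

lemma length_\<theta>_op: "ys \<in> set (\<theta>_op xs) \<Longrightarrow> length ys = 2"
  by (auto simp: \<theta>_op_def \<theta>_sum_def)

text \<open>R is the braiding of the pairs (x, y) and (z, w): the first legs of z and w move to the
  front and the other two act on x and y.\<close>

lemma pull_R_op:
  "pull R_op f [x, y, z, w] = braiding (x, y) (z, w) (\<lambda>u v. f [fst u, snd u, fst v, snd v])"
proof -
  have "pull R_op f [x, y, z, w] = (\<Sum>(z1, z2, z3)\<leftarrow>comult3 z. \<Sum>(w1, w2, w3)\<leftarrow>comult3 w.
      f [z1, w1, T x z2 w2, T y z3 w3])"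
    by (simp add: pull_def R_op_def R_sum_def sum_list_concat_map case_prod_unfold o_def)
  then show ?thesis
    by (simp only: sum_list_comult3 braiding_def act_def fst_conv snd_conv)
qed

text \<open>The map \<theta> comultiplies a pair and lets the second half act on the first.\<close>

lemma pull_\<theta>_op:
  "pull \<theta>_op f [x, y] = sweedler (x, y) (\<lambda>p1 p2. act p1 p2 (\<lambda>u. f [fst u, snd u]))"
proof -
  have "pull \<theta>_op f [x, y] = (\<Sum>(x1, x2, x3)\<leftarrow>comult3 x. \<Sum>(y1, y2, y3)\<leftarrow>comult3 y.
      f [T x1 x2 y2, T y1 x3 y3])"
    by (simp add: pull_def \<theta>_op_def \<theta>_sum_def sum_list_concat_map case_prod_unfold o_def)
  then show ?thesis
    by (simp only: sum_list_comult3 act_def fst_conv snd_conv)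
qed

lemma pair_linear_multilinear:
  assumes "multilinear_form (scaleX sc) N f" "length as + 2 + length bs = N"
  shows "pair_linear (\<lambda>u. f (as @ fst u # snd u # bs))"
proof (rule pair_linearI)
  fix w
  show "linK (\<lambda>z. f (as @ fst (z, w) # snd (z, w) # bs))"
    using multilinear_formD assms by (simp add: X.multilinear_formD)
  show "linK (\<lambda>z. f (as @ fst (w, z) # snd (w, z) # bs))"
    using X.multilinear_formD[OF assms(1), of "as @ [w]" bs] assms(2) by simp
qed

lemma multilinear_form_2I:
  assumes "\<And>x y. F [x, y] = G (x, y)" "pair_linear G"
  shows "multilinear_form (scaleX sc) 2 F"
  unfolding multilinear_form_def
proof (intro allI impI)
  fix us vs :: "('k \<times> 'l) list" assume "length us + 1 + length vs = 2"
  then consider "length us = 0" "length vs = 1" | "length us = 1" "length vs = 0"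
    by linarith
  then show "linK (\<lambda>x. F (us @ x # vs))"
  proof cases
    case 1
    then obtain w where "us = []" "vs = [w]"
      by (auto simp: length_Suc_conv)
    then show ?thesis
      using pair_linearD(1)[OF assms(2)] by (simp add: assms(1))
  next
    case 2
    then obtain w where "us = [w]" "vs = []"
      by (auto simp: length_Suc_conv)
    then show ?thesis
      using pair_linearD(2)[OF assms(2)] by (simp add: assms(1))
  qed
qed

lemma multilinear_form_4I:
  assumes F: "\<And>x y z w. F [x, y, z, w] = G (x, y) (z, w)"
    and G: "\<And>q. pair_linear (\<lambda>p. G p q)" "\<And>p. pair_linear (G p)"
  shows "multilinear_form (scaleX sc) 4 F"
  unfolding multilinear_form_def
proof (intro allI impI)
  fix us vs :: "('k \<times> 'l) list" assume len: "length us + 1 + length vs = 4"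
  then consider "length us = 0" "length vs = 3" | "length us = 1" "length vs = 2"
    | "length us = 2" "length vs = 1" | "length us = 3" "length vs = 0"
    by linarith
  then show "linK (\<lambda>x. F (us @ x # vs))"
  proof cases
    case 1
    then obtain b c d where "us = []" "vs = [b, c, d]"
      by (auto simp: length_Suc_conv numeral_eq_Suc)
    then show ?thesis
      using pair_linearD(1)[OF G(1)] by (simp add: F)
  next
    case 2
    then obtain a c d where "us = [a]" "vs = [c, d]"
      by (auto simp: length_Suc_conv numeral_eq_Suc)
    then show ?thesis
      using pair_linearD(2)[OF G(1)] by (simp add: F)
  next
    case 3
    then obtain a b d where "us = [a, b]" "vs = [d]"
      by (auto simp: length_Suc_conv numeral_eq_Suc)
    then show ?thesis
      using pair_linearD(1)[OF G(2)] by (simp add: F)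
  next
    case 4
    then obtain a b c where "us = [a, b, c]" "vs = []"
      by (auto simp: length_Suc_conv numeral_eq_Suc)
    then show ?thesis
      using pair_linearD(2)[OF G(2)] by (simp add: F)
  qed
qed

lemma multilinear_op_R: "multilinear_op (scaleX sc) 4 R_op"
  unfolding multilinear_op_def
proof (intro conjI allI impI ballI)
  fix f :: "('k \<times> 'l) list \<Rightarrow> 'k" assume f: "multilinear_form (scaleX sc) 4 f"
  have f1: "pair_linear (\<lambda>u. f [fst u, snd u, fst v, snd v])" for v
    using pair_linear_multilinear[OF f, of "[]" "[fst v, snd v]"] by simp
  have f2: "pair_linear (\<lambda>v. f [fst u, snd u, fst v, snd v])" for u
    using pair_linear_multilinear[OF f, of "[fst u, snd u]" "[]"] by simp
  show "multilinear_form (scaleX sc) 4 (pull R_op f)"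
  proof (rule multilinear_form_4I[where G = "\<lambda>p q. braiding p q (\<lambda>u v. f [fst u, snd u, fst v, snd v])", OF pull_R_op])
    show "pair_linear (\<lambda>p. braiding p q (\<lambda>u v. f [fst u, snd u, fst v, snd v]))" for q
      unfolding braiding_def by (intro pair_linear_intros f1 f2)
    show "pair_linear (\<lambda>q. braiding p q (\<lambda>u v. f [fst u, snd u, fst v, snd v]))" for p
      unfolding braiding_def by (intro pair_linear_intros f1 f2)
  qed
qed (rule length_R_op)

lemma multilinear_op_\<theta>: "multilinear_op (scaleX sc) 2 \<theta>_op"
  unfolding multilinear_op_def
proof (intro conjI allI impI ballI)
  fix f :: "('k \<times> 'l) list \<Rightarrow> 'k" assume f: "multilinear_form (scaleX sc) 2 f"
  have f1: "pair_linear (\<lambda>u. f [fst u, snd u])"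
    using pair_linear_multilinear[OF f, of "[]" "[]"] by simp
  show "multilinear_form (scaleX sc) 2 (pull \<theta>_op f)"
    by (rule multilinear_form_2I[where G = "\<lambda>p. sweedler p (\<lambda>p1 p2. act p1 p2 (\<lambda>u. f [fst u, snd u]))", OF pull_\<theta>_op]) (intro pair_linear_intros f1)
qed (rule length_\<theta>_op)

abbreviation V :: "nat \<Rightarrow> ('k, 'k \<times> 'l) tensor set" where "V \<equiv> tensor_power (scaleX sc)"

abbreviation R_local :: "nat \<Rightarrow> ('k \<times> 'l) list \<Rightarrow> ('k \<times> 'l) list list" where
  "R_local i \<equiv> local_op (2 * (i - 1)) 4 R_op"

abbreviation \<theta>_local :: "nat \<Rightarrow> ('k \<times> 'l) list \<Rightarrow> ('k \<times> 'l) list list" where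
  "\<theta>_local i \<equiv> local_op (2 * (i - 1)) 2 \<theta>_op"

lemma linear_R_map: "Vector_Spaces.linear scale_tensor scale_tensor (R_map sc T n i)"
  unfolding R_map_def by (rule linear_induced_map)

lemma linear_\<theta>_map: "Vector_Spaces.linear scale_tensor scale_tensor (\<theta>_map sc T n i)"
  unfolding \<theta>_map_def by (rule linear_induced_map)

lemma R_local_eq:
  assumes "1 \<le> i" "i < n" "length xs = 2 * n"
  shows "(let m = 2 * (i - 1) in [take m xs @ ys @ drop (m + 4) xs.
        ys \<leftarrow> R_sum T (xs ! m) (xs ! (m + 1)) (xs ! (m + 2)) (xs ! (m + 3))]) = R_local i xs"
  using assms take4_drop[of "2 * (i - 1)" xs] by (simp add: local_op_def R_op_def Let_def)

lemma \<theta>_local_eq: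
  assumes "1 \<le> i" "i \<le> n" "length xs = 2 * n"
  shows "(let m = 2 * (i - 1) in [take m xs @ ys @ drop (m + 2) xs.
        ys \<leftarrow> \<theta>_sum T (xs ! m) (xs ! (m + 1))]) = \<theta>_local i xs"
  using assms take2_drop[of "2 * (i - 1)" xs] by (simp add: local_op_def \<theta>_op_def Let_def)

lemma induced_map_eq_local:
  assumes "t \<in> V N" "multilinear_form (scaleX sc) N f" "\<And>xs. length xs = N \<Longrightarrow> F xs = G xs"
  shows "induced_map (scaleX sc) N F t f = t (pull G f)"
  using assms by (simp add: induced_map_pull) (rule X.tensor_cong, auto simp: pull_def)

lemma R_map_apply:
  assumes "1 \<le> i" "i < n" "t \<in> V (2 * n)" "multilinear_form (scaleX sc) (2 * n) f"
  shows "R_map sc T n i t f = t (pull (R_local i) f)"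
  unfolding R_map_def by (rule induced_map_eq_local[OF assms(3,4) R_local_eq[OF assms(1,2)]])

lemma multilinear_pull_R:
  "1 \<le> i \<Longrightarrow> i < n \<Longrightarrow> multilinear_form (scaleX sc) (2 * n) f \<Longrightarrow>
    multilinear_form (scaleX sc) (2 * n) (pull (R_local i) f)"
  by (rule X.multilinear_form_local[OF _ multilinear_op_R]) auto

lemma multilinear_pull_\<theta>:
  "1 \<le> i \<Longrightarrow> i \<le> n \<Longrightarrow> multilinear_form (scaleX sc) (2 * n) f \<Longrightarrow>
    multilinear_form (scaleX sc) (2 * n) (pull (\<theta>_local i) f)"
  by (rule X.multilinear_form_local[OF _ multilinear_op_\<theta>]) auto

lemma length_R_local:
  "1 \<le> i \<Longrightarrow> i < n \<Longrightarrow> length xs = 2 * n \<Longrightarrow> ys \<in> set (R_local i xs) \<Longrightarrow> length ys = 2 * n"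
  by (auto simp: local_op_def dest!: length_R_op)

lemma length_\<theta>_local:
  "1 \<le> i \<Longrightarrow> i \<le> n \<Longrightarrow> length xs = 2 * n \<Longrightarrow> ys \<in> set (\<theta>_local i xs) \<Longrightarrow> length ys = 2 * n"
  by (auto simp: local_op_def dest!: length_\<theta>_op)

lemma induced_map_pure_local:
  assumes "\<And>f. multilinear_form (scaleX sc) N f \<Longrightarrow> multilinear_form (scaleX sc) N (pull G f)"
    and "length xs = N" "\<And>xs. length xs = N \<Longrightarrow> F xs = G xs"
    and "\<And>ys. ys \<in> set (G xs) \<Longrightarrow> length ys = N"
  shows "induced_map (scaleX sc) N F (pure_tensor (scaleX sc) xs) = (\<Sum>ys\<leftarrow>G xs. pure_tensor (scaleX sc) ys)"
proof -
  have "multilinear_form (scaleX sc) N (pull F f)" if "multilinear_form (scaleX sc) N f" for f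
    using assms(1)[OF that] X.multilinear_form_cong[of N "pull F f" "pull G f"] assms(3) by (simp add: pull_def)
  then show ?thesis
    using X.induced_map_pure_tensor[of N F xs] assms by simp
qed

lemma R_map_pure:
  assumes "1 \<le> i" "i < n" "length xs = 2 * n"
  shows "R_map sc T n i (pure_tensor (scaleX sc) xs) = (\<Sum>ys\<leftarrow>R_local i xs. pure_tensor (scaleX sc) ys)"
  unfolding R_map_def
  by (rule induced_map_pure_local[OF multilinear_pull_R[OF assms(1,2)] assms(3) R_local_eq[OF assms(1,2)] length_R_local[OF assms]])

lemma \<theta>_map_pure:
  assumes "1 \<le> i" "i \<le> n" "length xs = 2 * n"
  shows "\<theta>_map sc T n i (pure_tensor (scaleX sc) xs) = (\<Sum>ys\<leftarrow>\<theta>_local i xs. pure_tensor (scaleX sc) ys)"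
  unfolding \<theta>_map_def
  by (rule induced_map_pure_local[OF multilinear_pull_\<theta>[OF assms(1,2)] assms(3) \<theta>_local_eq[OF assms(1,2)] length_\<theta>_local[OF assms]])

lemma R_map_in:
  assumes "1 \<le> i" "i < n" "t \<in> V (2 * n)"
  shows "R_map sc T n i t \<in> V (2 * n)"
  using linear_R_map _ assms(3)
proof (rule X.linear_tensor_power_invariant)
  fix xs :: "('k \<times> 'l) list" assume len: "length xs = 2 * n"
  show "R_map sc T n i (pure_tensor (scaleX sc) xs) \<in> V (2 * n)"
    unfolding R_map_pure[OF assms(1,2) len]
    by (rule X.sum_list_in_tensor_power) (rule length_R_local[OF assms(1,2) len])
qed

lemma \<theta>_map_in:
  assumes "1 \<le> i" "i \<le> n" "t \<in> V (2 * n)"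
  shows "\<theta>_map sc T n i t \<in> V (2 * n)"
  using linear_\<theta>_map _ assms(3)
proof (rule X.linear_tensor_power_invariant)
  fix xs :: "('k \<times> 'l) list" assume len: "length xs = 2 * n"
  show "\<theta>_map sc T n i (pure_tensor (scaleX sc) xs) \<in> V (2 * n)"
    unfolding \<theta>_map_pure[OF assms(1,2) len]
    by (rule X.sum_list_in_tensor_power) (rule length_\<theta>_local[OF assms(1,2) len])
qed

lemma R_map_apply2:
  assumes "1 \<le> i" "i < n" "1 \<le> j" "j < n" "t \<in> V (2 * n)" "multilinear_form (scaleX sc) (2 * n) f"
  shows "R_map sc T n i (R_map sc T n j t) f = t (pull (R_local j) (pull (R_local i) f))"
  using R_map_apply[OF assms(1,2) R_map_in[OF assms(3,4,5)] assms(6)]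
    R_map_apply[OF assms(3,4,5) multilinear_pull_R[OF assms(1,2,6)]] by (simp only:)

lemma R_map_apply3:
  assumes "1 \<le> i" "i < n" "1 \<le> j" "j < n" "1 \<le> k" "k < n" "t \<in> V (2 * n)"
    "multilinear_form (scaleX sc) (2 * n) f"
  shows "R_map sc T n i (R_map sc T n j (R_map sc T n k t)) f =
    t (pull (R_local k) (pull (R_local j) (pull (R_local i) f)))"
  using R_map_apply2[OF assms(1-4) R_map_in[OF assms(5-7)] assms(8)]
    R_map_apply[OF assms(5-7) multilinear_pull_R[OF assms(3,4) multilinear_pull_R[OF assms(1,2,8)]]]
  by (simp only:)

section \<open>The braid relations for R\<close>

lemma pull_R_local:
  assumes "length as = 2 * (i - 1)"
  shows "pull (R_local i) f (as @ x # y # z # w # bs) =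
    braiding (x, y) (z, w) (\<lambda>u v. f (as @ fst u # snd u # fst v # snd v # bs))"
  using pull_local_op[OF assms, of "[x, y, z, w]" 4 R_op f bs] by (simp add: pull_R_op)

text \<open>Transposition reverses composites, which the palindromic words of the braid relation do
  not notice. What remains is \<open>yang_baxter\<close> for three neighbouring pairs, with the
  other entries as parameters of the form.\<close>

lemma R_map_braid:
  assumes i: "1 \<le> i" "i + 1 < n" and t: "t \<in> V (2 * n)"
  shows "R_map sc T n i (R_map sc T n (i + 1) (R_map sc T n i t)) =
    R_map sc T n (i + 1) (R_map sc T n i (R_map sc T n (i + 1) t))"
proof (rule X.tensor_eqI)
  fix f :: "('k \<times> 'l) list \<Rightarrow> 'k" assume f: "multilinear_form (scaleX sc) (2 * n) f"
  have "R_map sc T n i (R_map sc T n (i + 1) (R_map sc T n i t)) f =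
      t (pull (R_local i) (pull (R_local (i + 1)) (pull (R_local i) f)))"
    using i t f by (intro R_map_apply3) auto
  also have "\<dots> = t (pull (R_local (i + 1)) (pull (R_local i) (pull (R_local (i + 1)) f)))"
  proof (rule X.tensor_cong[OF t])
    fix xs :: "('k \<times> 'l) list" assume len: "length xs = 2 * n"
    define as where "as = take (2 * (i - 1)) xs"
    have as: "length as = 2 * (i - 1)"
      using len i by (simp add: as_def)
    have "length (drop (2 * (i - 1)) xs) = 4 + (2 + 2 * (n - i - 2))"
      using len i by simp
    then obtain x1 x2 x3 x4 cs where
      cs: "drop (2 * (i - 1)) xs = x1 # x2 # x3 # x4 # cs" "length cs = 2 + 2 * (n - i - 2)"
      by (rule split_4)
    obtain x5 x6 bs where "cs = x5 # x6 # bs"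
      using cs(2) by (auto simp: length_Suc_conv numeral_2_eq_2)
    with cs(1) have "drop (2 * (i - 1)) xs = x1 # x2 # x3 # x4 # x5 # x6 # bs"
      by simp
    then have xs: "xs = as @ x1 # x2 # x3 # x4 # x5 # x6 # bs"
      unfolding as_def by (metis append_take_drop_id)
    have lenf: "length as + 6 + length bs = 2 * n"
      using len xs by simp
    \<comment> \<open>A prefix longer by one pair makes the same evaluation rule serve the generator
      with index i + 1.\<close>
    have as2: "length (as @ [x, y]) = 2 * (i + 1 - 1)" for x y
      using as i by simp
    note shift = pull_R_local[OF as2, unfolded append.assoc append_Cons append_Nil]
    have fpl: "pair_linear (\<lambda>a. f (as @ fst a # snd a # fst b # snd b # fst c # snd c # bs))"
      "pair_linear (\<lambda>b. f (as @ fst a # snd a # fst b # snd b # fst c # snd c # bs))"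
      "pair_linear (\<lambda>c. f (as @ fst a # snd a # fst b # snd b # fst c # snd c # bs))" for a b c
      using pair_linear_multilinear[OF f, of as "fst b # snd b # fst c # snd c # bs"]
        pair_linear_multilinear[OF f, of "as @ [fst a, snd a]" "fst c # snd c # bs"]
        pair_linear_multilinear[OF f, of "as @ [fst a, snd a, fst b, snd b]" "bs"] lenf
      by simp_all
    show "pull (R_local i) (pull (R_local (i + 1)) (pull (R_local i) f)) xs =
        pull (R_local (i + 1)) (pull (R_local i) (pull (R_local (i + 1)) f)) xs"
      unfolding xs pull_R_local[OF as] shift prod.collapse
      by (rule yang_baxter[of "\<lambda>a b c. f (as @ fst a # snd a # fst b # snd b # fst c # snd c # bs)", OF fpl])
  qed
  also have "\<dots> = R_map sc T n (i + 1) (R_map sc T n i (R_map sc T n (i + 1) t)) f"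
    using i t f by (intro R_map_apply3[symmetric]) auto
  finally show "R_map sc T n i (R_map sc T n (i + 1) (R_map sc T n i t)) f =
    R_map sc T n (i + 1) (R_map sc T n i (R_map sc T n (i + 1) t)) f" .
qed (use i t in \<open>auto intro!: R_map_in\<close>)

lemma braiding_swap:
  "braiding p q (\<lambda>u v. braiding p' q' (\<lambda>u' v'. K u v u' v')) =
    braiding p' q' (\<lambda>u' v'. braiding p q (\<lambda>u v. K u v u' v'))"
proof -
  have "braiding p q (\<lambda>u v. braiding p' q' (\<lambda>u' v'. K u v u' v')) =
      sweedler q (\<lambda>q1 q2. sweedler q' (\<lambda>q1' q2'. act p q2 (\<lambda>v. act p' q2' (\<lambda>v'. K q1 v q1' v'))))"
    by (simp only: braiding_def act_sweedler)
  also have "\<dots> = sweedler q' (\<lambda>q1' q2'. sweedler q (\<lambda>q1 q2. act p q2 (\<lambda>v. act p' q2' (\<lambda>v'. K q1 v q1' v'))))"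
    by (rule sweedler_swap)
  also have "\<dots> = sweedler q' (\<lambda>q1' q2'. sweedler q (\<lambda>q1 q2. act p' q2' (\<lambda>v'. act p q2 (\<lambda>v. K q1 v q1' v'))))"
    by (intro sweedler_cong act_swap)
  also have "\<dots> = braiding p' q' (\<lambda>u' v'. braiding p q (\<lambda>u v. K u v u' v'))"
    by (simp only: braiding_def act_sweedler)
  finally show ?thesis .
qed

text \<open>The two operators work on disjoint windows, so the claim is an interchange of finite
  sums.\<close>

lemma R_map_commute:
  assumes i: "1 \<le> i" "i + 2 \<le> j" "j < n" and t: "t \<in> V (2 * n)"
  shows "R_map sc T n i (R_map sc T n j t) = R_map sc T n j (R_map sc T n i t)"
proof (rule X.tensor_eqI)
  fix f :: "('k \<times> 'l) list \<Rightarrow> 'k" assume f: "multilinear_form (scaleX sc) (2 * n) f"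
  have "R_map sc T n i (R_map sc T n j t) f = t (pull (R_local j) (pull (R_local i) f))"
    using i t f by (intro R_map_apply2) auto
  also have "\<dots> = t (pull (R_local i) (pull (R_local j) f))"
  proof (rule X.tensor_cong[OF t])
    fix xs :: "('k \<times> 'l) list" assume len: "length xs = 2 * n"
    define as where "as = take (2 * (i - 1)) xs"
    \<comment> \<open>Between the windows lie j - i - 2 pairs, possibly none.\<close>
    define mid where "mid = take (2 * (j - i - 2)) (drop (2 * (i - 1) + 4) xs)"
    have as: "length as = 2 * (i - 1)" and mid: "length mid = 2 * (j - i - 2)"
      using len i by (simp_all add: as_def mid_def)
    have "length (drop (2 * (i - 1)) xs) = 4 + 2 * (n - i - 1)"
      using len i by simp
    then obtain x1 x2 x3 x4 cs where cs: "drop (2 * (i - 1)) xs = x1 # x2 # x3 # x4 # cs" "length cs = 2 * (n - i - 1)"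
      by (rule split_4)
    have "drop (2 * (i - 1) + 4) xs = drop 4 (drop (2 * (i - 1)) xs)"
      by (simp only: drop_drop add.commute)
    also have "\<dots> = cs"
      by (simp only: cs) simp
    finally have cs': "drop (2 * (i - 1) + 4) xs = cs" .
    have "length (drop (2 * (j - i - 2)) cs) = 4 + 2 * (n - j - 1)"
      using cs(2) i by simp
    then obtain y1 y2 y3 y4 bs where "drop (2 * (j - i - 2)) cs = y1 # y2 # y3 # y4 # bs"
      by (rule split_4)
    then have "cs = mid @ y1 # y2 # y3 # y4 # bs"
      unfolding mid_def cs' by (metis append_take_drop_id)
    then have xs: "xs = as @ x1 # x2 # x3 # x4 # mid @ y1 # y2 # y3 # y4 # bs"
      unfolding as_def using cs(1) by (metis append_take_drop_id)
    have as2: "length (as @ [a, b, c, d] @ mid) = 2 * (j - 1)" for a b c d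
      using as mid i by simp
    note shift = pull_R_local[OF as2, unfolded append.assoc append_Cons append_Nil]
    show "pull (R_local j) (pull (R_local i) f) xs = pull (R_local i) (pull (R_local j) f) xs"
      unfolding xs pull_R_local[OF as] shift by (rule braiding_swap)
  qed
  also have "\<dots> = R_map sc T n j (R_map sc T n i t) f"
    using i t f by (intro R_map_apply2[symmetric]) auto
  finally show "R_map sc T n i (R_map sc T n j t) f = R_map sc T n j (R_map sc T n i t) f" .
qed (use i t in \<open>auto intro!: R_map_in\<close>)

end

section \<open>Triangular maps and their traces\<close>

text \<open>Homogeneous elements of \<open>X = \<k> \<oplus> L\<close> of degree 0 (only the unit) and of degree 1.\<close>

definition homogeneous :: "'k::field \<times> 'l::zero \<Rightarrow> bool" where
  "homogeneous x \<longleftrightarrow> x = unitX \<or> fst x = 0"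

text \<open>On homogeneous lists this counts the factors in L. The zero vector counts too, so zero
  entries are treated separately below.\<close>

definition deg :: "('k::field \<times> 'l::zero) list \<Rightarrow> nat" where
  "deg xs = length (filter (\<lambda>x. fst x = 0) xs)"

lemma deg_simps [simp]:
  "deg [] = 0" "deg (x # xs) = (if fst x = 0 then 1 else 0) + deg xs" "deg (xs @ ys) = deg xs + deg ys"
  by (simp_all add: deg_def)

lemma deg_le_length: "deg xs \<le> length xs"
  by (simp add: deg_def)

definition homogeneous_lists :: "nat \<Rightarrow> ('k::field \<times> 'l::zero) list set" where
  "homogeneous_lists N = {xs. length xs = N \<and> (\<forall>x\<in>set xs. homogeneous x)}"

lemma deg_mset_cong: "mset xs = mset ys \<Longrightarrow> deg xs = deg ys"
  by (metis deg_def mset_filter size_mset)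

lemma homogeneous_lists_mset_cong:
  "mset xs = mset ys \<Longrightarrow> xs \<in> homogeneous_lists N \<longleftrightarrow> ys \<in> homogeneous_lists N"
  using mset_eq_setD[of xs ys] mset_eq_length[of xs ys] by (simp add: homogeneous_lists_def)

lemma sum_Pair_0: "(\<Sum>b\<in>A. (0 :: 'k::comm_monoid_add, h b)) = (0, \<Sum>b\<in>A. h b :: 'l::comm_monoid_add)"
  by (induction A rule: infinite_finite_induct) (auto simp: zero_prod_def)

locale finite_ternary_shelf = ternary_shelf sc T + finite_dimensional_vector_space sc Basis
  for sc :: "'k::field \<Rightarrow> 'l::ab_group_add \<Rightarrow> 'l" and T and Basis :: "'l set"
begin

definition basisX :: "('k \<times> 'l) set" where
  "basisX = insert unitX (Pair 0 ` Basis)"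

definition coordX :: "'k \<times> 'l \<Rightarrow> 'k \<times> 'l \<Rightarrow> 'k" where
  "coordX b x = (if fst b = 0 then representation Basis (snd x) (snd b) else fst x)"

lemma finite_basisX: "finite basisX"
  by (simp add: basisX_def finite_Basis)

lemma homogeneous_basisX: "b \<in> basisX \<Longrightarrow> homogeneous b"
  by (auto simp: basisX_def homogeneous_def)

lemma linK_coordX: "linK (coordX b)"
  using independent_Basis
  by (auto simp: linK_iff coordX_def representation_add representation_scale span_Basis scaleX_def case_prod_beta
      simp del: split_paired_All)

lemma coordX_basisX: "b \<in> basisX \<Longrightarrow> c \<in> basisX \<Longrightarrow> coordX b c = (if b = c then 1 else 0)"
  using independent_Basis
  by (auto simp: basisX_def coordX_def representation_basis representation_zero split: if_splits)

lemma expandX: "x = (\<Sum>b\<in>basisX. scaleX sc (coordX b x) b)"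
proof -
  have "unitX \<notin> Pair (0::'k) ` Basis" "inj_on (Pair (0::'k)) Basis"
    by (auto simp: inj_on_def)
  then have "(\<Sum>b\<in>basisX. scaleX sc (coordX b x) b) =
      (fst x, 0) + (\<Sum>b\<in>Basis. (0, sc (representation Basis (snd x) b) b))"
    by (simp add: basisX_def finite_Basis sum.reindex coordX_def scaleX_def)
  also have "(\<Sum>b\<in>Basis. (0 :: 'k, sc (representation Basis (snd x) b) b)) =
      (0, \<Sum>b\<in>Basis. sc (representation Basis (snd x) b) b)"
    by (rule sum_Pair_0)
  also have "(\<Sum>b\<in>Basis. sc (representation Basis (snd x) b) b) = snd x"
    by (rule sum_representation_eq[OF independent_Basis _ finite_Basis order_refl]) (simp add: span_Basis)
  finally show ?thesis
    by simp
qed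

abbreviation pure :: "('k \<times> 'l) list \<Rightarrow> ('k, 'k \<times> 'l) tensor" where
  "pure \<equiv> pure_tensor (scaleX sc)"

text \<open>The filtration of the tensor power by degree. All homogeneous lists are generators, not
  only basis words, because R sends basis words to lists whose entries are homogeneous but need not
  be basis vectors.\<close>

definition low :: "nat \<Rightarrow> nat \<Rightarrow> ('k, 'k \<times> 'l) tensor set" where
  "low N d = tensor.span (pure ` {xs \<in> homogeneous_lists N. deg xs < d})"

lemma pure_in_low: "xs \<in> homogeneous_lists N \<Longrightarrow> deg xs < d \<Longrightarrow> pure xs \<in> low N d"
  by (auto simp: low_def intro: tensor.span_base)

lemma subspace_low: "tensor.subspace (low N d)"
  by (simp add: low_def)

lemma low_mono: "d \<le> d' \<Longrightarrow> low N d \<subseteq> low N d'"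
  unfolding low_def by (intro tensor.span_mono image_mono) auto

lemma words_homogeneous: "I \<in> words basisX N \<Longrightarrow> I \<in> homogeneous_lists N"
  using homogeneous_basisX by (auto simp: words_def homogeneous_lists_def)

text \<open>No list has degree above its length, so step \<open>Suc N\<close> of the filtration
  contains everything; inductions on degree start from this.\<close>

lemma V_subset_low: "V N \<subseteq> low N (Suc N)"
proof
  fix t assume "t \<in> V N"
  then have "t = (\<Sum>I\<in>words basisX N. scale_tensor (t (dual_form coordX I)) (pure I))"
    by (intro X.tensor_expand finite_basisX expandX linK_coordX)
  also have "\<dots> \<in> low N (Suc N)"
    using words_homogeneous deg_le_length
    by (intro tensor.subspace_sum[OF subspace_low] tensor.subspace_scale[OF subspace_low] pure_in_low)
      (auto simp: words_def less_Suc_eq_le)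
  finally show "t \<in> low N (Suc N)" .
qed

lemma V_eq_span_words: "V N = tensor.span (pure ` words basisX N)"
proof (intro equalityI subsetI)
  fix t assume "t \<in> V N"
  then have "t = (\<Sum>I\<in>words basisX N. scale_tensor (t (dual_form coordX I)) (pure I))"
    by (intro X.tensor_expand finite_basisX expandX linK_coordX)
  also have "\<dots> \<in> tensor.span (pure ` words basisX N)"
    by (intro tensor.span_sum tensor.span_scale tensor.span_base imageI)
  finally show "t \<in> tensor.span (pure ` words basisX N)" .
next
  fix t assume "t \<in> tensor.span (pure ` words basisX N)"
  then show "t \<in> V N"
    unfolding tensor_power_def by (rule rev_subsetD) (auto intro!: tensor.span_mono simp: words_def)
qed

text \<open>Linearity is restricted to the tensor power because inverses taken with
  \<open>inv_into\<close> are controlled only there.\<close>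

definition linear_on_V :: "nat \<Rightarrow> (('k, 'k \<times> 'l) tensor \<Rightarrow> ('k, 'k \<times> 'l) tensor) \<Rightarrow> bool" where
  "linear_on_V N g \<longleftrightarrow> (\<forall>s\<in>V N. g s \<in> V N) \<and> (\<forall>s\<in>V N. \<forall>t\<in>V N. g (s + t) = g s + g t) \<and>
     (\<forall>c. \<forall>t\<in>V N. g (scale_tensor c t) = scale_tensor c (g t))"

text \<open>The rearrangement \<rho> gives the leading term. Preserving multisets makes it preserve
  degree, homogeneity and the set of basis words.\<close>

definition triangular :: "nat \<Rightarrow> (('k, 'k \<times> 'l) tensor \<Rightarrow> ('k, 'k \<times> 'l) tensor) \<Rightarrow>
    (('k \<times> 'l) list \<Rightarrow> ('k \<times> 'l) list) \<Rightarrow> bool" where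
  "triangular N g \<rho> \<longleftrightarrow> linear_on_V N g \<and> bij_betw g (V N) (V N) \<and>
     (\<forall>xs\<in>homogeneous_lists N. mset (\<rho> xs) = mset xs \<and> g (pure xs) - pure (\<rho> xs) \<in> low N (deg xs))"

lemma linear_on_V_diff:
  assumes "linear_on_V N g" "s \<in> V N" "t \<in> V N"
  shows "g (s - t) = g s - g t"
proof -
  have "s - t \<in> V N"
    using assms by (intro tensor.subspace_diff[OF X.subspace_tensor_power])
  then have "g ((s - t) + t) = g (s - t) + g t"
    using assms unfolding linear_on_V_def by blast
  then show ?thesis
    by (simp only: diff_add_cancel eq_diff_eq)
qed

lemma linear_on_V_low:
  assumes g: "linear_on_V N g" and gen: "\<And>xs. xs \<in> homogeneous_lists N \<Longrightarrow> deg xs < d \<Longrightarrow> g (pure xs) \<in> W"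
    and W: "tensor.subspace W" and t: "t \<in> low N d"
  shows "g t \<in> W"
proof -
  \<comment> \<open>Membership in the tensor power is carried through the induction, since g is
    additive only there.\<close>
  have "t \<in> V N \<and> g t \<in> W"
    using t unfolding low_def
  proof (induction rule: tensor.span_induct_alt)
    case base
    have "0 \<in> V N"
      by (rule tensor.subspace_0[OF X.subspace_tensor_power])
    then have "g (scale_tensor 0 0) = scale_tensor 0 (g 0)"
      using g by (simp only: linear_on_V_def)
    then have "g 0 = 0"
      by (simp only: tensor.scale_zero_left)
    then show ?case
      using \<open>0 \<in> V N\<close> tensor.subspace_0[OF W] by (simp only:)
  next
    case (step c x y)
    then obtain xs where xs: "x = pure xs" "xs \<in> homogeneous_lists N" "deg xs < d"
      by blast
    then have x: "x \<in> V N"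
      by (auto simp: homogeneous_lists_def intro: X.pure_tensor_in_power)
    then have cx: "scale_tensor c x \<in> V N"
      by (rule tensor.subspace_scale[OF X.subspace_tensor_power])
    have "g (scale_tensor c x + y) = scale_tensor c (g x) + g y"
      using g x cx step(2) by (simp only: linear_on_V_def)
    moreover have "scale_tensor c (g x) + g y \<in> W"
      using gen[OF xs(2,3)] xs(1) step(2)
      by (intro tensor.subspace_add[OF W] tensor.subspace_scale[OF W]) auto
    moreover have "scale_tensor c x + y \<in> V N"
      using cx step(2) by (intro tensor.subspace_add[OF X.subspace_tensor_power]) auto
    ultimately show ?case
      by (simp only:)
  qed
  then show ?thesis ..
qed

lemma triangular_homogeneous:
  assumes "triangular N g \<rho>" "xs \<in> homogeneous_lists N"
  shows "\<rho> xs \<in> homogeneous_lists N" "deg (\<rho> xs) = deg xs"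
  using assms homogeneous_lists_mset_cong[of "\<rho> xs" xs N] deg_mset_cong[of "\<rho> xs" xs]
  by (auto simp: triangular_def)

lemma triangular_low:
  assumes g: "triangular N g \<rho>" and "t \<in> low N d"
  shows "g t \<in> low N d"
proof (rule linear_on_V_low[OF _ _ subspace_low assms(2)])
  show "linear_on_V N g"
    using g by (simp add: triangular_def)
  fix xs :: "('k \<times> 'l) list" assume xs: "xs \<in> homogeneous_lists N" "deg xs < d"
  have "g (pure xs) - pure (\<rho> xs) \<in> low N d"
    using g xs low_mono[of "deg xs" d N] by (auto simp: triangular_def)
  moreover have "pure (\<rho> xs) \<in> low N d"
    using triangular_homogeneous[OF g xs(1)] xs(2) by (intro pure_in_low) auto
  ultimately have "(g (pure xs) - pure (\<rho> xs)) + pure (\<rho> xs) \<in> low N d"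
    by (rule tensor.subspace_add[OF subspace_low])
  then show "g (pure xs) \<in> low N d"
    by (simp only: diff_add_cancel)
qed

lemma triangular_id: "triangular N id id"
  using tensor.subspace_0[OF subspace_low]
  by (auto simp: triangular_def linear_on_V_def)

text \<open>The error of the composite telescopes into g applied to the error of h and the error of
  g at the rearranged list; both have lower degree.\<close>

lemma triangular_comp:
  assumes g: "triangular N g \<rho>" and h: "triangular N h \<rho>'"
  shows "triangular N (g \<circ> h) (\<rho> \<circ> \<rho>')"
proof -
  have lin: "linear_on_V N g" "linear_on_V N h"
    using g h by (auto simp: triangular_def)
  have "linear_on_V N (g \<circ> h)"
    using lin by (auto simp: linear_on_V_def)
  moreover have "bij_betw (g \<circ> h) (V N) (V N)"
    using g h by (auto simp: triangular_def intro: bij_betw_trans)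
  moreover have "mset ((\<rho> \<circ> \<rho>') xs) = mset xs \<and> (g \<circ> h) (pure xs) - pure ((\<rho> \<circ> \<rho>') xs) \<in> low N (deg xs)"
    if xs: "xs \<in> homogeneous_lists N" for xs
  proof
    note hom = triangular_homogeneous[OF h xs]
    show "mset ((\<rho> \<circ> \<rho>') xs) = mset xs"
      using g h xs hom(1) by (simp add: triangular_def)
    have "pure xs \<in> V N" "pure (\<rho>' xs) \<in> V N"
      using xs hom(1) by (auto simp: homogeneous_lists_def intro: X.pure_tensor_in_power)
    then have "g (h (pure xs) - pure (\<rho>' xs)) = g (h (pure xs)) - g (pure (\<rho>' xs))"
      using lin by (intro linear_on_V_diff) (auto simp: linear_on_V_def)
    moreover have "g (h (pure xs) - pure (\<rho>' xs)) \<in> low N (deg xs)"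
      using h xs by (intro triangular_low[OF g]) (auto simp: triangular_def)
    moreover have "g (pure (\<rho>' xs)) - pure (\<rho> (\<rho>' xs)) \<in> low N (deg xs)"
      using g hom by (auto simp: triangular_def)
    ultimately have "(g (h (pure xs)) - g (pure (\<rho>' xs))) + (g (pure (\<rho>' xs)) - pure (\<rho> (\<rho>' xs))) \<in> low N (deg xs)"
      by (intro tensor.subspace_add[OF subspace_low]) simp_all
    then show "(g \<circ> h) (pure xs) - pure ((\<rho> \<circ> \<rho>') xs) \<in> low N (deg xs)"
      by (simp only: o_apply diff_add_cancel add_diff_eq)
  qed
  ultimately show ?thesis
    by (simp add: triangular_def)
qed

text \<open>Surjectivity goes by induction on degree: as \<rho> is an involution, g maps the pure
  tensor of \<rho> xs to that of xs plus an error of smaller degree, which already lies in the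
  image. Injectivity then follows by finite dimension.\<close>

lemma triangularI:
  assumes lin: "Vector_Spaces.linear scale_tensor scale_tensor g" and V: "\<And>t. t \<in> V N \<Longrightarrow> g t \<in> V N"
    and mset: "\<And>xs. xs \<in> homogeneous_lists N \<Longrightarrow> mset (\<rho> xs) = mset xs"
    and inv: "\<And>xs. xs \<in> homogeneous_lists N \<Longrightarrow> \<rho> (\<rho> xs) = xs"
    and low: "\<And>xs. xs \<in> homogeneous_lists N \<Longrightarrow> g (pure xs) - pure (\<rho> xs) \<in> low N (deg xs)"
  shows "triangular N g \<rho>"
proof -
  interpret g: Vector_Spaces.linear scale_tensor scale_tensor g
    by (rule lin)
  have sub: "tensor.subspace (g ` V N)"
    by (rule g.subspace_image[OF X.subspace_tensor_power])
  have "low N d \<subseteq> g ` V N" for d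
  proof (induction d rule: less_induct)
    case (less d)
    have "pure xs \<in> g ` V N" if xs: "xs \<in> homogeneous_lists N" "deg xs < d" for xs
    proof -
      have \<rho>: "\<rho> xs \<in> homogeneous_lists N" "deg (\<rho> xs) = deg xs"
        using homogeneous_lists_mset_cong[OF mset[OF xs(1)]] deg_mset_cong[OF mset[OF xs(1)]] xs(1) by auto
      have "g (pure (\<rho> xs)) - pure xs \<in> g ` V N"
        using low[OF \<rho>(1)] less.IH[of "deg xs"] \<rho>(2) inv[OF xs(1)] xs(2) by auto
      moreover have "g (pure (\<rho> xs)) \<in> g ` V N"
        using \<rho>(1) by (intro imageI) (auto simp: homogeneous_lists_def intro: X.pure_tensor_in_power)
      ultimately have "g (pure (\<rho> xs)) - (g (pure (\<rho> xs)) - pure xs) \<in> g ` V N"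
        using tensor.subspace_diff[OF sub] by blast
      then show ?thesis
        by (simp only: diff_diff_eq2 add_diff_cancel_left')
    qed
    then show ?case
      unfolding low_def by (intro tensor.span_minimal[OF _ sub]) auto
  qed
  then have surj: "g ` V N = V N"
    using V_subset_low V by blast
  have "inj_on g (V N)"
    using tensor.surjective_imp_injective_on_span[OF lin, of "pure ` words basisX N"] surj
      finite_words[OF finite_basisX] by (simp add: V_eq_span_words)
  moreover have "linear_on_V N g"
    using V by (simp add: linear_on_V_def g.add g.scale)
  ultimately show ?thesis
    using surj mset low by (simp add: triangular_def bij_betw_def)
qed

text \<open>For an involution \<rho> the inverse has the same leading term: its error at xs is minus
  the inverse applied to the error of g at \<rho> xs.\<close>

lemma triangular_inv:
  assumes g: "triangular N g \<rho>" and inv: "\<And>xs. xs \<in> homogeneous_lists N \<Longrightarrow> \<rho> (\<rho> xs) = xs"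
  shows "triangular N (inv_into (V N) g) \<rho>"
proof -
  let ?h = "inv_into (V N) g"
  have bij: "bij_betw g (V N) (V N)" and ling: "linear_on_V N g"
    using g by (auto simp: triangular_def)
  have h: "?h t \<in> V N" "g (?h t) = t" if "t \<in> V N" for t
    using bij that by (auto simp: bij_betw_def inv_into_into f_inv_into_f)
  have h_eq: "?h t = s" if "s \<in> V N" "g s = t" for s t
    using bij that by (auto simp: bij_betw_def)
  have lin: "linear_on_V N ?h"
    unfolding linear_on_V_def
  proof (intro conjI ballI allI)
    fix s t assume st: "s \<in> V N" "t \<in> V N"
    show "?h (s + t) = ?h s + ?h t"
      using h st ling
      by (intro h_eq tensor.subspace_add[OF X.subspace_tensor_power]) (simp_all add: linear_on_V_def)
  next
    fix c t assume t: "t \<in> V N"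
    show "?h (scale_tensor c t) = scale_tensor c (?h t)"
      using h t ling
      by (intro h_eq tensor.subspace_scale[OF X.subspace_tensor_power]) (simp_all add: linear_on_V_def)
  qed (rule h)
  have rel: "?h (pure xs) - pure (\<rho> xs) = - ?h (g (pure (\<rho> xs)) - pure xs)"
    if xs: "xs \<in> homogeneous_lists N" for xs
  proof -
    have V: "pure xs \<in> V N" "pure (\<rho> xs) \<in> V N"
      using xs triangular_homogeneous[OF g xs] by (auto simp: homogeneous_lists_def intro: X.pure_tensor_in_power)
    then have "?h (g (pure (\<rho> xs)) - pure xs) = ?h (g (pure (\<rho> xs))) - ?h (pure xs)"
      using ling by (intro linear_on_V_diff[OF lin]) (auto simp: linear_on_V_def)
    moreover have "?h (g (pure (\<rho> xs))) = pure (\<rho> xs)"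
      using V by (intro h_eq) auto
    ultimately show ?thesis
      by (simp only: minus_diff_eq)
  qed
  have lower: "g (pure (\<rho> xs)) - pure xs \<in> low N (deg xs)" if "xs \<in> homogeneous_lists N" for xs
    using g triangular_homogeneous[OF g that] inv[OF that] unfolding triangular_def by metis
  \<comment> \<open>That the inverse respects the filtration is shown by induction on d, because its
    error at a list of degree below d is the inverse of an element of smaller filtration.\<close>
  have hlow: "?h t \<in> low N d" if "t \<in> low N d" for t d
    using that
  proof (induction d arbitrary: t rule: less_induct)
    case (less d)
    show ?case
    proof (rule linear_on_V_low[OF lin _ subspace_low less.prems])
      fix xs :: "('k \<times> 'l) list" assume xs: "xs \<in> homogeneous_lists N" "deg xs < d"
      have "?h (g (pure (\<rho> xs)) - pure xs) \<in> low N d"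
        using less.IH[OF xs(2) lower[OF xs(1)]] low_mono[OF less_imp_le[OF xs(2)]] by (rule rev_subsetD)
      then have "?h (pure xs) - pure (\<rho> xs) \<in> low N d"
        unfolding rel[OF xs(1)] by (rule tensor.subspace_neg[OF subspace_low])
      moreover have "pure (\<rho> xs) \<in> low N d"
        using triangular_homogeneous[OF g xs(1)] xs(2) by (intro pure_in_low) auto
      ultimately have "(?h (pure xs) - pure (\<rho> xs)) + pure (\<rho> xs) \<in> low N d"
        by (rule tensor.subspace_add[OF subspace_low])
      then show "?h (pure xs) \<in> low N d"
        by (simp only: diff_add_cancel)
    qed
  qed
  have "?h (pure xs) - pure (\<rho> xs) \<in> low N (deg xs)" if "xs \<in> homogeneous_lists N" for xs
    unfolding rel[OF that] by (rule tensor.subspace_neg[OF subspace_low hlow[OF lower[OF that]]])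
  then show ?thesis
    using lin g bij_betw_inv_into[OF bij] by (simp add: triangular_def)
qed

lemma triangular_funpow: "triangular N g \<rho> \<Longrightarrow> triangular N (g ^^ j) (\<rho> ^^ j)"
  by (induction j) (auto intro: triangular_comp simp: triangular_id simp del: o_apply)

text \<open>Since g and its inverse share the leading rearrangement, only the absolute value of the
  exponent matters.\<close>

lemma triangular_int_power:
  assumes "triangular N g \<rho>" "\<And>xs. xs \<in> homogeneous_lists N \<Longrightarrow> \<rho> (\<rho> xs) = xs"
  shows "triangular N (int_power (V N) g k) (\<rho> ^^ nat \<bar>k\<bar>)"
  using triangular_funpow[OF assms(1)] triangular_funpow[OF triangular_inv[OF assms]]
  by (auto simp: int_power_def[abs_def])

text \<open>If ys has smaller degree than I, at some position I has a letter from L where ys has the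
  unit, and the coordinate there is 0. The induction discards matching positions; an entry from L
  against the unit letter gives 0 as well.\<close>

lemma low_dual_form:
  assumes "t \<in> low N (deg I)" "I \<in> words basisX N"
  shows "t (dual_form coordX I) = 0"
proof -
  have zero: "dual_form coordX J ys = 0"
    if "length J = length ys" "set J \<subseteq> basisX" "\<forall>y\<in>set ys. homogeneous y" "deg ys < deg J" for J ys
    using that
  proof (induction J ys rule: list_induct2)
    case (Cons b J y ys)
    show ?case
    proof (cases "fst b = 0 \<and> y = unitX")
      case True
      then have "coordX b y = 0"
        by (simp add: coordX_def representation_zero)
      then show ?thesis
        by simp
    next
      case False
      show ?thesis
      proof (cases "fst y = 0 \<and> fst b \<noteq> 0")
        case True
        then show ?thesis
          by (simp add: coordX_def)
      next
        case same: False
        then have "deg ys < deg J"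
          using False Cons.prems by (auto simp: homogeneous_def split: if_splits)
        then show ?thesis
          using Cons by simp
      qed
    qed
  qed simp
  show ?thesis
    using assms(1) unfolding low_def
  proof (induction rule: tensor.span_induct_alt)
    case (step c x y)
    then obtain xs where "x = pure xs" "xs \<in> homogeneous_lists N" "deg xs < deg I"
      by blast
    then have "x (dual_form coordX I) = 0"
      using zero[of I xs] assms(2) by (simp add: pure_tensor_def homogeneous_lists_def words_def)
    then show ?case
      using step(2) by (simp add: scale_tensor_def)
  qed simp
qed

text \<open>The dual form of I vanishes on terms of degree below that of I, so the diagonal
  coefficient at I comes from the leading word \<rho> I alone and is 1 or 0.\<close>

lemma triangular_trace:
  assumes g: "triangular N g \<rho>"
  shows "trace_on scale_tensor (V N) g = of_nat (card {I \<in> words basisX N. \<rho> I = I})"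
proof -
  have lin: "linear_on_V N g"
    using g by (simp add: triangular_def)
  have pure_V: "pure I \<in> V N" if "I \<in> words basisX N" for I
    using that by (auto simp: words_def intro: X.pure_tensor_in_power)
  have "trace_on scale_tensor (V N) g = (\<Sum>I\<in>words basisX N. g (pure I) (dual_form coordX I))"
  proof (rule tensor.trace_on_eq_sum_dual[where \<phi> = "\<lambda>I t. t (dual_form coordX I)"])
    show "t = (\<Sum>I\<in>words basisX N. scale_tensor (t (dual_form coordX I)) (pure I))" if "t \<in> V N" for t
      using that by (intro X.tensor_expand finite_basisX expandX linK_coordX)
  qed (use lin pure_V in \<open>auto simp: linear_on_V_def scale_tensor_def X.subspace_tensor_power
      finite_words finite_basisX\<close>)
  also have "\<dots> = (\<Sum>I\<in>words basisX N. if \<rho> I = I then 1 else 0)"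
  proof (intro sum.cong HOL.refl)
    fix I assume I: "I \<in> words basisX N"
    then have hom: "I \<in> homogeneous_lists N"
      by (rule words_homogeneous)
    have "mset (\<rho> I) = mset I"
      using g hom by (simp add: triangular_def)
    then have \<rho>I: "\<rho> I \<in> words basisX N"
      using I mset_eq_setD[of "\<rho> I" I] mset_eq_length[of "\<rho> I" I] by (simp add: words_def)
    have "(g (pure I) - pure (\<rho> I)) (dual_form coordX I) = 0"
      using g hom unfolding triangular_def by (intro low_dual_form[OF _ I]) blast
    then have "g (pure I) (dual_form coordX I) = pure (\<rho> I) (dual_form coordX I)"
      by simp
    also have "\<dots> = dual_form coordX I (\<rho> I)"
      using \<rho>I I X.multilinear_form_dual_form[OF linK_coordX] by (auto simp: pure_tensor_def words_def)
    also have "\<dots> = (if \<rho> I = I then 1 else 0)"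
      using dual_form_words[OF coordX_basisX I \<rho>I] by auto
    finally show "g (pure I) (dual_form coordX I) = (if \<rho> I = I then 1 else 0)" .
  qed
  also have "\<dots> = of_nat (card {I \<in> words basisX N. \<rho> I = I})"
    using finite_words[OF finite_basisX, of N] by (simp add: sum.If_cases Int_def)
  finally show ?thesis .
qed

end

section \<open>Leading terms of R and \<theta>\<close>

definition swap_pairs :: "'a list \<Rightarrow> 'a list" where
  "swap_pairs xs = drop 2 xs @ take 2 xs"

context finite_ternary_shelf
begin

definition lowering_op :: "nat \<Rightarrow> (('k \<times> 'l) list \<Rightarrow> ('k \<times> 'l) list list) \<Rightarrow> (('k \<times> 'l) list \<Rightarrow> ('k \<times> 'l) list) \<Rightarrow> bool" where
  "lowering_op r G \<pi> \<longleftrightarrow> (\<forall>xs\<in>homogeneous_lists r. \<exists>rest. G xs = \<pi> xs # rest \<and>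
     (\<forall>ys\<in>set rest. 0 \<in> set ys \<or> ys \<in> homogeneous_lists r \<and> deg ys < deg xs))"

lemma local_op_low:
  assumes G: "lowering_op r G \<pi>" and xs: "xs \<in> homogeneous_lists N" and "m + r \<le> N"
  shows "(\<Sum>ys\<leftarrow>local_op m r G xs. pure ys) - pure (take m xs @ \<pi> (take r (drop m xs)) @ drop (m + r) xs)
    \<in> low N (deg xs)"
proof -
  define as where "as = take m xs"
  define mid where "mid = take r (drop m xs)"
  define bs where "bs = drop (m + r) xs"
  have "bs = drop r (drop m xs)"
    by (simp only: bs_def drop_drop add.commute)
  then have eq: "xs = as @ mid @ bs"
    by (simp only: as_def mid_def append_take_drop_id)
  have len: "length as = m" "length mid = r" "length as + length mid + length bs = N"
    using xs \<open>m + r \<le> N\<close> by (auto simp: as_def mid_def bs_def homogeneous_lists_def)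
  have hom: "\<forall>x\<in>set as. homogeneous x" "mid \<in> homogeneous_lists r" "\<forall>x\<in>set bs. homogeneous x"
    using xs len unfolding eq by (simp_all add: homogeneous_lists_def)
  obtain rest where rest: "G mid = \<pi> mid # rest"
    "\<And>ys. ys \<in> set rest \<Longrightarrow> 0 \<in> set ys \<or> ys \<in> homogeneous_lists r \<and> deg ys < deg mid"
    using G hom(2) unfolding lowering_op_def by blast
  have "(\<Sum>ys\<leftarrow>local_op m r G xs. pure ys) = pure (as @ \<pi> mid @ bs) + (\<Sum>ys\<leftarrow>rest. pure (as @ ys @ bs))"
    unfolding local_op_def as_def[symmetric] mid_def[symmetric] bs_def[symmetric] rest(1)
    by (simp only: list.map sum_list.Cons map_map o_def)
  then have diff: "(\<Sum>ys\<leftarrow>local_op m r G xs. pure ys) - pure (as @ \<pi> mid @ bs) = (\<Sum>ys\<leftarrow>rest. pure (as @ ys @ bs))"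
    by (simp only: add_diff_cancel_left')
  have "pure (as @ ys @ bs) \<in> low N (deg xs)" if "ys \<in> set rest" for ys
  proof (cases "0 \<in> set ys")
    case True
    then have "pure (as @ ys @ bs) = 0"
      by (intro X.pure_tensor_zero) auto
    then show ?thesis
      by (simp only: tensor.subspace_0[OF subspace_low])
  next
    case False
    then have ys: "ys \<in> homogeneous_lists r" "deg ys < deg mid"
      using rest(2)[OF that] by auto
    have "deg (as @ ys @ bs) < deg xs"
      using ys(2) unfolding eq by simp
    moreover have "as @ ys @ bs \<in> homogeneous_lists N"
      using ys(1) hom len by (auto simp: homogeneous_lists_def)
    ultimately show ?thesis
      by (intro pure_in_low)
  qed
  then have "(\<Sum>ys\<leftarrow>rest. pure (as @ ys @ bs)) \<in> low N (deg xs)"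
  proof (induction rest)
    case Nil
    then show ?case
      using tensor.subspace_0[OF subspace_low] by (simp only: list.map sum_list.Nil)
  next
    case (Cons ys rest)
    have "pure (as @ ys @ bs) + (\<Sum>ys\<leftarrow>rest. pure (as @ ys @ bs)) \<in> low N (deg xs)"
      using Cons by (intro tensor.subspace_add[OF subspace_low]) simp_all
    then show ?case
      by (simp only: list.map sum_list.Cons)
  qed
  then show ?thesis
    using diff unfolding as_def mid_def bs_def by (simp only:)
qed

text \<open>For the unit every further summand has a zero entry. For z in L the further nonzero
  summands carry z in the second or third leg, which leaves the unit in the first.\<close>

lemma comult3_homogeneous:
  assumes "homogeneous z"
  obtains rest where "comult3 z = (z, unitX, unitX) # rest"
    "\<And>z1 z2 z3. (z1, z2, z3) \<in> set rest \<Longrightarrow> 0 \<in> {z1, z2, z3} \<or>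
      (z1 = unitX \<and> fst z = 0 \<and> homogeneous z2 \<and> homogeneous z3)"
proof -
  obtain a v where z: "z = (a, v)"
    by fastforce
  have "comult3 z = (z, unitX, unitX) # [((a, v), unitX, (0, 0)), (unitX, (0, v), unitX), (unitX, unitX, (0, v))]"
    by (simp add: z comult3_def comult_def)
  moreover have "a = 0 \<or> v = 0"
    using assms by (auto simp: z homogeneous_def)
  ultimately show ?thesis
    by (intro that) (auto simp: z homogeneous_def zero_prod_def)
qed

text \<open>An element of L stays in L because T respects counits, and the unit becomes its multiple
  by the counits of a and b, which are 0 or 1.\<close>

lemma T_homogeneous:
  assumes "homogeneous x" "homogeneous a" "homogeneous b" "T x a b \<noteq> 0"
  shows "homogeneous (T x a b)" "fst (T x a b) = 0 \<longleftrightarrow> fst x = 0"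
proof -
  have "homogeneous (T x a b) \<and> (fst (T x a b) = 0 \<longleftrightarrow> fst x = 0)"
  proof (cases "fst x = 0")
    case True
    then show ?thesis
      by (simp add: homogeneous_def fst_T)
  next
    case False
    then have "x = unitX"
      using assms(1) by (simp add: homogeneous_def)
    then show ?thesis
      using assms by (auto simp: homogeneous_def T_unit_left zero_prod_def)
  qed
  then show "homogeneous (T x a b)" "fst (T x a b) = 0 \<longleftrightarrow> fst x = 0"
    by auto
qed

text \<open>A nonzero summand other than the first replaces z or w from L by the unit, while the
  entries built from x and y keep their degrees.\<close>

lemma lowering_op_R: "lowering_op 4 R_op swap_pairs"
  unfolding lowering_op_def
proof
  fix xs :: "('k \<times> 'l) list" assume xs: "xs \<in> homogeneous_lists 4"
  then obtain x y z w where eq: "xs = [x, y, z, w]"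
    by (auto simp: homogeneous_lists_def length_Suc_conv numeral_eq_Suc)
  have hom: "homogeneous x" "homogeneous y" "homogeneous z" "homogeneous w"
    using xs by (auto simp: eq homogeneous_lists_def)
  obtain zs where zs: "comult3 z = (z, unitX, unitX) # zs"
    "\<And>z1 z2 z3. (z1, z2, z3) \<in> set zs \<Longrightarrow> 0 \<in> {z1, z2, z3} \<or>
      (z1 = unitX \<and> fst z = 0 \<and> homogeneous z2 \<and> homogeneous z3)"
    using comult3_homogeneous[OF hom(3)] by blast
  obtain ws where ws: "comult3 w = (w, unitX, unitX) # ws"
    "\<And>w1 w2 w3. (w1, w2, w3) \<in> set ws \<Longrightarrow> 0 \<in> {w1, w2, w3} \<or>
      (w1 = unitX \<and> fst w = 0 \<and> homogeneous w2 \<and> homogeneous w3)"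
    using comult3_homogeneous[OF hom(4)] by blast
  define h where "h = (\<lambda>(z1, z2, z3) (w1, w2, w3). [z1, w1, T x z2 w2, T y z3 w3])"
  define rest where "rest = map (h (z, unitX, unitX)) ws @ concat (map (\<lambda>t. map (h t) (comult3 w)) zs)"
  have "R_op xs = swap_pairs xs # rest"
    by (simp add: R_op_def R_sum_def eq zs(1) ws(1) h_def rest_def swap_pairs_def T_unit_right case_prod_unfold)
  moreover have "0 \<notin> set ys \<longrightarrow> ys \<in> homogeneous_lists 4 \<and> deg ys < deg xs" if mem: "ys \<in> set rest" for ys
  proof
    assume nz: "0 \<notin> set ys"
    have unit: "homogeneous unitX"
      by (simp add: homogeneous_def)
    obtain t s where ts: "ys = h t s" "t \<in> set zs \<or> t = (z, unitX, unitX) \<and> s \<in> set ws"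
      "s \<in> set ws \<or> s = (w, unitX, unitX)"
      using mem unfolding rest_def ws(1) set_append set_concat set_map image_image list.set by blast
    obtain z1 z2 z3 w1 w2 w3 where t: "t = (z1, z2, z3)" and s: "s = (w1, w2, w3)"
      by (metis prod_cases3)
    note cases = ts(2,3)[unfolded t s]
    have ys: "ys = [z1, w1, T x z2 w2, T y z3 w3]"
      by (simp add: ts(1) t s h_def)
    have nz': "0 \<notin> {z1, z2, z3}" "0 \<notin> {w1, w2, w3}" "T x z2 w2 \<noteq> 0" "T y z3 w3 \<noteq> 0"
      using nz ys by auto
    have z': "homogeneous z1" "homogeneous z2" "homogeneous z3" "(z1, z2, z3) = (z, unitX, unitX) \<or> z1 = unitX \<and> fst z = 0"
      using cases(1) zs(2)[of z1 z2 z3] nz'(1) hom unit by auto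
    have w': "homogeneous w1" "homogeneous w2" "homogeneous w3" "(w1, w2, w3) = (w, unitX, unitX) \<or> w1 = unitX \<and> fst w = 0"
      using cases(2) ws(2)[of w1 w2 w3] nz'(2) hom unit by auto
    have ne: "z1 = unitX \<and> fst z = 0 \<or> w1 = unitX \<and> fst w = 0"
      using cases(1) zs(2)[of z1 z2 z3] ws(2)[of w1 w2 w3] nz'(1,2) by blast
    note Tx = T_homogeneous[OF hom(1) z'(2) w'(2) nz'(3)]
    note Ty = T_homogeneous[OF hom(2) z'(3) w'(3) nz'(4)]
    have "ys \<in> homogeneous_lists 4"
      using z'(1) w'(1) Tx(1) Ty(1) by (simp add: ys homogeneous_lists_def)
    moreover have "deg ys < deg xs"
      using z'(4) w'(4) ne by (auto simp: ys eq Tx(2) Ty(2))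
    ultimately show "ys \<in> homogeneous_lists 4 \<and> deg ys < deg xs"
      by simp
  qed
  ultimately show "\<exists>rest. R_op xs = swap_pairs xs # rest \<and>
      (\<forall>ys\<in>set rest. 0 \<in> set ys \<or> ys \<in> homogeneous_lists 4 \<and> deg ys < deg xs)"
    by blast
qed

text \<open>The degree of an output entry is that of the first leg of x or y, and a nonzero summand
  other than the first has the unit in such a leg in place of an element of L.\<close>

lemma lowering_op_\<theta>: "lowering_op 2 \<theta>_op id"
  unfolding lowering_op_def
proof
  fix xs :: "('k \<times> 'l) list" assume xs: "xs \<in> homogeneous_lists 2"
  then obtain x y where eq: "xs = [x, y]"
    by (auto simp: homogeneous_lists_def length_Suc_conv numeral_eq_Suc)
  have hom: "homogeneous x" "homogeneous y"
    using xs by (auto simp: eq homogeneous_lists_def)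
  obtain zs where zs: "comult3 x = (x, unitX, unitX) # zs"
    "\<And>z1 z2 z3. (z1, z2, z3) \<in> set zs \<Longrightarrow> 0 \<in> {z1, z2, z3} \<or>
      (z1 = unitX \<and> fst x = 0 \<and> homogeneous z2 \<and> homogeneous z3)"
    using comult3_homogeneous[OF hom(1)] by blast
  obtain ws where ws: "comult3 y = (y, unitX, unitX) # ws"
    "\<And>w1 w2 w3. (w1, w2, w3) \<in> set ws \<Longrightarrow> 0 \<in> {w1, w2, w3} \<or>
      (w1 = unitX \<and> fst y = 0 \<and> homogeneous w2 \<and> homogeneous w3)"
    using comult3_homogeneous[OF hom(2)] by blast
  define h where "h = (\<lambda>(z1, z2, z3) (w1, w2, w3). [T z1 z2 w2, T w1 z3 w3])"
  define rest where "rest = map (h (x, unitX, unitX)) ws @ concat (map (\<lambda>t. map (h t) (comult3 y)) zs)"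
  have "\<theta>_op xs = id xs # rest"
    by (simp add: \<theta>_op_def \<theta>_sum_def eq zs(1) ws(1) h_def rest_def T_unit_right case_prod_unfold)
  moreover have "0 \<notin> set ys \<longrightarrow> ys \<in> homogeneous_lists 2 \<and> deg ys < deg xs" if mem: "ys \<in> set rest" for ys
  proof
    assume nz: "0 \<notin> set ys"
    have unit: "homogeneous unitX"
      by (simp add: homogeneous_def)
    obtain t s where ts: "ys = h t s" "t \<in> set zs \<or> t = (x, unitX, unitX) \<and> s \<in> set ws"
      "s \<in> set ws \<or> s = (y, unitX, unitX)"
      using mem unfolding rest_def ws(1) set_append set_concat set_map image_image list.set by blast
    obtain z1 z2 z3 w1 w2 w3 where t: "t = (z1, z2, z3)" and s: "s = (w1, w2, w3)"
      by (metis prod_cases3)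
    note cases = ts(2,3)[unfolded t s]
    have ys: "ys = [T z1 z2 w2, T w1 z3 w3]"
      by (simp add: ts(1) t s h_def)
    have nz': "0 \<notin> {z1, z2, z3}" "0 \<notin> {w1, w2, w3}" "T z1 z2 w2 \<noteq> 0" "T w1 z3 w3 \<noteq> 0"
      using nz ys by auto
    have z': "homogeneous z1" "homogeneous z2" "homogeneous z3" "(z1, z2, z3) = (x, unitX, unitX) \<or> z1 = unitX \<and> fst x = 0"
      using cases(1) zs(2)[of z1 z2 z3] nz'(1) hom unit by auto
    have w': "homogeneous w1" "homogeneous w2" "homogeneous w3" "(w1, w2, w3) = (y, unitX, unitX) \<or> w1 = unitX \<and> fst y = 0"
      using cases(2) ws(2)[of w1 w2 w3] nz'(2) hom unit by auto
    have ne: "z1 = unitX \<and> fst x = 0 \<or> w1 = unitX \<and> fst y = 0"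
      using cases(1) zs(2)[of z1 z2 z3] ws(2)[of w1 w2 w3] nz'(1,2) by blast
    note Tx = T_homogeneous[OF z'(1,2) w'(2) nz'(3)]
    note Ty = T_homogeneous[OF w'(1) z'(3) w'(3) nz'(4)]
    have "ys \<in> homogeneous_lists 2"
      using Tx(1) Ty(1) by (simp add: ys homogeneous_lists_def)
    moreover have "deg ys < deg xs"
      using z'(4) w'(4) ne by (auto simp: ys eq Tx(2) Ty(2))
    ultimately show "ys \<in> homogeneous_lists 2 \<and> deg ys < deg xs"
      by simp
  qed
  ultimately show "\<exists>rest. \<theta>_op xs = id xs # rest \<and>
      (\<forall>ys\<in>set rest. 0 \<in> set ys \<or> ys \<in> homogeneous_lists 2 \<and> deg ys < deg xs)"
    by blast
qed

end

section \<open>Components of framed links\<close>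

lemma homeomorphism_image_components:
  assumes "homeomorphism S S' f g" "C \<in> components S"
  shows "f ` C \<in> components S'"
proof -
  obtain x where "x \<in> S" "C = connected_component_set S x"
    using assms(2) by (auto elim: componentsE)
  then have "f ` C = connected_component_set S' (f x)"
    using connected_component_set_homeomorphism[OF assms(1)] by simp
  moreover have "f x \<in> S'"
    using assms(1) \<open>x \<in> S\<close> by (auto simp: homeomorphism_def)
  ultimately show ?thesis
    by (simp add: componentsI)
qed

lemma bij_betw_components_homeomorphism:
  assumes "homeomorphism S S' f g"
  shows "bij_betw (image f) (components S) (components S')"
proof (rule bij_betw_byWitness[where f' = "image g"])
  have g: "homeomorphism S' S g f"
    using assms by (rule homeomorphism_symD)
  show "image f ` components S \<subseteq> components S'" "image g ` components S' \<subseteq> components S"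
    using homeomorphism_image_components[OF assms] homeomorphism_image_components[OF g] by blast+
  show "\<forall>C\<in>components S. g ` f ` C = C"
    using assms by (metis homeomorphism_of_subsets homeomorphism_def in_components_subset order_refl)
  show "\<forall>C\<in>components S'. f ` g ` C = C"
    using g by (metis homeomorphism_of_subsets homeomorphism_def in_components_subset order_refl)
qed

lemma isotopic_sym:
  assumes "isotopic S S'"
  shows "isotopic S' S"
proof -
  obtain H :: "real \<times> (real ^ 3) \<Rightarrow> real ^ 3" where H: "continuous_on ({0..1} \<times> UNIV) H"
    "\<And>s. s \<in> {0..1} \<Longrightarrow> \<exists>g. homeomorphism UNIV UNIV (\<lambda>p. H (s, p)) g"
    "\<And>p. H (0, p) = p" "(\<lambda>p. H (1, p)) ` S = S'"
    using assms unfolding isotopic_def by blast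
  obtain h where h: "homeomorphism UNIV UNIV (\<lambda>p. H (1, p)) h"
    using H(2)[of 1] by auto
  then have hh: "H (1, h p) = p" "h (H (1, p)) = p" for p
    by (auto simp: homeomorphism_def)
  have h': "homeomorphism UNIV UNIV h (\<lambda>p. H (1, p))"
    using h by (rule homeomorphism_symD)
  have ch: "continuous_on UNIV h"
    using h by (simp add: homeomorphism_def)
  \<comment> \<open>Time is reversed and the result composed with the inverse of the final
    homeomorphism; only that single inverse has to be continuous.\<close>
  let ?G = "\<lambda>(s, p). H (1 - s, h p)"
  have "continuous_on ({0..1} \<times> UNIV) (H \<circ> (\<lambda>(s, p). (1 - s, h p)))"
  proof (rule continuous_on_compose)
    show "continuous_on ({0..1::real} \<times> UNIV) (\<lambda>(s, p). (1 - s, h p))"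
      unfolding case_prod_beta
      by (auto intro!: continuous_intros continuous_on_compose2[OF ch])
    show "continuous_on ((\<lambda>(s, p). (1 - s, h p)) ` ({0..1::real} \<times> UNIV)) H"
      by (rule continuous_on_subset[OF H(1)]) auto
  qed
  then have "continuous_on ({0..1} \<times> UNIV) ?G"
    by (simp add: o_def case_prod_beta)
  moreover have "\<forall>s\<in>{0..1}. \<exists>g. homeomorphism UNIV UNIV (\<lambda>p. ?G (s, p)) g"
  proof
    fix s :: real assume s: "s \<in> {0..1}"
    obtain g where "homeomorphism UNIV UNIV (\<lambda>p. H (1 - s, p)) g"
      using H(2)[of "1 - s"] s by auto
    from homeomorphism_compose[OF h' this] show "\<exists>g. homeomorphism UNIV UNIV (\<lambda>p. ?G (s, p)) g"
      by (auto simp: o_def)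
  qed
  moreover have "\<forall>p. ?G (0, p) = p"
    by (simp add: hh)
  moreover have "(\<lambda>p. ?G (1, p)) ` S' = S"
    by (simp add: H(4)[symmetric] H(3) hh image_image)
  ultimately show ?thesis
    unfolding isotopic_def by blast
qed

lemma isotopic_trans:
  assumes "isotopic S S'" "isotopic S' S''"
  shows "isotopic S S''"
proof -
  obtain H :: "real \<times> (real ^ 3) \<Rightarrow> real ^ 3" where H: "continuous_on ({0..1} \<times> UNIV) H"
    "\<And>s. s \<in> {0..1} \<Longrightarrow> \<exists>g. homeomorphism UNIV UNIV (\<lambda>p. H (s, p)) g"
    "\<And>p. H (0, p) = p" "(\<lambda>p. H (1, p)) ` S = S'"
    using assms(1) unfolding isotopic_def by blast
  obtain G :: "real \<times> (real ^ 3) \<Rightarrow> real ^ 3" where G: "continuous_on ({0..1} \<times> UNIV) G"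
    "\<And>s. s \<in> {0..1} \<Longrightarrow> \<exists>g. homeomorphism UNIV UNIV (\<lambda>p. G (s, p)) g"
    "\<And>p. G (0, p) = p" "(\<lambda>p. G (1, p)) ` S' = S''"
    using assms(2) unfolding isotopic_def by blast
  \<comment> \<open>Both isotopies run simultaneously, which avoids gluing two time
    intervals.\<close>
  let ?F = "\<lambda>(s, p). G (s, H (s, p))"
  have "continuous_on ({0..1} \<times> UNIV) (G \<circ> (\<lambda>q. (fst q, H q)))"
  proof (rule continuous_on_compose)
    show "continuous_on ({0..1} \<times> UNIV) (\<lambda>q. (fst q, H q))"
      by (intro continuous_intros H(1))
    show "continuous_on ((\<lambda>q. (fst q, H q)) ` ({0..1::real} \<times> UNIV)) G"
      by (rule continuous_on_subset[OF G(1)]) auto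
  qed
  then have "continuous_on ({0..1} \<times> UNIV) ?F"
    by (simp add: o_def case_prod_beta)
  moreover have "\<forall>s\<in>{0..1}. \<exists>g. homeomorphism UNIV UNIV (\<lambda>p. ?F (s, p)) g"
  proof
    fix s :: real assume s: "s \<in> {0..1}"
    obtain h g where "homeomorphism UNIV UNIV (\<lambda>p. H (s, p)) h" "homeomorphism UNIV UNIV (\<lambda>p. G (s, p)) g"
      using H(2) G(2) s by blast
    from homeomorphism_compose[OF this] show "\<exists>g. homeomorphism UNIV UNIV (\<lambda>p. ?F (s, p)) g"
      by (auto simp: o_def)
  qed
  moreover have "\<forall>p. ?F (0, p) = p"
    by (simp add: H(3) G(3))
  moreover have "(\<lambda>p. ?F (1, p)) ` S = S''"
    by (simp add: H(4)[symmetric] G(4)[symmetric] image_image)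
  ultimately show ?thesis
    unfolding isotopic_def by blast
qed

lemma isotopic_card_components:
  assumes "isotopic S S'"
  shows "card (components S) = card (components S')"
proof -
  obtain H :: "real \<times> (real ^ 3) \<Rightarrow> real ^ 3" where H: "(\<lambda>p. H (1, p)) ` S = S'"
    "\<exists>g. homeomorphism UNIV UNIV (\<lambda>p. H (1, p)) g"
    using assms unfolding isotopic_def by force
  then obtain g where "homeomorphism UNIV UNIV (\<lambda>p. H (1, p)) g"
    by blast
  then have "homeomorphism S S' (\<lambda>p. H (1, p)) g"
    using H(1) by (auto intro: homeomorphism_of_subsets)
  then show ?thesis
    by (meson bij_betw_components_homeomorphism bij_betw_same_card)
qed

text \<open>A colouring of the pieces that agrees on meeting pieces has closed level sets, so it is
  constant on every component of the union.\<close>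

lemma card_colourings_eq_power_components:
  fixes K :: "'i \<Rightarrow> 'a::topological_space set"
  assumes "finite I" and conn: "\<And>i. i \<in> I \<Longrightarrow> connected (K i)"
    and clo: "\<And>i. i \<in> I \<Longrightarrow> closed (K i)" and ne: "\<And>i. i \<in> I \<Longrightarrow> K i \<noteq> {}"
  shows "card {f \<in> I \<rightarrow>\<^sub>E C. \<forall>i\<in>I. \<forall>j\<in>I. K i \<inter> K j \<noteq> {} \<longrightarrow> f i = f j}
    = card C ^ card (components (\<Union>i\<in>I. K i))"
proof -
  define U where "U = (\<Union>i\<in>I. K i)"
  have "\<exists>c. c \<in> components U \<and> K i \<subseteq> c" if "i \<in> I" for i
    using that conn ne exists_component_superset[of "K i" U] by (force simp: U_def)
  then obtain comp where comp: "\<And>i. i \<in> I \<Longrightarrow> comp i \<in> components U" "\<And>i. i \<in> I \<Longrightarrow> K i \<subseteq> comp i"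
    by metis
  have onto: "\<exists>i\<in>I. c = comp i" if c: "c \<in> components U" for c
  proof -
    obtain x where "x \<in> c" "x \<in> U"
      using in_components_nonempty[OF c] in_components_subset[OF c] by blast
    then obtain i where "i \<in> I" "x \<in> K i"
      by (auto simp: U_def)
    then show ?thesis
      using comp components_nonoverlap[OF c, of "comp i"] \<open>x \<in> c\<close> by blast
  qed
  have meet: "comp i = comp j" if "i \<in> I" "j \<in> I" "K i \<inter> K j \<noteq> {}" for i j
    using comp that components_nonoverlap[of "comp i" U "comp j"] by blast
  have sep: "f i = f j"
    if f: "\<And>i j. i \<in> I \<Longrightarrow> j \<in> I \<Longrightarrow> K i \<inter> K j \<noteq> {} \<Longrightarrow> f i = f j"
      and ij: "i \<in> I" "j \<in> I" "comp i = comp j" for f :: "'i \<Rightarrow> 'c" and i j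
  proof (rule ccontr)
    assume "f i \<noteq> f j"
    \<comment> \<open>Finiteness of \<open>I\<close> makes both unions closed, and equal colours on
      meeting pieces make them disjoint.\<close>
    define A where "A = (\<Union>k\<in>{k\<in>I. f k = f i}. K k)"
    define B where "B = (\<Union>k\<in>{k\<in>I. f k \<noteq> f i}. K k)"
    have "closed A" "closed B"
      unfolding A_def B_def using \<open>finite I\<close> clo by (auto intro!: closed_UN)
    moreover have "A \<inter> B \<inter> comp i = {}"
      using f by (fastforce simp: A_def B_def)
    moreover have "comp i \<subseteq> A \<union> B"
      using in_components_subset[OF comp(1)[OF ij(1)]] by (auto simp: U_def A_def B_def)
    moreover have "K i \<subseteq> A \<inter> comp i"
      using ij comp(2) by (auto simp: A_def)
    moreover have "K j \<subseteq> B \<inter> comp i"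
      using ij comp(2)[of j] \<open>f i \<noteq> f j\<close> by (auto simp: B_def)
    ultimately show False
      using connected_closedD[OF in_components_connected[OF comp(1)[OF ij(1)]], of A B]
        ne[OF ij(1)] ne[OF ij(2)] by auto
  qed
  have fin: "finite (components U)"
    by (rule finite_surj[OF \<open>finite I\<close>, of _ comp]) (use onto in blast)
  \<comment> \<open>Colourings of the components are pulled back along \<open>comp\<close>; the
    inverse reads the colour of a component off one chosen piece in it.\<close>
  have "bij_betw (\<lambda>h. restrict (h \<circ> comp) I) (components U \<rightarrow>\<^sub>E C)
      {f \<in> I \<rightarrow>\<^sub>E C. \<forall>i\<in>I. \<forall>j\<in>I. K i \<inter> K j \<noteq> {} \<longrightarrow> f i = f j}" (is "bij_betw ?r ?A ?B")
    unfolding bij_betw_def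
  proof
    show "inj_on ?r ?A"
    proof (rule inj_onI)
      fix h h' assume h: "h \<in> ?A" "h' \<in> ?A" "?r h = ?r h'"
      show "h = h'"
      proof (rule PiE_ext[OF h(1,2)])
        fix c assume "c \<in> components U"
        then obtain i where "i \<in> I" "c = comp i"
          using onto by blast
        then show "h c = h' c"
          using fun_cong[OF h(3), of i] by simp
      qed
    qed
    show "?r ` ?A = ?B"
    proof (intro equalityI subsetI)
      fix f assume "f \<in> ?r ` ?A"
      then obtain h where "h \<in> ?A" "f = ?r h"
        by blast
      moreover have "h (comp i) = h (comp j)" if "i \<in> I" "j \<in> I" "K i \<inter> K j \<noteq> {}" for i j
        using meet[OF that] by simp
      ultimately show "f \<in> ?B"
        using comp(1) by (auto simp: PiE_iff)
    next
      fix f assume f: "f \<in> ?B"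
      have "\<forall>c\<in>components U. \<exists>i. i \<in> I \<and> comp i = c"
        using onto by blast
      then obtain r where r: "\<And>c. c \<in> components U \<Longrightarrow> r c \<in> I" "\<And>c. c \<in> components U \<Longrightarrow> comp (r c) = c"
        by metis
      define h where "h = restrict (f \<circ> r) (components U)"
      have "h \<in> ?A"
        using f r(1) by (auto simp: h_def PiE_iff)
      moreover have "?r h = f"
      proof
        fix i
        show "?r h i = f i"
        proof (cases "i \<in> I")
          case True
          have "f (r (comp i)) = f i"
            using sep[of f "r (comp i)" i] f r[OF comp(1)[OF True]] True by blast
          then show ?thesis
            using True comp(1) by (simp add: h_def)
        next
          case False
          then show ?thesis
            using f by (auto simp: PiE_iff extensional_def)
        qed
      qed
      ultimately show "f \<in> ?r ` ?A"
        by blast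
    qed
  qed
  then show ?thesis
    using card_funcsetE[OF fin, of C] by (simp add: bij_betw_same_card[symmetric] U_def)
qed

section \<open>Components of closed braids\<close>

definition syllable_perm :: "nat \<times> int \<Rightarrow> nat \<Rightarrow> nat" where
  "syllable_perm = (\<lambda>(i, k). if odd k then Transposition.transpose i (i + 1) else id)"

definition string_perm :: "(nat \<times> int) list \<Rightarrow> nat \<Rightarrow> nat" where
  "string_perm w = foldr (\<circ>) (map syllable_perm w) id"

text \<open>In a sector with sections \<open>D s\<close>, the ribbon starting in position \<open>p\<close> is \<open>q p\<close>, and it ends in
  position \<open>\<tau> p\<close>.\<close>

definition ribbon_sector :: "nat \<Rightarrow> (real \<Rightarrow> (real \<times> real) set) \<Rightarrow>
    (nat \<Rightarrow> real \<Rightarrow> real \<Rightarrow> real \<times> real) \<Rightarrow> (nat \<Rightarrow> nat) \<Rightarrow> bool" where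
  "ribbon_sector n D q \<tau> \<longleftrightarrow>
     (\<forall>s. D s = (\<Union>p\<in>{1..n}. q p s ` {-1/4..1/4})) \<and>
     (\<forall>p\<in>{1..n}. continuous_on ({0..1} \<times> {-1/4..1/4}) (\<lambda>(s, u). q p s u)) \<and>
     (\<forall>p\<in>{1..n}. \<forall>s. \<forall>u\<in>{-1/4..1/4}. fst (q p s u) > 0) \<and>
     (\<forall>p\<in>{1..n}. \<forall>p'\<in>{1..n}. \<forall>s. \<forall>u\<in>{-1/4..1/4}. \<forall>u'\<in>{-1/4..1/4}.
        q p s u = q p' s u' \<longrightarrow> p = p') \<and>
     (\<forall>p\<in>{1..n}. \<forall>u. q p 0 u = (real p + u, 0) \<and> q p 1 u = (real (\<tau> p) + u, 0)) \<and>
     bij_betw \<tau> {1..n} {1..n}"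

section \<open>Ribbons within a single sector\<close>

lemma cos_sin_int_pi:
  "cos (pi * of_int k) = (if even k then 1 else - 1 :: real)" "sin (pi * of_int k) = (0 :: real)"
  by (simp_all add: cos_npi_int)

lemma real_near_eq:
  assumes "\<bar>real p - real p'\<bar> < 1"
  shows "p = p'"
proof -
  have "real p < real p' + 1" "real p' < real p + 1"
    using assms by linarith+
  then show ?thesis
    by linarith
qed

lemma mult_cos_sin_bound:
  fixes u :: real
  assumes "\<bar>u\<bar> \<le> c"
  shows "\<bar>u * cos x\<bar> \<le> c" "\<bar>u * sin x\<bar> \<le> c"
  using mult_mono[OF assms abs_cos_le_one[of x]] mult_mono[OF assms abs_sin_le_one[of x]] assms
  by (auto simp: abs_mult)

lemma interval_eq: "{-1/4..1/4} = {u::real. \<bar>u\<bar> \<le> 1/4}"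
  by (auto simp: abs_le_iff)

text \<open>Each ribbon stays within radial distance 1/4 of its core and the cores are at least 1
  apart, so distinct ribbons are disjoint; whole turns bring each ribbon back to its place.\<close>

lemma ribbon_sector_twist:
  "ribbon_sector (length ts) (twist_section ts)
     (\<lambda>p s u. (real p + u * cos (2 * pi * of_int (ts ! (p - 1)) * s),
               - u * sin (2 * pi * of_int (ts ! (p - 1)) * s))) id"
  (is "ribbon_sector ?n _ ?q _")
  unfolding ribbon_sector_def
proof (intro conjI allI ballI impI)
  fix s
  show "twist_section ts s = (\<Union>p\<in>{1..?n}. ?q p s ` {-1/4..1/4})"
  proof (intro equalityI subsetI)
    fix x assume "x \<in> twist_section ts s"
    \<comment> \<open>The section numbers the strings from 0, the ribbons are numbered from
      1.\<close>
    then obtain p u where "p < ?n" "\<bar>u\<bar> \<le> 1/4" "x = ?q (Suc p) s u"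
      by (auto simp: twist_section_def)
    then show "x \<in> (\<Union>p\<in>{1..?n}. ?q p s ` {-1/4..1/4})"
      by (intro UN_I[of "Suc p"] image_eqI[of _ _ u]) (auto simp: abs_le_iff)
  next
    fix x assume "x \<in> (\<Union>p\<in>{1..?n}. ?q p s ` {-1/4..1/4})"
    then obtain p u where "p \<in> {1..?n}" "u \<in> {-1/4..1/4}" "x = ?q p s u"
      by blast
    then show "x \<in> twist_section ts s"
      unfolding twist_section_def mem_Collect_eq
      by (intro exI[of _ "p - 1"] exI[of _ u]) (auto simp: abs_le_iff)
  qed
next
  fix p
  show "continuous_on ({0..1} \<times> {-1/4..1/4}) (\<lambda>(s, u). ?q p s u)"
    unfolding case_prod_beta by (intro continuous_intros)
next
  fix p and s u :: real assume "p \<in> {1..?n}" "u \<in> {-1/4..1/4}"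
  then have "\<bar>u\<bar> \<le> 1/4" "real p \<ge> 1"
    by (auto simp: abs_le_iff)
  moreover from this(1) have "\<bar>u * cos (2 * pi * of_int (ts ! (p - 1)) * s)\<bar> \<le> 1/4"
    by (rule mult_cos_sin_bound)
  ultimately show "fst (?q p s u) > 0"
    unfolding fst_conv by linarith
next
  fix p p' and s u u' :: real
  assume *: "u \<in> {-1/4..1/4}" "u' \<in> {-1/4..1/4}" "?q p s u = ?q p' s u'"
  have "\<bar>u\<bar> \<le> 1/4" "\<bar>u'\<bar> \<le> 1/4"
    using *(1,2) by (auto simp: abs_le_iff)
  then have "\<bar>u * cos (2 * pi * of_int (ts ! (p - 1)) * s)\<bar> \<le> 1/4"
    "\<bar>u' * cos (2 * pi * of_int (ts ! (p' - 1)) * s)\<bar> \<le> 1/4"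
    by (simp_all only: mult_cos_sin_bound)
  moreover have "real p + u * cos (2 * pi * of_int (ts ! (p - 1)) * s) =
      real p' + u' * cos (2 * pi * of_int (ts ! (p' - 1)) * s)"
    using *(3) by (simp only: prod.inject)
  ultimately show "p = p'"
    by (intro real_near_eq) linarith
next
  fix p :: nat and u :: real
  have "2 * pi * real_of_int (ts ! (p - 1)) * 1 = pi * real_of_int (2 * ts ! (p - 1))"
    by simp
  then show "?q p 1 u = (real (id p) + u, 0)"
    by (simp only: cos_sin_int_pi) simp
  show "?q p 0 u = (real p + u, 0)"
    by simp
qed simp

text \<open>After k half turns the two cores have changed places exactly when k is odd, whence the
  permutation.\<close>

lemma ribbon_sector_crossing:
  assumes i: "1 \<le> i" "i < n"
  shows "ribbon_sector n (crossing_section n (i, k))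
     (\<lambda>p s u. if p \<in> {i, i + 1}
        then (real i + 1/2 + (real p - (real i + 1/2)) * cos (pi * of_int k * s) + u,
              - (real p - (real i + 1/2)) * sin (pi * of_int k * s))
        else (real p + u, 0)) (syllable_perm (i, k))"
  (is "ribbon_sector _ _ ?q _")
  unfolding ribbon_sector_def
proof (intro conjI allI ballI impI)
  fix s
  have split: "(\<Union>p\<in>{1..n}. ?q p s ` {-1/4..1/4}) =
     (\<Union>p\<in>{i, i + 1}. ?q p s ` {-1/4..1/4}) \<union> (\<Union>p\<in>{1..n} - {i, i + 1}. ?q p s ` {-1/4..1/4})"
    using i by (simp only: UN_Un[symmetric]) (rule arg_cong[of _ _ "\<lambda>A. \<Union>p\<in>A. ?q p s ` {-1/4..1/4}"], auto)
  have "{(real i + 1/2 + (real p - (real i + 1/2)) * cos (pi * of_int k * s) + u,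
        - (real p - (real i + 1/2)) * sin (pi * of_int k * s)) | p u. p \<in> {i, i + 1} \<and> \<bar>u\<bar> \<le> 1/4} =
      (\<Union>p\<in>{i, i + 1}. (\<lambda>u. (real i + 1/2 + (real p - (real i + 1/2)) * cos (pi * of_int k * s) + u,
        - (real p - (real i + 1/2)) * sin (pi * of_int k * s))) ` {-1/4..1/4})"
    unfolding interval_eq by blast
  also have "\<dots> = (\<Union>p\<in>{i, i + 1}. ?q p s ` {-1/4..1/4})"
    by (intro SUP_cong HOL.refl image_cong) simp
  finally have near: "{(real i + 1/2 + (real p - (real i + 1/2)) * cos (pi * of_int k * s) + u,
        - (real p - (real i + 1/2)) * sin (pi * of_int k * s)) | p u. p \<in> {i, i + 1} \<and> \<bar>u\<bar> \<le> 1/4} =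
      (\<Union>p\<in>{i, i + 1}. ?q p s ` {-1/4..1/4})" .
  have "{(real p + u, 0) | p u. p \<in> {1..n} - {i, i + 1} \<and> \<bar>u\<bar> \<le> 1/4} =
      (\<Union>p\<in>{1..n} - {i, i + 1}. (\<lambda>u. (real p + u, 0 :: real)) ` {-1/4..1/4})"
    unfolding interval_eq by blast
  also have "\<dots> = (\<Union>p\<in>{1..n} - {i, i + 1}. ?q p s ` {-1/4..1/4})"
    by (intro SUP_cong HOL.refl image_cong) simp
  finally show "crossing_section n (i, k) s = (\<Union>p\<in>{1..n}. ?q p s ` {-1/4..1/4})"
    unfolding split crossing_section_def Let_def prod.case near by simp
next
  fix p
  show "continuous_on ({0..1} \<times> {-1/4..1/4}) (\<lambda>(s, u). ?q p s u)"
    unfolding case_prod_beta by (cases "p \<in> {i, i + 1}") (simp_all only: if_True if_False, (intro continuous_intros)+)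
next
  fix p and s u :: real assume p: "p \<in> {1..n}" "u \<in> {-1/4..1/4}"
  show "fst (?q p s u) > 0"
  proof (cases "p \<in> {i, i + 1}")
    case True
    then have "\<bar>(real p - (real i + 1/2)) * cos (pi * of_int k * s)\<bar> \<le> 1/2"
      by (intro mult_cos_sin_bound(1)) (auto simp: abs_if)
    moreover have "real i \<ge> 1" "u \<ge> -1/4"
      using i p by auto
    ultimately show ?thesis
      unfolding if_P[OF True] fst_conv by linarith
  next
    case False
    then show ?thesis
      using p by simp
  qed
next
  fix p p' and s u u' :: real
  assume *: "u \<in> {-1/4..1/4}" "u' \<in> {-1/4..1/4}" "?q p s u = ?q p' s u'"
  have b: "\<bar>(real p - (real i + 1/2)) * cos (pi * of_int k * s)\<bar> \<le> 1/2" if "p \<in> {i, i + 1}" for p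
    using that by (intro mult_cos_sin_bound(1)) (auto simp: abs_if)
  \<comment> \<open>A resting core is at least 3/2 from the midpoint, a rotating one radially at
    most 1/2; the difference exceeds the two half-widths 1/4.\<close>
  have far: "\<bar>real p - (real i + 1/2)\<bar> \<ge> 3/2" if "p \<notin> {i, i + 1}" for p
    using that by (cases "p < i") auto
  show "p = p'"
  proof (cases "p \<in> {i, i + 1}"; cases "p' \<in> {i, i + 1}")
    assume pp: "p \<in> {i, i + 1}" "p' \<in> {i, i + 1}"
    show "p = p'"
    proof (rule ccontr)
      assume ne: "p \<noteq> p'"
      \<comment> \<open>The cores lie opposite each other at offsets a and -a. Equal heights force
        the sine to vanish, and then their radial distance is 1, more than the two half-widths
        together.\<close>
      define a where "a = real p - (real i + 1/2)"
      have a: "real p' - (real i + 1/2) = - a" "\<bar>a\<bar> = 1/2"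
        using pp ne by (auto simp: a_def)
      have "- a * sin (pi * of_int k * s) = a * sin (pi * of_int k * s)"
        using *(3) pp a(1) by (simp add: a_def[symmetric])
      moreover have "a \<noteq> 0"
        using a(2) by auto
      ultimately have "sin (pi * of_int k * s) = 0"
        by (metis add.inverse_inverse add_cancel_right_right eq_neg_iff_add_eq_0 mult_eq_0_iff mult_minus_left mult_2 numeral_eq_iff zero_neq_numeral)
      then have "\<bar>cos (pi * of_int k * s)\<bar> = 1"
        by (simp add: sin_zero_abs_cos_one)
      then have "\<bar>2 * a * cos (pi * of_int k * s)\<bar> = 1"
        using a(2) by (simp add: abs_mult)
      moreover define A where "A = a * cos (pi * of_int k * s)"
      moreover have "a * cos (pi * of_int k * s) + u = - a * cos (pi * of_int k * s) + u'"
        using *(3) pp a(1) by (simp add: a_def[symmetric])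
      ultimately show False
        using *(1,2) unfolding mult.assoc mult_minus_left atLeastAtMost_iff A_def[symmetric] by linarith
    qed
  next
    assume pp: "p \<in> {i, i + 1}" "p' \<notin> {i, i + 1}"
    have "real i + 1/2 + (real p - (real i + 1/2)) * cos (pi * of_int k * s) + u = real p' + u'"
      using *(3) unfolding if_P[OF pp(1)] if_not_P[OF pp(2)] by (simp only: prod.inject)
    then show "p = p'"
      using *(1,2) b[OF pp(1)] far[OF pp(2)] unfolding atLeastAtMost_iff by linarith
  next
    assume pp: "p \<notin> {i, i + 1}" "p' \<in> {i, i + 1}"
    have "real i + 1/2 + (real p' - (real i + 1/2)) * cos (pi * of_int k * s) + u' = real p + u"
      using *(3) unfolding if_not_P[OF pp(1)] if_P[OF pp(2)] by (elim Pair_inject) simp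
    then show "p = p'"
      using *(1,2) b[OF pp(2)] far[OF pp(1)] unfolding atLeastAtMost_iff by linarith
  next
    assume pp: "p \<notin> {i, i + 1}" "p' \<notin> {i, i + 1}"
    have "real p + u = real p' + u'"
      using *(3) unfolding if_not_P[OF pp(1)] if_not_P[OF pp(2)] by (simp only: prod.inject)
    then show "p = p'"
      using *(1,2) unfolding atLeastAtMost_iff by (intro real_near_eq) linarith
  qed
next
  fix p :: nat and u :: real
  show "?q p 0 u = (real p + u, 0)" 
    by auto
  show "?q p 1 u = (real (syllable_perm (i, k) p) + u, 0)"
    by (auto simp: cos_sin_int_pi syllable_perm_def Transposition.transpose_def)
next
  show "bij_betw (syllable_perm (i, k)) {1..n} {1..n}"
    using i permutes_imp_bij[OF permutes_swap_id[of i "{1..n}" "i + 1"]]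
    by (auto simp: syllable_perm_def)
qed

section \<open>Gluing the sectors around the axis\<close>

lemma cylindrical_eq:
  assumes "cylindrical \<phi> p = cylindrical \<phi>' p'" "fst p > 0" "fst p' > 0"
  shows "p = p'" "\<exists>N::int. \<phi> = \<phi>' + 2 * pi * of_int N"
proof -
  have eq: "fst p * cos \<phi> = fst p' * cos \<phi>'" "fst p * sin \<phi> = fst p' * sin \<phi>'" "snd p = snd p'"
    using assms(1) by (auto simp: cylindrical_def vec_eq_iff forall_3 case_prod_beta)
  have "r\<^sup>2 = (r * cos \<phi>)\<^sup>2 + (r * sin \<phi>)\<^sup>2" for r \<phi> :: real
    by (simp add: power_mult_distrib flip: distrib_left)
  then have "(fst p)\<^sup>2 = (fst p')\<^sup>2"
    by (metis eq(1,2))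
  then have fst: "fst p = fst p'"
    using assms(2,3) by (simp add: power2_eq_iff_nonneg)
  then show "p = p'"
    using eq(3) by (simp add: prod_eq_iff)
  have "sin \<phi> = sin \<phi>' \<and> cos \<phi> = cos \<phi>'"
    using eq fst assms(2) by auto
  then show "\<exists>N::int. \<phi> = \<phi>' + 2 * pi * of_int N"
    unfolding sin_cos_eq_iff by auto
qed

lemma continuous_on_cylindrical:
  fixes f :: "'a::t2_space \<Rightarrow> real"
  assumes "continuous_on A f" "continuous_on A g"
  shows "continuous_on A (\<lambda>x. cylindrical (f x) (g x))"
proof -
  have "cylindrical \<phi> p = (fst p * cos \<phi>) *\<^sub>R axis 1 1 + (fst p * sin \<phi>) *\<^sub>R axis 2 1 + snd p *\<^sub>R axis 3 1"
    for \<phi> p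
    by (auto simp: cylindrical_def vec_eq_iff forall_3 axis_def case_prod_beta)
  then show ?thesis
    using assms by (simp only:) (intro continuous_intros)
qed

text \<open>Where the string starting at a given place stands at the beginning of sector j.\<close>

definition position :: "(nat \<Rightarrow> nat \<Rightarrow> nat) \<Rightarrow> nat \<Rightarrow> nat \<Rightarrow> nat" where
  "position \<tau> j = fold (\<lambda>i. (\<circ>) (\<tau> i)) [0..<j] id"

lemma position_simps [simp]:
  "position \<tau> 0 = id" "position \<tau> (Suc j) = \<tau> j \<circ> position \<tau> j"
  by (simp_all add: position_def)

locale ribbon_sectors =
  fixes n m :: nat and D :: "nat \<Rightarrow> real \<Rightarrow> (real \<times> real) set"
    and q :: "nat \<Rightarrow> nat \<Rightarrow> real \<Rightarrow> real \<Rightarrow> real \<times> real" and \<tau> :: "nat \<Rightarrow> nat \<Rightarrow> nat"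
  assumes m: "m \<ge> 1"
    and sector: "j < m \<Longrightarrow> ribbon_sector n (D j) (q j) (\<tau> j)"
begin

lemma
  assumes "j < m"
  shows section_eq: "D j s = (\<Union>p\<in>{1..n}. q j p s ` {-1/4..1/4})"
    and bij_sector: "bij_betw (\<tau> j) {1..n} {1..n}"
  using sector[OF assms] unfolding ribbon_sector_def by blast+

lemma
  assumes "j < m" "p \<in> {1..n}"
  shows ribbon_continuous: "continuous_on ({0..1} \<times> {-1/4..1/4}) (\<lambda>(s, u). q j p s u)"
    and ribbon_pos: "u \<in> {-1/4..1/4} \<Longrightarrow> fst (q j p s u) > 0"
    and ribbon_disjoint: "p' \<in> {1..n} \<Longrightarrow> u \<in> {-1/4..1/4} \<Longrightarrow> u' \<in> {-1/4..1/4} \<Longrightarrow>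
      q j p s u = q j p' s u' \<Longrightarrow> p = p'"
    and ribbon_start: "q j p 0 u = (real p + u, 0)"
    and ribbon_end: "q j p 1 u = (real (\<tau> j p) + u, 0)"
  using sector[OF assms(1)] assms(2) unfolding ribbon_sector_def by blast+

definition piece :: "nat \<Rightarrow> nat \<Rightarrow> (real ^ 3) set" where
  "piece j p = (\<lambda>(s, u). cylindrical (2 * pi * (real j + s) / real m) (q j p s u)) ` ({0..1} \<times> {-1/4..1/4})"

text \<open>One string followed once around the axis. It is usually not closed: it ends where the
  strand of its final position begins.\<close>

definition strand :: "nat \<Rightarrow> (real ^ 3) set" where
  "strand p = (\<Union>j<m. piece j (position \<tau> j p))"

lemma mem_piece_iff:
  "x \<in> piece j p \<longleftrightarrow>
     (\<exists>s\<in>{0..1}. \<exists>u\<in>{-1/4..1/4}. x = cylindrical (2 * pi * (real j + s) / real m) (q j p s u))"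
  unfolding piece_def image_iff Bex_def mem_Sigma_iff split_paired_Ex prod.case by blast

lemma piece_subset_strand: "j < m \<Longrightarrow> piece j (position \<tau> j p) \<subseteq> strand p"
  by (auto simp: strand_def)

lemma bij_position: "j \<le> m \<Longrightarrow> bij_betw (position \<tau> j) {1..n} {1..n}"
proof (induction j)
  case (Suc j)
  then show ?case
    unfolding position_simps by (intro bij_betw_trans[OF _ bij_sector]) auto
qed simp

lemma position_in: "j \<le> m \<Longrightarrow> p \<in> {1..n} \<Longrightarrow> position \<tau> j p \<in> {1..n}"
  using bij_position bij_betwE by blast

lemma compact_piece: "compact (piece j p)" and connected_piece: "connected (piece j p)"
  if "j < m" "p \<in> {1..n}"
proof -
  have c: "continuous_on ({0..1} \<times> {-1/4..1/4})
      (\<lambda>(s, u). cylindrical (2 * pi * (real j + s) / real m) (q j p s u))"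
    using m ribbon_continuous[OF that]
    unfolding case_prod_beta by (intro continuous_on_cylindrical continuous_intros) simp_all
  show "compact (piece j p)"
    unfolding piece_def by (intro compact_continuous_image c compact_Times) auto
  have "connected ({0..1::real} \<times> {-1/4..1/4::real})"
    by (intro connected_Times connected_Icc)
  then show "connected (piece j p)"
    unfolding piece_def by (rule connected_continuous_image[OF c])
qed

lemma piece_start: "j < m \<Longrightarrow> p \<in> {1..n} \<Longrightarrow> cylindrical (2 * pi * real j / real m) (real p, 0) \<in> piece j p"
  unfolding piece_def by (intro image_eqI[of _ _ "(0, 0)"]) (simp_all add: ribbon_start)

lemma piece_end: "j < m \<Longrightarrow> p \<in> {1..n} \<Longrightarrow>
    cylindrical (2 * pi * (real j + 1) / real m) (real (\<tau> j p), 0) \<in> piece j p"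
  unfolding piece_def by (intro image_eqI[of _ _ "(1, 0)"]) (simp_all add: ribbon_end)

lemma compact_strand: "p \<in> {1..n} \<Longrightarrow> compact (strand p)"
  unfolding strand_def using position_in by (intro compact_UN compact_piece) auto

lemma connected_strand:
  assumes "p \<in> {1..n}"
  shows "connected (strand p)"
proof -
  have "connected (\<Union>j<k. piece j (position \<tau> j p))" if "k \<le> m" for k
    using that
  proof (induction k)
    case (Suc k)
    show ?case
    proof (cases k)
      case 0
      then show ?thesis
        using connected_piece[of 0 p] Suc.prems assms by (simp add: lessThan_Suc)
    next
      case (Suc k')
      have in_p: "position \<tau> k' p \<in> {1..n}" "position \<tau> k p \<in> {1..n}"
        by (intro position_in assms; use Suc \<open>Suc k \<le> m\<close> in simp)+
      \<comment> \<open>Consecutive pieces share the core point at the angle between their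
        sectors.\<close>
      have "cylindrical (2 * pi * real k / real m) (real (position \<tau> k p), 0)
          \<in> piece k' (position \<tau> k' p) \<inter> piece k (position \<tau> k p)"
        using piece_end[of k' "position \<tau> k' p"] piece_start[of k "position \<tau> k p"] in_p Suc \<open>Suc k \<le> m\<close>
        by (simp add: add.commute)
      moreover have "k' < k"
        using Suc by simp
      ultimately have "(\<Union>j<k. piece j (position \<tau> j p)) \<inter> piece k (position \<tau> k p) \<noteq> {}"
        by blast
      moreover have "(\<Union>j<Suc k. piece j (position \<tau> j p)) =
          (\<Union>j<k. piece j (position \<tau> j p)) \<union> piece k (position \<tau> k p)"
        by (auto simp: lessThan_Suc)
      ultimately show ?thesis
        using Suc.IH connected_piece[of k] in_p \<open>Suc k \<le> m\<close> by (simp add: connected_Un)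
    qed
  qed simp
  then show ?thesis
    by (simp add: strand_def)
qed

text \<open>The angle at the end of the last sector is a full turn, so the end of one strand is the
  start of the next.\<close>

lemma strand_meets_next:
  assumes "p \<in> {1..n}"
  shows "strand p \<inter> strand (position \<tau> m p) \<noteq> {}"
proof -
  obtain m' where m': "m = Suc m'"
    using m by (cases m) auto
  have "cylindrical (2 * pi * (real m' + 1) / real m) (real (position \<tau> m p), 0) \<in> piece m' (position \<tau> m' p)"
    using piece_end[of m' "position \<tau> m' p"] position_in[of m' p] assms m' by simp
  moreover have "cylindrical (2 * pi * real 0 / real m) (real (position \<tau> m p), 0) \<in> piece 0 (position \<tau> m p)"
    using piece_start[OF _ position_in[OF order_refl assms], of 0] m by simp
  moreover have "cylindrical (2 * pi * (real m' + 1) / real m) = cylindrical (2 * pi * real 0 / real m)"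
    using m' by (auto simp: cylindrical_def fun_eq_iff add.commute)
  moreover have "piece m' (position \<tau> m' p) \<subseteq> strand p" "piece 0 (position \<tau> m p) \<subseteq> strand (position \<tau> m p)"
    using piece_subset_strand[of m' p] piece_subset_strand[of 0 "position \<tau> m p"] m' by simp_all
  ultimately show ?thesis
    by (metis disjoint_iff subsetD)
qed

text \<open>Common points have equal angles up to full turns, so the sectors coincide or are
  cyclically adjacent. Within a sector ribbons are disjoint; at a common boundary the cores lie at
  integers and the half-widths 1/4 are too small to reach another one.\<close>

lemma pieces_meet:
  assumes j: "j < m" "j' < m" and p: "p \<in> {1..n}" "p' \<in> {1..n}" and "piece j p \<inter> piece j' p' \<noteq> {}"
  shows "j = j' \<and> p = p' \<or> (j' = Suc j \<or> j = m - 1 \<and> j' = 0) \<and> p' = \<tau> j p \<or>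
    (j = Suc j' \<or> j' = m - 1 \<and> j = 0) \<and> p = \<tau> j' p'"
proof -
  obtain s u s' u' where su: "s \<in> {0..1}" "u \<in> {-1/4..1/4}" "s' \<in> {0..1}" "u' \<in> {-1/4..1/4}"
    and eq: "cylindrical (2 * pi * (real j + s) / real m) (q j p s u) =
      cylindrical (2 * pi * (real j' + s') / real m) (q j' p' s' u')"
    using assms(5) unfolding disjoint_iff mem_piece_iff by metis
  have pos: "fst (q j p s u) > 0" "fst (q j' p' s' u') > 0"
    using ribbon_pos j p su by blast+
  have q: "q j p s u = q j' p' s' u'"
    using cylindrical_eq(1)[OF eq pos] .
  obtain N :: int where "2 * pi * (real j + s) / real m = 2 * pi * (real j' + s') / real m + 2 * pi * of_int N"
    using cylindrical_eq(2)[OF eq pos] by blast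
  then have "2 * pi * (real j + s) = 2 * pi * (real j' + s' + real m * of_int N)"
    using m by (simp add: field_simps)
  then have N: "real j + s = real j' + s' + real m * of_int N"
    by simp
  have jm: "real j + 1 \<le> real m" "real j' + 1 \<le> real m"
    using j by linarith+
  \<comment> \<open>Both j + s and j' + s' lie between 0 and m, so the angles differ by at most one
    full turn.\<close>
  have "real m * of_int N \<le> real m * 1" "real m * (- 1) \<le> real m * of_int N"
    using N jm su unfolding atLeastAtMost_iff by linarith+
  then have "of_int N \<le> (1 :: real)" "- 1 \<le> (of_int N :: real)"
    using m by (simp_all only: mult_le_cancel_left_pos of_nat_0_less_iff less_le_trans[OF zero_less_one])
  then consider "N = 0" | "N = 1" | "N = -1"
    by linarith
  note N_cases = this
  have next_sector: "q' = \<tau> i p''"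
    if "i < m" "i' < m" "p'' \<in> {1..n}" "q' \<in> {1..n}" "q i p'' 1 v = q i' q' 0 v'"
      "v \<in> {-1/4..1/4}" "v' \<in> {-1/4..1/4}" for i i' p'' q' v v'
  proof -
    have "real (\<tau> i p'') + v = real q' + v'"
      using ribbon_end[OF that(1,3), of v] ribbon_start[OF that(2,4), of v'] that(5) by simp
    then show ?thesis
      using that(6,7) by (intro real_near_eq) auto
  qed
  show ?thesis
    using N_cases
  proof cases
    case 1
    then have e: "real j + s = real j' + s'"
      using N by simp
    consider "j = j'" | "j' = Suc j" | "j = Suc j'"
      using e su by fastforce
    then show ?thesis
    proof cases
      case 1
      moreover have "s = s'"
        using e 1 by simp
      ultimately have "p = p'"
        using ribbon_disjoint[OF j(1) p su(2,4)] q 1 by simp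
      then show ?thesis
        using 1 by simp
    next
      case 2
      then have "s = 1" "s' = 0"
        using e su by auto
      then show ?thesis
        using 2 next_sector[OF j p, of u u'] q su by simp
    next
      case 3
      then have "s = 0" "s' = 1"
        using e su by auto
      then show ?thesis
        using 3 next_sector[OF j(2,1) p(2,1), of u' u] q su by simp
    qed
  next
    case 2
    then have "s = 1" "s' = 0" "j = m - 1" "j' = 0"
      using N jm su by auto
    then show ?thesis
      using next_sector[OF j p, of u u'] q su by simp
  next
    case 3
    then have "s = 0" "s' = 1" "j' = m - 1" "j = 0"
      using N jm su by auto
    then show ?thesis
      using next_sector[OF j(2,1) p(2,1), of u' u] q su by simp
  qed
qed

text \<open>Positions are injective in the starting point, so a meeting within a sector or between
  consecutive ones forces equal strands; only the passage from the last sector to the first leads to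
  the next strand.\<close>

lemma strands_meet:
  assumes p: "p \<in> {1..n}" "p' \<in> {1..n}" and meet: "strand p \<inter> strand p' \<noteq> {}"
  shows "p = p' \<or> p' = position \<tau> m p \<or> p = position \<tau> m p'"
proof -
  obtain j j' where j: "j < m" "j' < m" and m': "piece j (position \<tau> j p) \<inter> piece j' (position \<tau> j' p') \<noteq> {}"
    using meet by (auto simp: strand_def)
  have eq: "r = r'" if "position \<tau> i r = position \<tau> i r'" "i \<le> m" "r \<in> {1..n}" "r' \<in> {1..n}" for r r' i
    using that bij_betw_imp_inj_on[OF bij_position, of i] by (auto dest: inj_onD)
  have step: "r = r' \<or> r' = position \<tau> m r"
    if "i < m" "i' < m" "i' = Suc i \<or> i = m - 1 \<and> i' = 0" "position \<tau> i' r' = \<tau> i (position \<tau> i r)"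
      "r \<in> {1..n}" "r' \<in> {1..n}" for i i' r r'
  proof (cases "i' = Suc i")
    case True
    then show ?thesis
      using that eq[of i' r r'] by simp
  next
    case False
    then have "m = Suc i" "i' = 0"
      using that m by auto
    then show ?thesis
      using that(4) by simp
  qed
  consider "j = j'" "position \<tau> j p = position \<tau> j' p'"
    | "j' = Suc j \<or> j = m - 1 \<and> j' = 0" "position \<tau> j' p' = \<tau> j (position \<tau> j p)"
    | "j = Suc j' \<or> j' = m - 1 \<and> j = 0" "position \<tau> j p = \<tau> j' (position \<tau> j' p')"
    using pieces_meet[OF j position_in position_in m'] j p by auto
  then show ?thesis
  proof cases
    case 1
    then show ?thesis
      using eq[of j p p'] j p by simp
  next
    case 2
    then show ?thesis
      using step[OF j 2 p] by blast
  next
    case 3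
    then show ?thesis
      using step[OF j(2,1) 3 p(2,1)] by blast
  qed
qed

text \<open>In each sector the positions run through all strings, so following the strings or
  listing the sections gives the same set.\<close>

lemma Union_strand:
  "(\<Union>p\<in>{1..n}. strand p) =
     (\<Union>j<m. \<Union>s\<in>{0..1}. cylindrical (2 * pi * (real j + s) / real m) ` D j s)"
proof -
  have "(\<Union>p\<in>{1..n}. strand p) = (\<Union>j<m. \<Union>p\<in>position \<tau> j ` {1..n}. piece j p)"
    by (auto simp: strand_def)
  also have "\<dots> = (\<Union>j<m. \<Union>p\<in>{1..n}. piece j p)"
    by (intro SUP_cong HOL.refl bij_betw_imp_surj_on[OF bij_position]) auto
  also have "\<dots> = (\<Union>j<m. \<Union>s\<in>{0..1}. cylindrical (2 * pi * (real j + s) / real m) ` D j s)"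
  proof (rule SUP_cong[OF HOL.refl])
    fix j assume "j \<in> {..<m}"
    then have D: "D j s = (\<Union>p\<in>{1..n}. q j p s ` {-1/4..1/4})" for s
      by (simp only: section_eq lessThan_iff)
    show "(\<Union>p\<in>{1..n}. piece j p) =
        (\<Union>s\<in>{0..1}. cylindrical (2 * pi * (real j + s) / real m) ` D j s)"
      by (simp only: D set_eq_iff UN_iff mem_piece_iff image_iff) blast
  qed
  finally show ?thesis .
qed

text \<open>Distinct strands meet only if one is the successor of the other, so invariance under the
  return permutation is agreement on meeting strands.\<close>

lemma card_invariant_colourings:
  fixes C :: "'c set"
  shows "card {f \<in> {1..n} \<rightarrow>\<^sub>E C. \<forall>p\<in>{1..n}. f (position \<tau> m p) = f p} =
     card C ^ card (components (\<Union>p\<in>{1..n}. strand p))"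
proof -
  have "(\<forall>p\<in>{1..n}. f (position \<tau> m p) = f p) \<longleftrightarrow>
      (\<forall>p\<in>{1..n}. \<forall>p'\<in>{1..n}. strand p \<inter> strand p' \<noteq> {} \<longrightarrow> f p = f p')" for f :: "nat \<Rightarrow> 'c"
    using strands_meet strand_meets_next position_in[OF order_refl] by metis
  moreover have "strand p \<noteq> {}" if "p \<in> {1..n}" for p
    using strand_meets_next[OF that] by blast
  ultimately show ?thesis
    by (simp only: card_colourings_eq_power_components connected_strand
        compact_imp_closed[OF compact_strand] finite_atLeastAtMost not_False_eq_True)
qed

end

lemma card_string_perm_invariant:
  assumes "framed_braid b"
  shows "card {f \<in> {1..strands b} \<rightarrow>\<^sub>E C. \<forall>p\<in>{1..strands b}. f (string_perm (snd b) p) = f p} =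
    card C ^ card (components (braid_closure b))"
proof -
  define n where "n = strands b"
  define m where "m = length (sectors b)"
  \<comment> \<open>Sector 0 holds the twists and permutes nothing. The word is reversed because it
    is read from right to left along the closed braid.\<close>
  define \<tau> where "\<tau> = (\<lambda>j. (id # map syllable_perm (rev (snd b))) ! j)"
  have "\<exists>q. ribbon_sector n (sectors b ! j) q (\<tau> j)" if "j < m" for j
  proof (cases j)
    case 0
    then show ?thesis
      using ribbon_sector_twist[of "fst b"] by (auto simp: sectors_def \<tau>_def n_def strands_def)
  next
    case (Suc j')
    then have "j' < length (snd b)"
      using that by (simp add: m_def sectors_def)
    moreover obtain i k where ik: "rev (snd b) ! j' = (i, k)"
      by fastforce
    ultimately have "(i, k) \<in> set (snd b)"
      by (metis length_rev nth_mem set_rev)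
    then have "1 \<le> i" "i < n"
      using assms by (auto simp: framed_braid_def braid_word_def n_def)
    then show ?thesis
      using ribbon_sector_crossing[of i n k] Suc ik \<open>j' < length (snd b)\<close>
      by (auto simp: sectors_def \<tau>_def n_def)
  qed
  then obtain q where q: "\<And>j. j < m \<Longrightarrow> ribbon_sector n (sectors b ! j) (q j) (\<tau> j)"
    by metis
  interpret ribbon_sectors n m "\<lambda>j. sectors b ! j" q \<tau>
    using q by unfold_locales (auto simp: m_def sectors_def)
  have "m = length (id # map syllable_perm (rev (snd b)))"
    by (simp add: m_def sectors_def)
  then have "position \<tau> m = fold (\<circ>) (id # map syllable_perm (rev (snd b))) id"
    unfolding position_def \<tau>_def by (metis (no_types, lifting) fold_map map_nth comp_def fun_eq_iff)
  also have "\<dots> = string_perm (snd b)"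
    by (simp add: string_perm_def foldr_conv_fold rev_map)
  finally have "position \<tau> m = string_perm (snd b)" .
  moreover have "(\<Union>p\<in>{1..n}. strand p) = braid_closure b"
    unfolding Union_strand by (simp add: braid_closure_def m_def)
  ultimately show ?thesis
    using card_invariant_colourings[of C] by (simp add: n_def)
qed

section \<open>The map and the trace of a framed braid\<close>

lemma int_power_in:
  assumes "bij_betw g V V" "t \<in> V"
  shows "int_power V g k t \<in> V"
proof -
  have "(f ^^ j) t \<in> V" if "\<And>s. s \<in> V \<Longrightarrow> f s \<in> V" for f j
    using that assms(2) by (induction j) auto
  then show ?thesis
    using bij_betwE[OF assms(1)] bij_betwE[OF bij_betw_inv_into[OF assms(1)]] by (simp add: int_power_def)
qed

lemma int_power_succ:
  assumes g: "bij_betw g V V" and t: "t \<in> V"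
  shows "int_power V g (k + 1) t = g (int_power V g k t)"
proof (cases "k \<ge> 0")
  case True
  then show ?thesis
    by (simp add: int_power_def nat_add_distrib)
next
  case False
  define j where "j = nat (- k - 1)"
  have j: "nat (- k) = Suc j"
    using False by (simp add: j_def)
  have "int_power V g (k + 1) t = (inv_into V g ^^ j) t"
  proof (cases "k = - 1")
    case True
    then show ?thesis
      by (simp add: int_power_def j_def)
  next
    case False
    then show ?thesis
      using \<open>\<not> k \<ge> 0\<close> by (simp add: int_power_def j_def)
  qed
  moreover have "(inv_into V g ^^ j) t \<in> V"
    using t bij_betwE[OF bij_betw_inv_into[OF g]] by (induction j) auto
  then have "g (inv_into V g ((inv_into V g ^^ j) t)) = (inv_into V g ^^ j) t"
    using g by (simp add: bij_betw_def f_inv_into_f)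
  ultimately show ?thesis
    using False j by (simp add: int_power_def)
qed

lemma int_power_add:
  assumes g: "bij_betw g V V" and t: "t \<in> V"
  shows "int_power V g k (int_power V g l t) = int_power V g (k + l) t"
proof (induction k rule: int_induct[where k = 0])
  case base
  then show ?case
    by (simp add: int_power_def)
next
  case (step1 k)
  have "int_power V g (k + 1) (int_power V g l t) = g (int_power V g (k + l) t)"
    using int_power_succ[OF g int_power_in[OF g t]] step1 by simp
  also have "\<dots> = int_power V g ((k + l) + 1) t"
    by (rule int_power_succ[OF g t, symmetric])
  finally show ?case
    by (simp add: algebra_simps)
next
  case (step2 k)
  \<comment> \<open>In the downward step both sides are compared after applying g, which is
    injective on V.\<close>
  have "g (int_power V g (k - 1) (int_power V g l t)) = int_power V g (k - 1 + 1) (int_power V g l t)"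
    by (rule int_power_succ[OF g int_power_in[OF g t], symmetric])
  also have "\<dots> = int_power V g (k - 1 + l + 1) t"
    using step2 by (simp add: algebra_simps)
  also have "\<dots> = g (int_power V g (k - 1 + l) t)"
    by (rule int_power_succ[OF g t])
  finally have "g (int_power V g (k - 1) (int_power V g l t)) = g (int_power V g (k - 1 + l) t)" .
  then show ?case
    by (rule inj_onD[OF bij_betw_imp_inj_on[OF g]]) (intro int_power_in[OF g] t)+
qed

lemma int_power_0: "int_power V g 0 = id"
  by (simp add: int_power_def fun_eq_iff)

lemma int_power_1: "int_power V g 1 = g"
  by (simp add: int_power_def fun_eq_iff)

section \<open>Words fixed by a braid and invariant colourings of its strings\<close>

definition swap_at :: "nat \<Rightarrow> 'a list \<Rightarrow> 'a list" where
  "swap_at i xs = (let m = 2 * (i - 1) in take m xs @ swap_pairs (take 4 (drop m xs)) @ drop (m + 4) xs)"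

text \<open>A string carries two factors of X, so its colour is a pair of letters; hence the
  exponent is twice the number of components.\<close>

definition strand_colour :: "'a list \<Rightarrow> nat \<Rightarrow> 'a \<times> 'a" where
  "strand_colour xs p = (xs ! (2 * (p - 1)), xs ! (2 * (p - 1) + 1))"

lemma swap_at_split:
  "length as = 2 * (i - 1) \<Longrightarrow> swap_at i (as @ x # y # z # w # bs) = as @ z # w # x # y # bs"
  by (simp add: swap_at_def Let_def swap_pairs_def)

lemma split_at_strand:
  assumes "length xs = 2 * n" "1 \<le> i" "i < n"
  obtains as x y z w bs where "xs = as @ x # y # z # w # bs" "length as = 2 * (i - 1)"
proof -
  have "length (drop (2 * (i - 1)) xs) = 4 + (2 * n - 2 * (i - 1) - 4)"
    using assms by simp
  then obtain x y z w bs where "drop (2 * (i - 1)) xs = x # y # z # w # bs"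
    by (rule split_4)
  then have "xs = take (2 * (i - 1)) xs @ x # y # z # w # bs"
    by (metis append_take_drop_id)
  moreover have "length (take (2 * (i - 1)) xs) = 2 * (i - 1)"
    using assms by simp
  ultimately show ?thesis
    by (rule that)
qed

lemma
  assumes "length xs = 2 * n" "1 \<le> i" "i < n"
  shows mset_swap_at: "mset (swap_at i xs) = mset xs"
    and swap_at_swap_at: "swap_at i (swap_at i xs) = xs"
    and strand_colour_swap_at: "p \<in> {1..n} \<Longrightarrow>
      strand_colour (swap_at i xs) (Transposition.transpose i (i + 1) p) = strand_colour xs p"
proof -
  obtain as x y z w bs where xs: "xs = as @ x # y # z # w # bs" "length as = 2 * (i - 1)"
    using split_at_strand[OF assms] .
  show "mset (swap_at i xs) = mset xs" "swap_at i (swap_at i xs) = xs"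
    by (simp_all add: xs swap_at_split)
  have l1: "2 * (i - 1) = length as" and l2: "2 * i = length as + 2"
    using xs(2) assms(2) by auto
  assume p: "p \<in> {1..n}"
  consider "p < i" | "p = i" | "p = i + 1" | "p > i + 1"
    by linarith
  then show "strand_colour (swap_at i xs) (Transposition.transpose i (i + 1) p) = strand_colour xs p"
  proof cases
    case 1
    then have "p - 1 < i - 1"
      using p by auto
    then have "2 * (p - 1) + 1 < 2 * (i - 1)"
      by linarith
    then show ?thesis
      using 1 by (simp add: xs swap_at_split strand_colour_def nth_append)
  next
    case 2
    then show ?thesis
      using l1 l2 by (simp add: xs(1) swap_at_split[OF xs(2)] strand_colour_def nth_append numeral_eq_Suc)
  next
    case 3
    then show ?thesis
      using l1 l2 by (simp add: xs(1) swap_at_split[OF xs(2)] strand_colour_def nth_append numeral_eq_Suc)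
  next
    case 4
    define d where "d = p - i - 2"
    have "2 * (p - 1) = length as + 4 + 2 * d"
      using 4 assms xs(2) by (simp add: d_def)
    moreover have "Transposition.transpose i (i + 1) p = p"
      using 4 by (simp add: Transposition.transpose_def)
    ultimately show ?thesis
      by (simp add: xs(1) swap_at_split[OF xs(2)] strand_colour_def nth_append numeral_eq_Suc)
  qed
qed

lemma strand_index_less:
  fixes p n :: nat
  assumes "p \<in> {1..n}"
  shows "2 * (p - 1) < 2 * n" "2 * (p - 1) + 1 < 2 * n"
proof -
  have "p - 1 < n"
    using assms by auto
  then show "2 * (p - 1) < 2 * n" "2 * (p - 1) + 1 < 2 * n"
    by linarith+
qed

lemma list_eq_strand_colour:
  assumes "length xs = 2 * n" "length ys = 2 * n" "\<And>p. p \<in> {1..n} \<Longrightarrow> strand_colour xs p = strand_colour ys p"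
  shows "xs = ys"
proof (rule nth_equalityI)
  fix k assume "k < length xs"
  then have "k div 2 + 1 \<in> {1..n}"
    using assms(1) by auto
  then have *: "xs ! (2 * (k div 2)) = ys ! (2 * (k div 2)) \<and> xs ! (2 * (k div 2) + 1) = ys ! (2 * (k div 2) + 1)"
    using assms(3)[of "k div 2 + 1"] by (simp add: strand_colour_def)
  show "xs ! k = ys ! k"
  proof (cases "even k")
    case True
    then have "k = 2 * (k div 2)"
      by simp
    then show ?thesis
      using * by metis
  next
    case False
    then have "k = 2 * (k div 2) + 1"
      by (metis odd_two_times_div_two_succ)
    then show ?thesis
      using * by metis
  qed
qed (simp add: assms)

lemma syllable_perm_funpow: "syllable_perm (i, k) = Transposition.transpose i (i + 1) ^^ nat \<bar>k\<bar>"
proof -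
  have "Transposition.transpose i (i + 1) ^^ j = (if odd j then Transposition.transpose i (i + 1) else id)" for j
    by (induction j) (auto simp: fun_eq_iff)
  moreover have "even (nat \<bar>k\<bar>) \<longleftrightarrow> even k"
    by (simp add: even_nat_iff)
  ultimately show ?thesis
    by (simp add: syllable_perm_def)
qed

definition swap_word :: "(nat \<times> int) list \<Rightarrow> 'a list \<Rightarrow> 'a list" where
  "swap_word w = foldr (\<circ>) (map (\<lambda>(i, k). swap_at i ^^ nat \<bar>k\<bar>) w) id"

lemma transpose_in_range:
  fixes i n q :: nat
  shows "1 \<le> i \<Longrightarrow> i < n \<Longrightarrow> q \<in> {1..n} \<Longrightarrow> Transposition.transpose i (i + 1) q \<in> {1..n}"
  by (auto simp: Transposition.transpose_def)

lemma strand_colour_syllable: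
  assumes "length xs = 2 * n" "1 \<le> i" "i < n" "p \<in> {1..n}"
  shows "length ((swap_at i ^^ j) xs) = 2 * n \<and> (Transposition.transpose i (i + 1) ^^ j) p \<in> {1..n} \<and>
    strand_colour ((swap_at i ^^ j) xs) ((Transposition.transpose i (i + 1) ^^ j) p) = strand_colour xs p"
proof (induction j)
  case (Suc j)
  let ?ys = "(swap_at i ^^ j) xs" and ?q = "(Transposition.transpose i (i + 1) ^^ j) p"
  have "length (swap_at i ?ys) = 2 * n"
    using mset_eq_length[OF mset_swap_at[of ?ys n i]] Suc assms by simp
  moreover have "Transposition.transpose i (i + 1) ?q \<in> {1..n}"
    using Suc assms by (intro transpose_in_range) auto
  moreover have "strand_colour (swap_at i ?ys) (Transposition.transpose i (i + 1) ?q) = strand_colour ?ys ?q"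
    using Suc assms by (intro strand_colour_swap_at) auto
  ultimately show ?case
    using Suc by simp
qed (use assms in simp)

text \<open>The rearrangement of pairs transports the colour of each string to the place where that
  string ends.\<close>

lemma strand_colour_word:
  assumes "braid_word n w" "length xs = 2 * n" "p \<in> {1..n}"
  shows "length (swap_word w xs) = 2 * n \<and> string_perm w p \<in> {1..n} \<and>
    strand_colour (swap_word w xs) (string_perm w p) = strand_colour xs p"
  using assms(1)
proof (induction w)
  case Nil
  then show ?case
    using assms by (simp add: swap_word_def string_perm_def)
next
  case (Cons s w)
  obtain i k where s: "s = (i, k)"
    by fastforce
  have IH: "length (swap_word w xs) = 2 * n" "string_perm w p \<in> {1..n}"
      "strand_colour (swap_word w xs) (string_perm w p) = strand_colour xs p"
    and i: "1 \<le> i" "i < n"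
    using Cons by (auto simp: braid_word_def s)
  have "swap_word (s # w) xs = (swap_at i ^^ nat \<bar>k\<bar>) (swap_word w xs)"
    "string_perm (s # w) p = (Transposition.transpose i (i + 1) ^^ nat \<bar>k\<bar>) (string_perm w p)"
    by (simp_all add: swap_word_def string_perm_def s syllable_perm_funpow del: One_nat_def add_Suc_right)
  then show ?case
    using strand_colour_syllable[OF IH(1) i IH(2), of "nat \<bar>k\<bar>"] IH(3) by (simp only:)
qed

lemma inj_string_perm: "inj (string_perm w)"
proof (induction w)
  case (Cons s w)
  have "inj (syllable_perm s)"
    by (cases s) (simp add: syllable_perm_def)
  moreover have "string_perm (s # w) = syllable_perm s \<circ> string_perm w"
    by (simp add: string_perm_def)
  ultimately show ?case
    using Cons by (simp only: inj_compose)
qed (simp add: string_perm_def)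

text \<open>The letters at place q after the rearrangement are those of the string ending there, and
  every place is such an end because an injective self-map of a finite set is onto.\<close>

lemma swap_word_fixed_iff:
  assumes w: "braid_word n w" and xs: "length xs = 2 * n"
  shows "swap_word w xs = xs \<longleftrightarrow> (\<forall>p\<in>{1..n}. strand_colour xs (string_perm w p) = strand_colour xs p)"
proof
  assume "swap_word w xs = xs"
  then show "\<forall>p\<in>{1..n}. strand_colour xs (string_perm w p) = strand_colour xs p"
    using strand_colour_word[OF w xs] by metis
next
  assume *: "\<forall>p\<in>{1..n}. strand_colour xs (string_perm w p) = strand_colour xs p"
  show "swap_word w xs = xs"
  \<comment> \<open>Without strings there are no generators, so the word is empty.\<close>
  proof (cases "n = 0")
    case True
    then show ?thesis
      using w xs by (cases w) (auto simp: swap_word_def braid_word_def)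
  next
    case False
    have sub: "string_perm w ` {1..n} \<subseteq> {1..n}"
      using strand_colour_word[OF w xs] by blast
    have surj: "string_perm w ` {1..n} = {1..n}"
      by (rule endo_inj_surj[OF _ sub inj_on_subset[OF inj_string_perm]]) auto
    show ?thesis
    proof (rule list_eq_strand_colour)
      show "length (swap_word w xs) = 2 * n"
        using strand_colour_word[OF w xs, of 1] False by simp
      fix q assume "q \<in> {1..n}"
      then obtain p where "p \<in> {1..n}" "q = string_perm w p"
        using surj by blast
      then show "strand_colour (swap_word w xs) q = strand_colour xs q"
        using strand_colour_word[OF w xs, of p] * by simp
    qed (rule xs)
  qed
qed

lemma card_words_fixed:
  assumes w: "braid_word n w"
  shows "card {I \<in> words B (2 * n). swap_word w I = I} =
    card {f \<in> {1..n} \<rightarrow>\<^sub>E B \<times> B. \<forall>p\<in>{1..n}. f (string_perm w p) = f p}"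
proof (cases "n = 0")
  case True
  then show ?thesis
    using w by (cases w) (auto simp: swap_word_def braid_word_def words_0)
next
  case False
  have len: "length I = 2 * n" if "I \<in> words B (2 * n)" for I
    using that by (simp add: words_def)
  \<comment> \<open>This concerns the permutation alone; a list of units supplies the word that the
    lemma asks for.\<close>
  have perm: "string_perm w p \<in> {1..n}" if "p \<in> {1..n}" for p
    using strand_colour_word[OF w length_replicate[of "2 * n" "()"] that] by blast
  have "bij_betw (\<lambda>I. restrict (strand_colour I) {1..n}) {I \<in> words B (2 * n). swap_word w I = I}
      {f \<in> {1..n} \<rightarrow>\<^sub>E B \<times> B. \<forall>p\<in>{1..n}. f (string_perm w p) = f p}" (is "bij_betw ?r ?A ?B")
    unfolding bij_betw_def
  proof
    show "inj_on ?r ?A"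
    proof (rule inj_onI)
      fix I J assume IJ: "I \<in> ?A" "J \<in> ?A" "?r I = ?r J"
      have "strand_colour I p = strand_colour J p" if "p \<in> {1..n}" for p
        using fun_cong[OF IJ(3), of p] that by simp
      then show "I = J"
        using IJ(1,2) len by (intro list_eq_strand_colour[of I n J]) auto
    qed
    show "?r ` ?A = ?B"
    proof (intro equalityI subsetI)
      fix f assume "f \<in> ?r ` ?A"
      then obtain I where I: "I \<in> words B (2 * n)" "swap_word w I = I" "f = ?r I"
        by blast
      have "I ! k \<in> B" if "k < 2 * n" for k
        using I(1) that by (auto simp: words_def)
      moreover note strand_index_less
      ultimately have "strand_colour I p \<in> B \<times> B" if "p \<in> {1..n}" for p
        using that by (simp only: strand_colour_def mem_Sigma_iff)
      moreover have "f (string_perm w p) = f p" if "p \<in> {1..n}" for p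
        using swap_word_fixed_iff[OF w len[OF I(1)]] I(2,3) that perm[OF that] by simp
      ultimately show "f \<in> ?B"
        using I(3) by (auto simp: PiE_iff)
    next
      fix f assume f: "f \<in> ?B"
      \<comment> \<open>Entry k belongs to string k div 2 + 1, as its first letter for even k and as
        its second for odd k.\<close>
      define I where "I = map (\<lambda>k. if even k then fst (f (k div 2 + 1)) else snd (f (k div 2 + 1))) [0..<2 * n]"
      have "f p \<in> B \<times> B" if "p \<in> {1..n}" for p
        using f that by (auto simp: PiE_iff)
      then have "I \<in> words B (2 * n)"
        by (fastforce simp: I_def words_def mem_Times_iff)
      moreover have colour: "strand_colour I p = f p" if "p \<in> {1..n}" for p
        using that strand_index_less[OF that] by (simp add: I_def strand_colour_def)
      moreover have "?r I = f"
      proof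
        fix p
        have "f \<in> extensional {1..n}"
          using f by (simp add: PiE_def)
        then show "?r I p = f p"
          using colour[of p] extensional_arb[of f "{1..n}" p] by (simp only: restrict_def split: if_split) simp
      qed
      moreover have "swap_word w I = I"
        using swap_word_fixed_iff[OF w, of I] f colour perm by (simp add: I_def[THEN arg_cong[of _ _ length]])
      ultimately show "f \<in> ?r ` ?A"
        by blast
    qed
  qed
  then show ?thesis
    by (rule bij_betw_same_card)
qed

section \<open>Triangularity, trace and invariance for framed braids\<close>

context finite_ternary_shelf
begin

lemma triangular_R_map:
  assumes "1 \<le> i" "i < n"
  shows "triangular (2 * n) (R_map sc T n i) (swap_at i)"
proof (rule triangularI[OF linear_R_map])
  fix xs :: "('k \<times> 'l) list" assume xs: "xs \<in> homogeneous_lists (2 * n)"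
  then have len: "length xs = 2 * n"
    by (simp add: homogeneous_lists_def)
  show "mset (swap_at i xs) = mset xs" "swap_at i (swap_at i xs) = xs"
    by (rule mset_swap_at[OF len assms] swap_at_swap_at[OF len assms])+
  show "R_map sc T n i (pure xs) - pure (swap_at i xs) \<in> low (2 * n) (deg xs)"
    unfolding R_map_pure[OF assms len] swap_at_def Let_def
    using assms by (intro local_op_low[OF lowering_op_R xs]) auto
qed (rule R_map_in[OF assms])

lemma triangular_\<theta>_map:
  assumes "1 \<le> i" "i \<le> n"
  shows "triangular (2 * n) (\<theta>_map sc T n i) id"
proof (rule triangularI[OF linear_\<theta>_map])
  fix xs :: "('k \<times> 'l) list" assume xs: "xs \<in> homogeneous_lists (2 * n)"
  then have len: "length xs = 2 * n"
    by (simp add: homogeneous_lists_def)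
  let ?m = "2 * (i - 1)"
  have "(\<Sum>ys\<leftarrow>\<theta>_local i xs. pure ys) - pure (take ?m xs @ id (take 2 (drop ?m xs)) @ drop (?m + 2) xs) \<in> low (2 * n) (deg xs)"
    using assms by (intro local_op_low[OF lowering_op_\<theta> xs]) auto
  moreover have "drop (?m + 2) xs = drop 2 (drop ?m xs)"
    by (simp only: drop_drop add.commute)
  ultimately show "\<theta>_map sc T n i (pure xs) - pure (id xs) \<in> low (2 * n) (deg xs)"
    unfolding \<theta>_map_pure[OF assms len] by (simp only: id_apply append_take_drop_id)
qed (simp_all add: \<theta>_map_in[OF assms])

definition word_map :: "nat \<Rightarrow> (nat \<times> int) list \<Rightarrow> ('k, 'k \<times> 'l) tensor \<Rightarrow> ('k, 'k \<times> 'l) tensor" where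
  "word_map n w = foldr (\<circ>) (map (\<lambda>(i, k). int_power (V (2 * n)) (R_map sc T n i) k) w) id"

definition twist_map :: "int list \<Rightarrow> ('k, 'k \<times> 'l) tensor \<Rightarrow> ('k, 'k \<times> 'l) tensor" where
  "twist_map ts = (let n = length ts in
     foldr (\<circ>) (map (\<lambda>i. int_power (V (2 * n)) (\<theta>_map sc T n i) (ts ! (i - 1))) [1..<n + 1]) id)"

lemma Psi_map_eq: "Psi_map sc T b = word_map (strands b) (snd b) \<circ> twist_map (fst b)"
  by (simp add: Psi_map_def word_map_def twist_map_def strands_def Let_def)

lemma word_map_simps:
  "word_map n [] = id" "word_map n ((i, k) # w) = int_power (V (2 * n)) (R_map sc T n i) k \<circ> word_map n w"
  by (simp_all add: word_map_def)

lemma word_map_append: "word_map n (u @ w) = word_map n u \<circ> word_map n w"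
  by (induction u) (auto simp: word_map_simps comp_assoc)

lemma triangular_word_map:
  assumes "braid_word n w"
  shows "triangular (2 * n) (word_map n w) (swap_word w)"
  using assms
proof (induction w)
  case Nil
  have "swap_word [] = (id :: ('k \<times> 'l) list \<Rightarrow> _)"
    by (rule HOL.ext) (simp add: swap_word_def)
  then show ?case
    using triangular_id by (simp only: word_map_simps)
next
  case (Cons s w)
  obtain i k where s: "s = (i, k)"
    by fastforce
  have i: "1 \<le> i" "i < n" and IH: "triangular (2 * n) (word_map n w) (swap_word w)"
    using Cons by (auto simp: braid_word_def s)
  have "triangular (2 * n) (int_power (V (2 * n)) (R_map sc T n i) k) (swap_at i ^^ nat \<bar>k\<bar>)"
  proof (rule triangular_int_power[OF triangular_R_map[OF i]])
    show "swap_at i (swap_at i xs) = xs" if "xs \<in> homogeneous_lists (2 * n)" for xs :: "('k \<times> 'l) list"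
      using that by (intro swap_at_swap_at[OF _ i]) (simp add: homogeneous_lists_def)
  qed
  moreover have "swap_word (s # w) = (swap_at i ^^ nat \<bar>k\<bar>) \<circ> (swap_word w :: ('k \<times> 'l) list \<Rightarrow> _)"
    by (rule HOL.ext) (simp add: swap_word_def s)
  ultimately show ?case
    using triangular_comp[OF _ IH] by (simp only: s word_map_simps)
qed

text \<open>All powers of \<theta> have the identity as leading term, so the framing leaves no mark
  on the trace.\<close>

lemma triangular_twist_map: "triangular (2 * length ts) (twist_map ts) id"
proof -
  have foldr: "triangular N (foldr (\<circ>) (map g is) id) id" if "\<And>i. i \<in> set is \<Longrightarrow> triangular N (g i) id" for N g and "is" :: "nat list"
    using that
  proof (induction "is")
    case (Cons i "is")
    have "triangular N (g i) id"
      by (rule Cons.prems) (rule list.set_intros)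
    moreover have "triangular N (foldr (\<circ>) (map g is) id) id"
      by (rule Cons.IH) (rule Cons.prems, rule list.set_intros)
    ultimately have "triangular N (g i \<circ> foldr (\<circ>) (map g is) id) (id \<circ> id)"
      by (rule triangular_comp)
    moreover have "foldr (\<circ>) (map g (i # is)) id = g i \<circ> foldr (\<circ>) (map g is) id"
      by (rule HOL.ext) simp
    ultimately show ?case
      by (simp only: id_comp)
  next
    case Nil
    have "foldr (\<circ>) (map g []) id = id"
      by (rule HOL.ext) simp
    then show ?case
      by (simp only: triangular_id)
  qed
  have "triangular (2 * length ts) (int_power (V (2 * length ts)) (\<theta>_map sc T (length ts) i) k) id"
    if i: "i \<in> set [1..<length ts + 1]" for i k
  proof -
    have "1 \<le> i" "i \<le> length ts"
      using i by auto
    from triangular_int_power[OF triangular_\<theta>_map[OF this], of k] show ?thesis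
      by (simp only: id_funpow id_apply)
  qed
  then show ?thesis
    unfolding twist_map_def Let_def by (intro foldr)
qed

lemma triangular_Psi_map:
  assumes "framed_braid b"
  shows "triangular (2 * strands b) (Psi_map sc T b) (swap_word (snd b))"
proof -
  have "triangular (2 * strands b) (word_map (strands b) (snd b)) (swap_word (snd b))"
    using assms by (intro triangular_word_map) (simp add: framed_braid_def)
  from triangular_comp[OF this triangular_twist_map[of "fst b", folded strands_def]] show ?thesis
    by (simp only: Psi_map_eq comp_id)
qed

text \<open>Fixed basis words are colourings of the strings by pairs of basis vectors of X,
  invariant under the permutation, and these are counted by the components. The count is read in the
  field, so it may vanish in positive characteristic.\<close>

lemma Psi_trace_eq:
  assumes "framed_braid b"
  shows "Psi_trace sc T b = of_nat (card (basisX \<times> basisX) ^ card (components (braid_closure b)))"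
proof -
  have "braid_word (strands b) (snd b)"
    using assms by (simp add: framed_braid_def)
  then show ?thesis
    unfolding Psi_trace_def triangular_trace[OF triangular_Psi_map[OF assms]]
    by (simp only: card_words_fixed card_string_perm_invariant[OF assms])
qed

lemma bij_R_map: "1 \<le> i \<Longrightarrow> i < n \<Longrightarrow> bij_betw (R_map sc T n i) (V (2 * n)) (V (2 * n))"
  using triangular_R_map unfolding triangular_def by blast

lemma word_map_in: "braid_word n w \<Longrightarrow> t \<in> V (2 * n) \<Longrightarrow> word_map n w t \<in> V (2 * n)"
  using triangular_word_map unfolding triangular_def linear_on_V_def by blast

text \<open>Validity of both words belongs to the induction because the maps of the context must
  preserve the tensor power, on which alone the relations hold.\<close>

lemma braid_eq_word_map:
  assumes "braid_eq n w w'"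
  shows "braid_word n w \<and> braid_word n w' \<and> (\<forall>t\<in>V (2 * n). word_map n w t = word_map n w' t)"
  using assms
proof (induction rule: braid_eq.induct)
  case (congruence u v w w')
  then have "braid_word n (u @ w @ v)" "braid_word n (u @ w' @ v)"
    by (auto simp: braid_word_def)
  moreover have "word_map n (u @ w @ v) t = word_map n (u @ w' @ v) t" if "t \<in> V (2 * n)" for t
    using congruence word_map_in[of n v t] that by (simp add: word_map_append)
  ultimately show ?case
    by blast
next
  case (power_0 i)
  then show ?case
    by (simp add: braid_word_def word_map_simps int_power_0)
next
  case (power_add i k l)
  then show ?case
    using int_power_add[OF bij_R_map[OF power_add]] by (simp add: braid_word_def word_map_simps)
next
  case (commute i j)
  then show ?case
    using R_map_commute[of i j n] by (simp add: braid_word_def word_map_simps int_power_1)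
next
  case (braid i)
  then have "word_map n [(i, 1), (i + 1, 1), (i, 1)] t = word_map n [(i + 1, 1), (i, 1), (i + 1, 1)] t"
    if "t \<in> V (2 * n)" for t
    using R_map_braid[OF braid that] by (simp only: word_map_simps int_power_1 o_apply id_apply)
  then show ?case
    using braid by (simp add: braid_word_def)
qed auto

lemma Psi_map_cong:
  assumes "framed_braid_eq b b'" "t \<in> V (2 * strands b)"
  shows "Psi_map sc T b t = Psi_map sc T b' t"
proof -
  have eq: "fst b = fst b'" "strands b = strands b'" "braid_eq (strands b) (snd b) (snd b')"
    using assms(1) by (auto simp: framed_braid_eq_def strands_def)
  have "twist_map (fst b) t \<in> V (2 * strands b)"
    using triangular_twist_map[of "fst b"] assms(2) unfolding triangular_def linear_on_V_def strands_def by blast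
  then show ?thesis
    using braid_eq_word_map[OF eq(3)] by (simp add: Psi_map_eq eq(1,2))
qed

text \<open>The braid selected by \<open>Psi_link\<close> may have another number of strings; its
  closure is isotopic to the same link, so the numbers of components, and with them the traces,
  agree.\<close>

lemma Psi_trace_eq_Psi_link:
  assumes "framed_braid b" "isotopic (braid_closure b) S"
  shows "Psi_trace sc T b = Psi_link sc T S"
proof -
  define c where "c = (SOME b. framed_braid b \<and> isotopic (braid_closure b) S)"
  have c: "framed_braid c \<and> isotopic (braid_closure c) S"
    unfolding c_def by (rule someI[of _ b]) (intro conjI assms)
  have "card (components (braid_closure b)) = card (components (braid_closure c))"
    using isotopic_card_components[OF assms(2)] isotopic_card_components c by metis
  then show ?thesis
    using Psi_trace_eq assms(1) c by (simp add: Psi_link_def c_def[symmetric])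
qed

end

text \<open>Isotopic links admit the same framed braids, so \<open>SOME\<close> selects the same
  braid for both.\<close>

lemma Psi_link_cong:
  assumes "isotopic S S'"
  shows "Psi_link sc T S = Psi_link sc T S'"
proof -
  have "(\<lambda>b. framed_braid b \<and> isotopic (braid_closure b) S) = (\<lambda>b. framed_braid b \<and> isotopic (braid_closure b) S')"
    using isotopic_trans isotopic_sym assms by blast
  then show ?thesis
    by (simp only: Psi_link_def)
qed

theorem corollary5p6:
  fixes sc :: "'k::field \<Rightarrow> 'l::ab_group_add \<Rightarrow> 'l"
    and Basis :: "'l set"
    and bracket2 :: "'l \<Rightarrow> 'l \<Rightarrow> 'l"
    and bracket3 :: "'l \<Rightarrow> 'l \<Rightarrow> 'l \<Rightarrow> 'l"
    and T :: "'k \<times> 'l \<Rightarrow> 'k \<times> 'l \<Rightarrow> 'k \<times> 'l \<Rightarrow> 'k \<times> 'l"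
  assumes "finite_dimensional_vector_space sc Basis"
    and "(lie_algebra sc bracket2 \<and> T = lie_T sc bracket2) \<or>
         (three_lie_algebra sc bracket3 \<and> T = three_lie_T sc bracket3)"
  shows "(\<forall>b b'. framed_braid b \<and> framed_braid b' \<and> framed_braid_eq b b' \<longrightarrow>
           (\<forall>t \<in> tensor_power (scaleX sc) (2 * strands b).
              Psi_map sc T b t = Psi_map sc T b' t)) \<and>
         (\<forall>S b. framed_link S \<and> framed_braid b \<and> isotopic (braid_closure b) S \<longrightarrow>
           trace_on scale_tensor (tensor_power (scaleX sc) (2 * strands b)) (Psi_map sc T b)
             = Psi_link sc T S) \<and>
         (\<forall>S S'. framed_link S \<and> framed_link S' \<and> isotopic S S' \<longrightarrow>
           Psi_link sc T S = Psi_link sc T S')"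
proof -
  have "ternary_shelf sc T"
    using assms(2) lie_algebra.ternary_shelf_lie_T three_lie_algebra.ternary_shelf_three_lie_T by blast
  then interpret finite_ternary_shelf sc T Basis
    using assms(1) by (rule finite_ternary_shelf.intro)
  show ?thesis
    using Psi_map_cong Psi_trace_eq_Psi_link Psi_link_cong unfolding Psi_trace_def by blast
qed

end
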